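(* Let $\Omega\subset\mathbb{R}^n$, $n\ge 2$, be a nonempty open bounded convex set with inradius $R_\Omega$. Then there exists a unique value $r^*\in(0,R_\Omega)$ such that $$\frac{|\partial\Omega_{r^*}|}{|\Omega_{r^*}|}=\frac1{r^*},$$ and the constant $\Lambda_\infty:=\inf\{\Lambda>0:\ (P)_\Lambda \text{ admits a non-constant solution}\}$ equals $$\Lambda^*:=\frac{1}{r^*\,|\Omega_{r^*}|}.$$ More precisely: (i) for $0<\Lambda<\Lambda^*$, the constant function $u\equiv 1$ is the unique solution of $(P)_\Lambda$; (ii) for $\Lambda=\Lambda^*$, $(P)_\Lambda$ admits the constant solution $u\equiv1$ and the non-constant solution $v_{r^*}$; (iii) for $\Lambda>\Lambda^*$, $u\equiv 1$ is not a solution of $(P)_\Lambda$, and $(P)_\Lambda$ admits the non-constant solution $v_{r_\Lambda}$, where $r_\Lambda$ is the smallest root $r\in(0,R_\Omega)$ of the equation $\frac{1}{r^2|\partial\Omega_r|}=\Lambda$. Moreover, for every $\Lambda\ge\Lambda^*$, any non-constant solution $v$ of $(P)_\Lambda$ satisfies $$\|\nabla v\|_\infty=\frac1{r_\Lambda}\qquad\text{and}\qquad \{x\in\Omega: v(x)>0\}=D_{r_\Lambda},$$ where $r_{\Lambda^*}=r^*$.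
   Context: $\mathrm{Lip}_1(\Omega):=\{u\in W^{1,\infty}(\Omega):\ u\ge0 \text{ in }\Omega,\ u=1\text{ on }\partial\Omega\}$; its elements are identified with their continuous representatives on $\overline\Omega$. For $\Lambda>0$ and $u\in\mathrm{Lip}_1(\Omega)$ set $J_\Lambda(u):=\|\nabla u\|_\infty+\Lambda\,|\{x\in\Omega:u(x)>0\}|$, where $\|\cdot\|_\infty$ is the $L^\infty(\Omega)$ norm and $|\cdot|$ is Lebesgue measure. Problem $(P)_\Lambda$ is to minimize $J_\Lambda$ over $\mathrm{Lip}_1(\Omega)$; a solution of $(P)_\Lambda$ is a minimizer. For $r\in[0,R_\Omega]$: $\Omega_r:=\{x\in\Omega:\mathrm{dist}(x,\partial\Omega)>r\}$, and $D_r:=\Omega\setminus\overline{\Omega_r}$. For $r\in(0,R_\Omega]$: $v_r(x):=\left[1-\frac1r\mathrm{dist}(x,\partial\Omega)\right]_+$, $x\in\overline\Omega$. $|\Omega_r|$ denotes Lebesgue measure and $|\partial\Omega_r|$ the $(n-1)$-dimensional Hausdorff measure of $\partial\Omega_r$. The inradius $R_\Omega$ is the maximum of $\mathrm{dist}(\cdot,\partial\Omega)$ over $\Omega$. *)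

theory Defs
  imports "HOL-Analysis.Analysis" "HOL-Probability.Essential_Supremum"
begin

section \<open>The spaces $L^\infty$ and $W^{1,\infty}$\<close>

definition Linf_norm :: "'a measure \<Rightarrow> ('a \<Rightarrow> 'b::real_normed_vector) \<Rightarrow> ereal" where
  "Linf_norm M f = esssup M (\<lambda>x. ereal (norm (f x)))"

definition Linf :: "'a measure \<Rightarrow> ('a \<Rightarrow> 'b::real_normed_vector) set" where
  "Linf M = {f. f \<in> borel_measurable M \<and> Linf_norm M f < \<infinity>}"

primrec k_times_cont_diff :: "nat \<Rightarrow> ('a::euclidean_space \<Rightarrow> real) \<Rightarrow> bool" where
  "k_times_cont_diff 0 f \<longleftrightarrow> continuous_on UNIV f"
| "k_times_cont_diff (Suc k) f \<longleftrightarrow>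
     (\<forall>x. f differentiable (at x)) \<and>
     (\<forall>i\<in>Basis. k_times_cont_diff k (\<lambda>x. frechet_derivative f (at x) i))"

definition test_functions :: "'a::euclidean_space set \<Rightarrow> ('a \<Rightarrow> real) set" where
  "test_functions \<Omega> =
     {\<phi>. (\<forall>k. k_times_cont_diff k \<phi>) \<and>
          compact (closure {x. \<phi> x \<noteq> 0}) \<and> closure {x. \<phi> x \<noteq> 0} \<subseteq> \<Omega>}"

text \<open>
  The vector field \<open>g\<close> is the distributional gradient of \<open>u\<close> on \<open>\<Omega>\<close>; its component in the
  direction of a basis vector \<open>i\<close> is \<open>g x \<bullet> i\<close>. Only essentially bounded \<open>u\<close> and \<open>g\<close> are
  considered, so that both integrands are integrable.
\<close>

definition is_Linf_weak_gradient ::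
    "'a::euclidean_space set \<Rightarrow> ('a \<Rightarrow> real) \<Rightarrow> ('a \<Rightarrow> 'a) \<Rightarrow> bool" where
  "is_Linf_weak_gradient \<Omega> u g \<longleftrightarrow>
     u \<in> Linf (lebesgue_on \<Omega>) \<and> g \<in> Linf (lebesgue_on \<Omega>) \<and>
     (\<forall>\<phi>\<in>test_functions \<Omega>. \<forall>i\<in>Basis.
        (\<integral>x. u x * frechet_derivative \<phi> (at x) i \<partial>lebesgue_on \<Omega>) =
        - (\<integral>x. (g x \<bullet> i) * \<phi> x \<partial>lebesgue_on \<Omega>))"

definition W1inf :: "'a::euclidean_space set \<Rightarrow> ('a \<Rightarrow> real) set" where
  "W1inf \<Omega> = {u. \<exists>g. is_Linf_weak_gradient \<Omega> u g}"

text \<open>The weak gradient is determined up to a null set, so the choice below does not affect norms.\<close>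

definition weak_gradient :: "'a::euclidean_space set \<Rightarrow> ('a \<Rightarrow> real) \<Rightarrow> 'a \<Rightarrow> 'a" where
  "weak_gradient \<Omega> u = (SOME g. is_Linf_weak_gradient \<Omega> u g)"

definition grad_norm :: "'a::euclidean_space set \<Rightarrow> ('a \<Rightarrow> real) \<Rightarrow> real" where
  "grad_norm \<Omega> u = real_of_ereal (Linf_norm (lebesgue_on \<Omega>) (weak_gradient \<Omega> u))"

section \<open>The minimization problem\<close>

text \<open>
  Elements are represented by functions that are continuous on \<open>closure \<Omega>\<close>; their values outside
  \<open>closure \<Omega>\<close> are irrelevant, and equality of elements means equality on \<open>closure \<Omega>\<close>.
\<close>

definition Lip1 :: "'a::euclidean_space set \<Rightarrow> ('a \<Rightarrow> real) set" where
  "Lip1 \<Omega> = {u \<in> W1inf \<Omega>. continuous_on (closure \<Omega>) u \<and>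
                 (\<forall>x\<in>\<Omega>. 0 \<le> u x) \<and> (\<forall>x\<in>frontier \<Omega>. u x = 1)}"

abbreviation vol :: "'a::euclidean_space set \<Rightarrow> real" where
  "vol A \<equiv> measure lebesgue A"

definition J :: "'a::euclidean_space set \<Rightarrow> real \<Rightarrow> ('a \<Rightarrow> real) \<Rightarrow> real" where
  "J \<Omega> \<Lambda> u = grad_norm \<Omega> u + \<Lambda> * vol {x\<in>\<Omega>. u x > 0}"

definition solution :: "'a::euclidean_space set \<Rightarrow> real \<Rightarrow> ('a \<Rightarrow> real) \<Rightarrow> bool" where
  "solution \<Omega> \<Lambda> u \<longleftrightarrow> is_arg_min (J \<Omega> \<Lambda>) (\<lambda>w. w \<in> Lip1 \<Omega>) u"

definition nonconst_solution :: "'a::euclidean_space set \<Rightarrow> real \<Rightarrow> ('a \<Rightarrow> real) \<Rightarrow> bool" where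
  "nonconst_solution \<Omega> \<Lambda> u \<longleftrightarrow> solution \<Omega> \<Lambda> u \<and> \<not> u constant_on closure \<Omega>"

definition Lambda_inf :: "'a::euclidean_space set \<Rightarrow> real" where
  "Lambda_inf \<Omega> = Inf {\<Lambda>. 0 < \<Lambda> \<and> (\<exists>u. nonconst_solution \<Omega> \<Lambda> u)}"

section \<open>Parallel sets\<close>

definition inradius :: "'a::euclidean_space set \<Rightarrow> real" where
  "inradius \<Omega> = (SUP x\<in>\<Omega>. infdist x (frontier \<Omega>))"

definition inner_set :: "'a::euclidean_space set \<Rightarrow> real \<Rightarrow> 'a set" where
  "inner_set \<Omega> r = {x\<in>\<Omega>. infdist x (frontier \<Omega>) > r}"

definition boundary_layer :: "'a::euclidean_space set \<Rightarrow> real \<Rightarrow> 'a set" where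
  "boundary_layer \<Omega> r = \<Omega> - closure (inner_set \<Omega> r)"

definition cone_fun :: "'a::euclidean_space set \<Rightarrow> real \<Rightarrow> 'a \<Rightarrow> real" where
  "cone_fun \<Omega> r x = max 0 (1 - infdist x (frontier \<Omega>) / r)"

section \<open>Hausdorff measure\<close>

text \<open>
  The \<open>s\<close>-dimensional Hausdorff (outer) measure for \<open>s > 0\<close>, normalized so that for integer \<open>s\<close>
  it agrees with \<open>s\<close>-dimensional area. Coverings consist of bounded sets because
  \<^const>\<open>diameter\<close> is unspecified on unbounded ones.
\<close>

definition hausdorff_content :: "real \<Rightarrow> real \<Rightarrow> 'a::metric_space set \<Rightarrow> ennreal" where
  "hausdorff_content s \<delta> A =
     (INF C \<in> {C :: nat \<Rightarrow> 'a set. A \<subseteq> (\<Union>i. C i) \<and> (\<forall>i. bounded (C i) \<and> diameter (C i) \<le> \<delta>)}.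
        \<Sum>i. ennreal (unit_ball_vol s * (diameter (C i) / 2) powr s))"

definition hausdorff_measure :: "real \<Rightarrow> 'a::metric_space set \<Rightarrow> ennreal" where
  "hausdorff_measure s A = (SUP \<delta>\<in>{0<..}. hausdorff_content s \<delta> A)"

text \<open>
  As \<^const>\<open>enn2real\<close> sends \<open>\<infinity>\<close> to \<open>0\<close> and \<open>x / 0 = 0\<close>, each of the two equations below can hold for
  some \<open>r > 0\<close> (and \<open>\<Lambda> > 0\<close>) only if the volume and area occurring in it are finite and positive.
\<close>

definition perimeter :: "'a::euclidean_space set \<Rightarrow> real" where
  "perimeter A = enn2real (hausdorff_measure (real DIM('a) - 1) (frontier A))"

definition critical_radius :: "'a::euclidean_space set \<Rightarrow> real \<Rightarrow> bool" where
  "critical_radius \<Omega> r \<longleftrightarrow>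
     0 < r \<and> r < inradius \<Omega> \<and> perimeter (inner_set \<Omega> r) / vol (inner_set \<Omega> r) = 1 / r"

definition roots :: "'a::euclidean_space set \<Rightarrow> real \<Rightarrow> real set" where
  "roots \<Omega> \<Lambda> = {r. 0 < r \<and> r < inradius \<Omega> \<and> 1 / (r\<^sup>2 * perimeter (inner_set \<Omega> r)) = \<Lambda>}"

definition r_Lambda :: "'a::euclidean_space set \<Rightarrow> real \<Rightarrow> real" where
  "r_Lambda \<Omega> \<Lambda> = (LEAST r. r \<in> roots \<Omega> \<Lambda>)"

end

theory Submission
  imports Defs
begin

text \<open>
  The weak gradient norm of \<open>u\<close> is its Lipschitz constant, so with \<open>r = 1 / grad_norm u\<close> the function
  \<open>u\<close> is positive at all points of distance less than \<open>r\<close> from the boundary. Hence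
  \<open>J u - J 1 \<ge> 1 / r - \<Lambda> V r\<close> with \<open>V r\<close> the volume of the inner parallel set, with equality for the
  cone function, and everything reduces to minimizing the right-hand side over \<open>r\<close>.

  Two facts about \<open>V\<close> suffice. First, \<open>V' = - P\<close> with \<open>P r\<close> the Hausdorff measure of the boundary of the
  inner parallel set: this holds up to the expected error for polytopes, by comparing parallel volumes
  with prisms over the facets, and passes to all convex bodies because the surface area is monotone.
  Second, \<open>V\<close> is log-concave by the Brunn-Minkowski inequality, so \<open>P / V\<close> is nondecreasing. Therefore
  \<open>r P r / V r = 1\<close> has a unique solution \<open>rs\<close>, which is the maximum of \<open>r V r\<close>, and \<open>r\<^sup>2 P r\<close> is
  strictly increasing on \<open>(0, rs]\<close>; no concavity of \<open>P\<close> itself is needed.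
\<close>

text \<open>The perimeter is a Hausdorff measure, an infimum over arbitrary coverings, so the
  obstacle is to relate it to volumes. The isodiametric inequality, itself a consequence of
  Brunn-Minkowski, identifies Hausdorff and Lebesgue measure in full dimension, and isometric charts
  carry this over to the facets of polytopes. The nearest-point projection makes surface area
  monotone, so that polytopes inside and outside a body control its surface area. Each of the two
  parallel volume estimates is one-sided; applied at the two ends of an interval they enclose
  \<open>V r - V (r + e)\<close> between \<open>e * P (r + e)\<close> and \<open>e * P r\<close>.
  The monotonicity of \<open>P / V\<close> then also yields the continuity of \<open>P\<close>.

  On the function side, gradient bounds and Lipschitz bounds are equivalent for a continuous
  function already known to lie in \<open>W1inf\<close>. Membership itself has to be established
  only for the constant and for the cone functions. These are convex on \<Omega>, so their
  difference quotients are monotone and converge at every point.\<close>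

section \<open>The Brunn-Minkowski inequality\<close>

text \<open>Two half-size copies fit into \<open>C\<close> almost side by side: \<open>A / 2\<close>
  shifted by half of a point near \<open>Inf B\<close>, and \<open>B / 2\<close> shifted by half of
  a point near \<open>Sup A\<close>. Their overlap lies in an interval of length at most
  \<open>e / 2\<close>.\<close>

lemma lebesgue_half_midpoint_real_bounded:
  fixes A B C :: "real set"
  assumes ne: "A \<noteq> {}" "B \<noteq> {}" and bd: "bounded A" "bounded B"
    and A: "A \<in> sets lebesgue" and B: "B \<in> sets lebesgue" and C: "C \<in> sets lebesgue"
    and sub: "\<And>x y. x \<in> A \<Longrightarrow> y \<in> B \<Longrightarrow> (x + y) / 2 \<in> C"
  shows "emeasure lebesgue A + emeasure lebesgue B \<le> 2 * emeasure lebesgue C"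
proof -
  have bA: "bdd_above A" and bB: "bdd_below B"
    using bd by (auto intro: bounded_imp_bdd_above bounded_imp_bdd_below)
  have *: "emeasure lebesgue A + emeasure lebesgue B \<le> 2 * emeasure lebesgue C + ennreal e" if ep: "e > 0" for e
  proof -
    obtain a where a: "a \<in> A" "a > Sup A - e/2"
      using less_cSup_iff[OF ne(1) bA, of "Sup A - e/2"] ep by auto
    obtain b where b: "b \<in> B" "b < Inf B + e/2"
      using cInf_less_iff[OF ne(2) bB, of "Inf B + e/2"] ep by auto
    \<comment> \<open>The copy of \<open>A\<close> lies to the left of \<open>c\<close> and the copy
      of \<open>B\<close> to the right of \<open>c'\<close>.\<close>
    define c where "c = (Sup A + b) / 2"
    define c' where "c' = (a + Inf B) / 2"
    have cc: "c - c' \<le> e / 2" using a b unfolding c_def c'_def by argo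
    let ?A = "(\<lambda>x. (1/2) *\<^sub>R x + b/2) ` A" and ?B = "(\<lambda>x. (1/2) *\<^sub>R x + a/2) ` B"
    have mA: "emeasure lebesgue ?A = ennreal (1/2) * emeasure lebesgue A"
      using emeasure_lebesgue_affine[of "1/2" "b/2" A] by simp
    have mB: "emeasure lebesgue ?B = ennreal (1/2) * emeasure lebesgue B"
      using emeasure_lebesgue_affine[of "1/2" "a/2" B] by simp
    have sA: "?A \<subseteq> C \<inter> {..c}" using sub[OF _ b(1)] cSup_upper[OF _ bA]
      by (auto simp: c_def field_simps)
    have sB: "?B \<subseteq> C \<inter> {c'..}" using sub[OF a(1)] cInf_lower[OF _ bB]
      by (auto simp: c'_def field_simps)
    have "emeasure lebesgue (C \<inter> {c'..}) \<le> emeasure lebesgue (C \<inter> {c<..} \<union> {c'..c})"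
      using C by (intro emeasure_mono sets.Un sets.Int) auto
    also have "\<dots> \<le> emeasure lebesgue (C \<inter> {c<..}) + emeasure lebesgue {c'..c}"
      using C by (intro emeasure_subadditive) auto
    also have "emeasure lebesgue {c'..c} \<le> ennreal (e/2)"
      using cc that by (cases "c' \<le> c") (auto simp: ennreal_leI)
    finally have 1: "emeasure lebesgue (C \<inter> {c'..}) \<le> emeasure lebesgue (C \<inter> {c<..}) + ennreal (e/2)"
      by (simp add: add_left_mono)
    have "ennreal (1/2) * emeasure lebesgue A + ennreal (1/2) * emeasure lebesgue B
       \<le> emeasure lebesgue (C \<inter> {..c}) + emeasure lebesgue (C \<inter> {c'..})"
      unfolding mA[symmetric] mB[symmetric] using C by (intro add_mono emeasure_mono sA sB) auto
    also have "\<dots> \<le> emeasure lebesgue (C \<inter> {..c}) + (emeasure lebesgue (C \<inter> {c<..}) + ennreal (e/2))"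
      by (intro add_left_mono 1)
    also have "\<dots> = (emeasure lebesgue (C \<inter> {..c}) + emeasure lebesgue (C \<inter> {c<..})) + ennreal (e/2)"
      by (simp add: add.assoc)
    also have "emeasure lebesgue (C \<inter> {..c}) + emeasure lebesgue (C \<inter> {c<..}) = emeasure lebesgue C"
    proof -
      have "C \<inter> {..c} \<union> C \<inter> {c<..} = C" by auto
      moreover have "emeasure lebesgue (C \<inter> {..c}) + emeasure lebesgue (C \<inter> {c<..})
          = emeasure lebesgue (C \<inter> {..c} \<union> C \<inter> {c<..})"
        by (rule plus_emeasure) (use C in auto)
      ultimately show ?thesis by metis
    qed
    finally have 2: "ennreal (1/2) * emeasure lebesgue A + ennreal (1/2) * emeasure lebesgue B
        \<le> emeasure lebesgue C + ennreal (e/2)" .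
    have h: "2 * (ennreal (1/2) * x) = x" for x
    proof -
      have "ennreal 2 * ennreal (1/2) = ennreal (2 * (1/2))" by (rule ennreal_mult[symmetric]) auto
      then have "2 * ennreal (1/2) = 1" by (simp only: ennreal_numeral) simp
      then show ?thesis by (simp only: mult.assoc[symmetric]) simp
    qed
    have e2: "2 * ennreal (e/2) = ennreal e"
    proof -
      have "ennreal 2 * ennreal (e/2) = ennreal (2 * (e/2))" by (rule ennreal_mult[symmetric]) (use ep in auto)
      moreover have "2 * (e/2) = e" by simp
      ultimately show ?thesis by (simp only: ennreal_numeral)
    qed
    have "emeasure lebesgue A + emeasure lebesgue B
       = 2 * (ennreal (1/2) * emeasure lebesgue A + ennreal (1/2) * emeasure lebesgue B)"
      by (simp only: distrib_left h)
    also have "\<dots> \<le> 2 * (emeasure lebesgue C + ennreal (e/2))"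
      by (intro mult_left_mono 2) auto
    also have "\<dots> = 2 * emeasure lebesgue C + ennreal e"
      by (simp only: distrib_left e2)
    finally show ?thesis .
  qed
  show ?thesis by (rule ennreal_le_epsilon) (rule *)
qed

text \<open>Truncation to the intervals from \<open>-n\<close> to \<open>n\<close> and continuity of
  measure from below; both truncations are nonempty for large \<open>n\<close>.\<close>

lemma lebesgue_half_midpoint_real:
  fixes A B C :: "real set"
  assumes ne: "A \<noteq> {}" "B \<noteq> {}"
    and A: "A \<in> sets lebesgue" and B: "B \<in> sets lebesgue" and C: "C \<in> sets lebesgue"
    and sub: "\<And>x y. x \<in> A \<Longrightarrow> y \<in> B \<Longrightarrow> (x + y) / 2 \<in> C"
  shows "emeasure lebesgue A + emeasure lebesgue B \<le> 2 * emeasure lebesgue C"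
proof -
  let ?A = "\<lambda>n::nat. A \<inter> {-real n..real n}" and ?B = "\<lambda>n::nat. B \<inter> {-real n..real n}"
  have un: "(\<Union>n. S \<inter> {-real n..real n}) = S" for S :: "real set"
  proof -
    have "\<exists>n. -real n \<le> x \<and> x \<le> real n" for x
      using real_arch_simple[of "\<bar>x\<bar>"] by (auto simp: abs_le_iff) (metis minus_le_iff)
    then show ?thesis by auto
  qed
  have lim: "(\<lambda>n. emeasure lebesgue (S \<inter> {-real n..real n})) \<longlonglongrightarrow> emeasure lebesgue S"
    if "S \<in> sets lebesgue" for S :: "real set"
  proof -
    have "range (\<lambda>n. S \<inter> {-real n..real n}) \<subseteq> sets lebesgue" "incseq (\<lambda>n. S \<inter> {-real n..real n})"
      using that by (auto simp: incseq_def)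
    from Lim_emeasure_incseq[OF this] show ?thesis unfolding un .
  qed
  obtain a b where ab: "a \<in> A" "b \<in> B" using ne by auto
  obtain N :: nat where N: "\<bar>a\<bar> \<le> N" "\<bar>b\<bar> \<le> N"
    using real_arch_simple[of "max \<bar>a\<bar> \<bar>b\<bar>"] by auto
  have "emeasure lebesgue (?A n) + emeasure lebesgue (?B n) \<le> 2 * emeasure lebesgue C" if "n \<ge> N" for n
  proof (rule lebesgue_half_midpoint_real_bounded)
    show "?A n \<noteq> {}" using ab N that by (auto simp: abs_le_iff intro!: exI[of _ a])
    show "?B n \<noteq> {}" using ab N that by (auto simp: abs_le_iff intro!: exI[of _ b])
  qed (use A B C sub in \<open>auto intro: bounded_subset[OF bounded_closed_interval]\<close>)
  then show ?thesis
    by (intro LIMSEQ_le_const2[OF tendsto_add[OF lim[OF A] lim[OF B]]]) blast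
qed

section \<open>The Prekopa-Leindler inequality via level sets\<close>

lemma scaled_layer_integral:
  fixes t :: ennreal and a :: real
  assumes "a > 0"
  shows "ennreal a * (\<integral>\<^sup>+l. indicator {l::real. 0 < l \<and> l < 1 \<and> ennreal (l * a) < t} l \<partial>lborel) = min t (ennreal a)"
proof (cases t)
  case top
  then have "{l::real. 0 < l \<and> l < 1 \<and> ennreal (l * a) < t} = {0<..<1}" by auto
  then show ?thesis using top by simp
next
  case (real r)
  have "{l::real. 0 < l \<and> l < 1 \<and> ennreal (l * a) < t} = {0<..<min 1 (r/a)}"
    using real assms by (auto simp: field_simps ennreal_less_iff)
  then show ?thesis using real assms
    by (auto simp: min_def field_simps ennreal_mult[symmetric] ennreal_le_iff2)
qed

text \<open>The level is written as \<open>l * a\<close> with \<open>l\<close> between 0 and 1, so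
  that functions with different suprema can be compared at the same relative level.\<close>

lemma layer_cake:
  fixes f :: "real \<Rightarrow> ennreal" and a :: real
  assumes "a > 0" and f[measurable]: "f \<in> borel_measurable borel"
  shows "(\<integral>\<^sup>+x. min (f x) (ennreal a) \<partial>lborel) =
    ennreal a * (\<integral>\<^sup>+l. emeasure lborel {x. ennreal (l * a) < f x} * indicator {0<..<1} l \<partial>lborel)"
proof -
  have "Measurable.pred (borel \<Otimes>\<^sub>M borel) (\<lambda>z::real \<times> real. 0 < snd z \<and> snd z < 1 \<and> ennreal (snd z * a) < f (fst z))"
    by measurable
  moreover have "{(x,l). 0 < l \<and> l < 1 \<and> ennreal (l * a) < f x} = {z. 0 < snd z \<and> snd z < 1 \<and> ennreal (snd z * a) < f (fst z)}"
    by auto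
  ultimately have S[measurable]: "{(x,l). 0 < l \<and> l < 1 \<and> ennreal (l * a) < f x} \<in> sets (borel \<Otimes>\<^sub>M borel)"
    by (simp add: pred_def space_pair_measure)
  have "(\<integral>\<^sup>+x. min (f x) (ennreal a) \<partial>lborel) =
     (\<integral>\<^sup>+x. ennreal a * (\<integral>\<^sup>+l. indicator {l::real. 0 < l \<and> l < 1 \<and> ennreal (l * a) < f x} l \<partial>lborel) \<partial>lborel)"
    by (subst scaled_layer_integral[OF assms(1)]) simp
  also have "\<dots> = ennreal a * (\<integral>\<^sup>+x. (\<integral>\<^sup>+l. indicator {(x,l). 0 < l \<and> l < 1 \<and> ennreal (l * a) < f x} (x,l) \<partial>lborel) \<partial>lborel)"
  proof -
    have e: "indicator {l::real. 0 < l \<and> l < 1 \<and> ennreal (l * a) < f x} l =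
      (indicator {(x,l). 0 < l \<and> l < 1 \<and> ennreal (l * a) < f x} (x,l) :: ennreal)" for x l
      by (simp add: indicator_def)
    show ?thesis unfolding e
      by (rule nn_integral_cmult) measurable
  qed
  also have "(\<integral>\<^sup>+x. (\<integral>\<^sup>+l. indicator {(x,l). 0 < l \<and> l < 1 \<and> ennreal (l * a) < f x} (x,l) \<partial>lborel) \<partial>lborel)
     = (\<integral>\<^sup>+l. (\<integral>\<^sup>+x. indicator {(x,l). 0 < l \<and> l < 1 \<and> ennreal (l * a) < f x} (x,l) \<partial>lborel) \<partial>lborel)"
    by (intro lborel_pair.Fubini'[symmetric]) (use S in \<open>simp add: borel_measurable_indicator_iff space_pair_measure\<close>)
  also have "\<dots> = (\<integral>\<^sup>+l. emeasure lborel {x. ennreal (l * a) < f x} * indicator {0<..<1} l \<partial>lborel)"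
  proof (intro nn_integral_cong)
    fix l :: real
    have "(\<integral>\<^sup>+x. indicator {(x,l). 0 < l \<and> l < 1 \<and> ennreal (l * a) < f x} (x,l) \<partial>lborel)
      = (\<integral>\<^sup>+x. indicator {x. ennreal (l * a) < f x} x * indicator {0<..<1} l \<partial>lborel)"
      by (auto simp: indicator_def intro!: nn_integral_cong)
    also have "\<dots> = emeasure lborel {x. ennreal (l * a) < f x} * indicator {0<..<1} l"
      by (subst nn_integral_multc) auto
    finally show "(\<integral>\<^sup>+x. indicator {(x,l). 0 < l \<and> l < 1 \<and> ennreal (l * a) < f x} (x,l) \<partial>lborel)
      = emeasure lborel {x. ennreal (l * a) < f x} * indicator {0<..<1} l" .
  qed
  finally show ?thesis .
qed

text \<open>The inequality of arithmetic and geometric means, squared.\<close>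

lemma ennreal_four_mult_le_square:
  fixes x y z :: ennreal
  assumes "x + y \<le> 2 * z"
  shows "x * y \<le> z ^ 2"
proof (cases "z = top")
  case False
  then have "x + y < top" using assms 
  proof -
    have "2 * z < top" using False by (simp add: ennreal_mult_less_top less_top)
    then show ?thesis using assms by (rule order.strict_trans1[rotated])
  qed
  then obtain a b c where e: "x = ennreal a" "y = ennreal b" "z = ennreal c" "a \<ge> 0" "b \<ge> 0" "c \<ge> 0"
    using False by (cases x; cases y; cases z) auto
  have "a + b \<le> 2 * c"
    using assms e by (simp add: ennreal_plus[symmetric] ennreal_numeral[symmetric] ennreal_mult[symmetric] del: ennreal_numeral ennreal_plus)
  then have "(a + b)^2 \<le> (2*c)^2" using e by (intro power_mono) auto
  then have "a * b \<le> c^2" using sum_squares_bound[of a b] by (simp add: power2_eq_square algebra_simps)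
  then show ?thesis using e by (simp add: ennreal_mult[symmetric] ennreal_power)
qed (simp add: power2_eq_square)

text \<open>The midpoint case of the Prekopa-Leindler inequality, squared in order to avoid roots in
  \<^typ>\<open>ennreal\<close>.\<close>

lemma prekopa_leindler_real_bounded:
  fixes f g h :: "real \<Rightarrow> ennreal" and K :: real
  assumes f[measurable]: "f \<in> borel_measurable borel" and g[measurable]: "g \<in> borel_measurable borel"
    and h[measurable]: "h \<in> borel_measurable borel"
    and bf: "\<And>x. f x \<le> ennreal K" and bg: "\<And>x. g x \<le> ennreal K"
    and le: "\<And>x y. f x * g y \<le> h ((x + y) / 2) ^ 2"
  shows "(\<integral>\<^sup>+x. f x \<partial>lborel) * (\<integral>\<^sup>+x. g x \<partial>lborel) \<le> (\<integral>\<^sup>+x. h x \<partial>lborel) ^ 2"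
proof (cases "(SUP x. f x) = 0 \<or> (SUP x. g x) = 0")
  case True
  then have "(\<forall>x. f x = 0) \<or> (\<forall>x. g x = 0)"
    by (metis SUP_upper UNIV_I le_zero_eq)
  then show ?thesis by auto
next
  case False
  have "(SUP x. f x) \<le> ennreal K" "(SUP x. g x) \<le> ennreal K"
    using bf bg by (auto intro: SUP_least)
  then obtain a b where a: "(SUP x. f x) = ennreal a" "a \<ge> 0" and b: "(SUP x. g x) = ennreal b" "b \<ge> 0"
    by (metis ennreal_cases ennreal_less_top order.strict_trans1 order_less_irrefl)
  have ab: "a > 0" "b > 0" using False a b by (auto simp: less_le)
  \<comment> \<open>With the geometric mean, \<open>(l * c)\<^sup>2 = (l * a) * (l * b)\<close>, so
    midpoints of the level sets of \<open>f\<close> and \<open>g\<close> lie in the level set of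
    \<open>h\<close> for the same \<open>l\<close>. As \<open>a\<close> and \<open>b\<close> are the
    suprema, the first two level sets are nonempty for every \<open>l < 1\<close>, as the inequality
    on the line requires.\<close>
  define c where "c = sqrt (a * b)"
  have c: "c > 0" "c * c = a * b" using ab by (auto simp: c_def)
  let ?A = "\<lambda>l. {x. ennreal (l * a) < f x}" and ?B = "\<lambda>l. {x. ennreal (l * b) < g x}"
    and ?C = "\<lambda>l. {x. ennreal (l * c) < h x}"
  let ?I = "\<lambda>A. \<integral>\<^sup>+l. emeasure lborel (A l) * indicator {0<..<1::real} l \<partial>lborel"
  have fa: "f x \<le> ennreal a" and gb: "g x \<le> ennreal b" for x
    unfolding a(1)[symmetric] b(1)[symmetric] by (auto intro: SUP_upper)
  have If: "(\<integral>\<^sup>+x. f x \<partial>lborel) = ennreal a * ?I ?A"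
    using layer_cake[OF ab(1) f] fa by (simp add: min_absorb1)
  have Ig: "(\<integral>\<^sup>+x. g x \<partial>lborel) = ennreal b * ?I ?B"
    using layer_cake[OF ab(2) g] gb by (simp add: min_absorb1)
  have Ih: "ennreal c * ?I ?C \<le> (\<integral>\<^sup>+x. h x \<partial>lborel)"
    unfolding layer_cake[OF c(1) h, symmetric] by (intro nn_integral_mono) auto
  have m: "(\<lambda>l. emeasure lborel {x. ennreal (l * k) < u x} * indicator {0<..<1} l) \<in> borel_measurable borel"
    if [measurable]: "u \<in> borel_measurable borel" for u :: "real \<Rightarrow> ennreal" and k
  proof -
    have "(\<lambda>l. emeasure lborel {x. ennreal (l * k) < u x}) \<in> borel_measurable borel"
      by (intro sigma_finite_measure.measurable_emeasure[OF sigma_finite_lborel, where A="\<lambda>l. {x. ennreal (l * k) < u x}"])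
         (simp add: space_pair_measure case_prod_beta, measurable)
    then show ?thesis by simp
  qed
  have lev: "emeasure lborel (?A l) + emeasure lborel (?B l) \<le> 2 * emeasure lborel (?C l)"
    if l: "0 < l" "l < 1" for l
  proof -
    have "ennreal (l * a) < (SUP x. f x)" unfolding a using ab l by (intro ennreal_lessI) auto
    then obtain x0 where x0: "ennreal (l * a) < f x0" by (auto simp: less_SUP_iff)
    have "ennreal (l * b) < (SUP x. g x)" unfolding b using ab l by (intro ennreal_lessI) auto
    then obtain y0 where y0: "ennreal (l * b) < g y0" by (auto simp: less_SUP_iff)
    have "emeasure lebesgue (?A l) + emeasure lebesgue (?B l) \<le> 2 * emeasure lebesgue (?C l)"
    proof (rule lebesgue_half_midpoint_real)
      fix x y assume "x \<in> ?A l" "y \<in> ?B l"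
      then have xy: "ennreal (l * a) < f x" "ennreal (l * b) < g y" by auto
      have "ennreal (l * c) ^ 2 = ennreal (l * a) * ennreal (l * b)"
        using c ab l by (simp add: ennreal_power ennreal_mult[symmetric] power2_eq_square algebra_simps)
      also have "\<dots> < f x * g y"
        using xy fa[of x] gb[of y]
      proof -
        obtain r q where rq: "f x = ennreal r" "g y = ennreal q" "r \<ge> 0" "q \<ge> 0"
          using fa[of x] gb[of y] by (cases "f x"; cases "g y") (auto simp: top_unique)
        have "l * a < r" "l * b < q" using xy rq ab l by (auto simp: ennreal_less_iff)
        moreover have "0 < l * a" "0 < l * b" using ab l by auto
        ultimately have "(l * a) * (l * b) < r * q" by (intro mult_strict_mono) auto
        then show ?thesis using rq ab l by (auto simp: ennreal_mult[symmetric] ennreal_less_iff)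
      qed
      also have "\<dots> \<le> h ((x + y)/2)^2" by (rule le)
      finally have "ennreal (l * c) ^ 2 < h ((x + y)/2)^2" .
      then have "ennreal (l * c) < h ((x + y)/2)"
        by (metis not_le power_mono zero_le)
      then show "(x + y)/2 \<in> ?C l" by simp
    qed (use x0 y0 in auto)
    then show ?thesis by simp
  qed
  have "?I ?A + ?I ?B = (\<integral>\<^sup>+l. emeasure lborel (?A l) * indicator {0<..<1} l + emeasure lborel (?B l) * indicator {0<..<1} l \<partial>lborel)"
    using m[OF f, of a] m[OF g, of b] by (subst nn_integral_add) auto
  also have "\<dots> \<le> (\<integral>\<^sup>+l. 2 * (emeasure lborel (?C l) * indicator {0<..<1} l) \<partial>lborel)"
    using lev by (intro nn_integral_mono) (auto simp: indicator_def)
  also have "\<dots> = 2 * ?I ?C" using m[OF h, of c] by (subst nn_integral_cmult) auto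
  \<comment> \<open>The levels give an additive inequality; the mean inequality makes it
    multiplicative, and the factor \<open>c * c = a * b\<close> restores the scales.\<close>
  finally have "?I ?A * ?I ?B \<le> (?I ?C)^2" by (rule ennreal_four_mult_le_square)
  then have "(ennreal c * ennreal c) * (?I ?A * ?I ?B) \<le> (ennreal c * ennreal c) * (?I ?C)^2"
    by (intro mult_left_mono) auto
  also have "\<dots> = (ennreal c * ?I ?C)^2" by (simp add: power2_eq_square algebra_simps)
  also have "\<dots> \<le> (\<integral>\<^sup>+x. h x \<partial>lborel)^2" by (intro power_mono Ih) auto
  also have "ennreal c * ennreal c = ennreal a * ennreal b" using c ab by (simp add: ennreal_mult[symmetric])
  finally show ?thesis unfolding If Ig by (simp add: algebra_simps)
qed

text \<open>Truncating \<open>f\<close> and \<open>g\<close> at height \<open>n\<close> preserves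
  the hypothesis, and monotone convergence removes the bound.\<close>

lemma prekopa_leindler_real:
  fixes f g h :: "real \<Rightarrow> ennreal"
  assumes f[measurable]: "f \<in> borel_measurable borel" and g[measurable]: "g \<in> borel_measurable borel"
    and h[measurable]: "h \<in> borel_measurable borel"
    and le: "\<And>x y. f x * g y \<le> h ((x + y) / 2) ^ 2"
  shows "(\<integral>\<^sup>+x. f x \<partial>lborel) * (\<integral>\<^sup>+x. g x \<partial>lborel) \<le> (\<integral>\<^sup>+x. h x \<partial>lborel) ^ 2"
proof -
  let ?f = "\<lambda>n x. min (f x) (of_nat n)" and ?g = "\<lambda>n x. min (g x) (of_nat n)"
  have sup: "(\<integral>\<^sup>+x. u x \<partial>lborel) = (SUP n. \<integral>\<^sup>+x. min (u x) (of_nat n) \<partial>lborel)"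
    if [measurable]: "u \<in> borel_measurable borel" for u :: "real \<Rightarrow> ennreal"
  proof -
    have "(SUP n. min (u x) (of_nat n)) = u x" for x
    proof (cases "u x")
      case (real r)
      obtain n :: nat where "r \<le> real n" using real_arch_simple by blast
      then have "u x \<le> of_nat n" using real by (simp add: ennreal_of_nat_eq_real_of_nat ennreal_leI)
      then have "min (u x) (of_nat n) = u x" by simp
      then show ?thesis by (intro antisym SUP_least) (auto intro: SUP_upper2[of n])
    next
      case top then show ?thesis by (simp add: ennreal_SUP_of_nat_eq_top min_top)
    qed
    then have "(\<integral>\<^sup>+x. u x \<partial>lborel) = (\<integral>\<^sup>+x. (SUP n. min (u x) (of_nat n)) \<partial>lborel)" by simp
    also have "\<dots> = (SUP n. \<integral>\<^sup>+x. min (u x) (of_nat n) \<partial>lborel)"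
      by (intro nn_integral_monotone_convergence_SUP)
         (auto simp: incseq_def le_fun_def min_le_iff_disj)
    finally show ?thesis .
  qed
  have inc: "incseq (\<lambda>n. \<integral>\<^sup>+x. min (u x) (of_nat n) \<partial>lborel)" for u :: "real \<Rightarrow> ennreal"
    by (auto simp: incseq_def min_le_iff_disj intro!: nn_integral_mono)
  have "(\<integral>\<^sup>+x. ?f n x \<partial>lborel) * (\<integral>\<^sup>+x. ?g n x \<partial>lborel) \<le> (\<integral>\<^sup>+x. h x \<partial>lborel) ^ 2" for n
  proof (rule prekopa_leindler_real_bounded[where K="real n"])
    fix x y
    have "?f n x * ?g n y \<le> f x * g y" by (intro mult_mono) auto
    then show "?f n x * ?g n y \<le> h ((x + y)/2)^2" using le[of x y] by simp
  qed (auto simp: ennreal_of_nat_eq_real_of_nat)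
  \<comment> \<open>Multiplication on \<open>ennreal\<close> is not continuous at zero times
    infinity, so vanishing integrals are treated separately.\<close>
  moreover have "(\<lambda>n. (\<integral>\<^sup>+x. ?f n x \<partial>lborel) * (\<integral>\<^sup>+x. ?g n x \<partial>lborel)) \<longlonglongrightarrow> (\<integral>\<^sup>+x. f x \<partial>lborel) * (\<integral>\<^sup>+x. g x \<partial>lborel)" if "(\<integral>\<^sup>+x. f x \<partial>lborel) \<noteq> 0" "(\<integral>\<^sup>+x. g x \<partial>lborel) \<noteq> 0"
    using that unfolding sup[OF f] sup[OF g]
    by (intro tendsto_mult_ennreal LIMSEQ_SUP inc) auto
  ultimately show ?thesis
    by (cases "(\<integral>\<^sup>+x. f x \<partial>lborel) = 0 \<or> (\<integral>\<^sup>+x. g x \<partial>lborel) = 0")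
       (auto intro: LIMSEQ_le_const2)
qed


text \<open>Induction on the number of coordinates. With coordinate \<open>i\<close> frozen at
  \<open>s\<close>, \<open>t\<close> and \<open>(s + t) / 2\<close>, the induction hypothesis says
  that the partial integrals again satisfy the assumption of the one-dimensional case.\<close>

lemma prekopa_leindler_PiM:
  fixes f g h :: "('i \<Rightarrow> real) \<Rightarrow> ennreal"
  assumes "finite I"
    and "f \<in> borel_measurable (\<Pi>\<^sub>M i\<in>I. lborel)" "g \<in> borel_measurable (\<Pi>\<^sub>M i\<in>I. lborel)"
    and "h \<in> borel_measurable (\<Pi>\<^sub>M i\<in>I. lborel)"
    and "\<And>x y. x \<in> extensional I \<Longrightarrow> y \<in> extensional I \<Longrightarrow> f x * g y \<le> h (\<lambda>i\<in>I. (x i + y i) / 2) ^ 2"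
  shows "(\<integral>\<^sup>+x. f x \<partial>(\<Pi>\<^sub>M i\<in>I. lborel)) * (\<integral>\<^sup>+x. g x \<partial>(\<Pi>\<^sub>M i\<in>I. lborel)) \<le> (\<integral>\<^sup>+x. h x \<partial>(\<Pi>\<^sub>M i\<in>I. lborel)) ^ 2"
  using assms
proof (induction I arbitrary: f g h rule: finite_induct)
  case empty
  interpret product_sigma_finite "\<lambda>_::'i. lborel :: real measure" by standard
  show ?case using empty(4)[of "\<lambda>_. undefined" "\<lambda>_. undefined"]
    by (simp add: PiM_empty nn_integral_count_space_finite restrict_def)
next
  case (insert i I)
  interpret product_sigma_finite "\<lambda>_::'i. lborel :: real measure" by standard
  note [measurable] = insert.prems(1-3)
  let ?M = "\<Pi>\<^sub>M i\<in>I. lborel :: real measure"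
  have sec[measurable]: "(\<lambda>x. u (x(i := s))) \<in> borel_measurable ?M"
    if [measurable]: "u \<in> borel_measurable (\<Pi>\<^sub>M i\<in>insert i I. lborel)" for u :: "('i \<Rightarrow> real) \<Rightarrow> ennreal" and s
    by measurable
  have ext: "x(i := s) \<in> extensional (insert i I)" if "x \<in> extensional I" for x and s :: real
    using that by (auto simp: extensional_def)
  show ?case
    unfolding product_nn_integral_insert_rev[OF insert.hyps insert.prems(1)]
      product_nn_integral_insert_rev[OF insert.hyps insert.prems(2)]
      product_nn_integral_insert_rev[OF insert.hyps insert.prems(3)]
  proof (rule prekopa_leindler_real)
    fix s t :: real
    show "(\<integral>\<^sup>+x. f (x(i := s)) \<partial>?M) * (\<integral>\<^sup>+x. g (x(i := t)) \<partial>?M) \<le> (\<integral>\<^sup>+x. h (x(i := (s + t) / 2)) \<partial>?M)^2"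
    proof (rule insert.IH)
      fix x y :: "'i \<Rightarrow> real" assume xy: "x \<in> extensional I" "y \<in> extensional I"
      have "(\<lambda>j\<in>insert i I. ((x(i := s)) j + (y(i := t)) j) / 2) = (\<lambda>j\<in>I. (x j + y j) / 2)(i := (s + t)/2)"
        using insert.hyps by (auto simp: fun_eq_iff restrict_def)
      then show "f (x(i := s)) * g (y(i := t)) \<le> h ((\<lambda>j\<in>I. (x j + y j) / 2)(i := (s + t)/2))^2"
        using insert.prems(4)[OF ext[OF xy(1)] ext[OF xy(2)], of s t] by (simp del: fun_upd_apply)
    qed (rule sec insert.prems)+
  next
    interpret M: sigma_finite_measure ?M using sigma_finite[OF insert.hyps(1)] .
    have "(\<lambda>s. \<integral>\<^sup>+x. u (x(i := s)) \<partial>?M) \<in> borel_measurable borel"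
      if [measurable]: "u \<in> borel_measurable (\<Pi>\<^sub>M i\<in>insert i I. lborel)" for u :: "('i \<Rightarrow> real) \<Rightarrow> ennreal"
      by measurable
    then show "(\<lambda>s. \<integral>\<^sup>+x. f (x(i := s)) \<partial>?M) \<in> borel_measurable borel"
       "(\<lambda>s. \<integral>\<^sup>+x. g (x(i := s)) \<partial>?M) \<in> borel_measurable borel"
       "(\<lambda>s. \<integral>\<^sup>+x. h (x(i := s)) \<partial>?M) \<in> borel_measurable borel"
      using insert.prems(1-3) by blast+
  qed
qed

text \<open>Prekopa-Leindler for indicator functions. This multiplicative form contains no dimension
  and is midpoint log-concavity as it stands.\<close>

theorem brunn_minkowski_midpoint:
  fixes A B C :: "'a::euclidean_space set"
  assumes [measurable]: "A \<in> sets borel" "B \<in> sets borel" "C \<in> sets borel"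
    and sub: "\<And>x y. x \<in> A \<Longrightarrow> y \<in> B \<Longrightarrow> (1/2) *\<^sub>R (x + y) \<in> C"
  shows "emeasure lborel A * emeasure lborel B \<le> emeasure lborel C ^ 2"
proof -
  let ?T = "\<lambda>f. \<Sum>b\<in>Basis. f b *\<^sub>R (b::'a)"
  let ?M = "\<Pi>\<^sub>M b\<in>(Basis::'a set). lborel :: real measure"
  have [measurable]: "?T \<in> borel_measurable ?M" by measurable
  have eq: "emeasure lborel S = (\<integral>\<^sup>+x. indicator S (?T x) \<partial>?M)" if [measurable]: "S \<in> sets borel" for S :: "'a set"
  proof -
    have "emeasure lborel S = (\<integral>\<^sup>+x. indicator S x \<partial>lborel)" by simp
    also have "\<dots> = (\<integral>\<^sup>+x. indicator S (?T x) \<partial>?M)"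
      by (subst lborel_eq, subst nn_integral_distr) auto
    finally show ?thesis .
  qed
  have "?T (\<lambda>b\<in>Basis. (x b + y b) / 2) = (1/2) *\<^sub>R (?T x + ?T y)" for x y :: "'a \<Rightarrow> real"
    by (simp add: scaleR_sum_right sum.distrib[symmetric] algebra_simps add_divide_distrib)
  then show ?thesis
    unfolding eq[OF assms(1)] eq[OF assms(2)] eq[OF assms(3)]
    by (intro prekopa_leindler_PiM) (use sub in \<open>auto simp: indicator_def\<close>)
qed

lemma powr_of_nat_dim: "x \<ge> 0 \<Longrightarrow> x powr real DIM('a::euclidean_space) = x ^ DIM('a)"
  by (cases "x = 0") (auto simp: powr_realpow)

text \<open>Brunn-Minkowski for \<open>K\<close> and \<open>-K\<close>: the midpoints lie in a ball of radius half the diameter.\<close>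

lemma isodiametric:
  fixes K :: "'a::euclidean_space set"
  assumes "closed K" "bounded K"
  shows "emeasure lborel K \<le> ennreal (unit_ball_vol (real DIM('a)) * (diameter K / 2) powr real DIM('a))"
proof (cases "K = {}")
  case False
  have d: "diameter K \<ge> 0" using assms diameter_ge_0 by blast
  have cl: "closed (uminus ` K)" using assms by (simp add: closed_negations)
  have b: "emeasure lborel K * emeasure lborel (uminus ` K) \<le> emeasure lborel (cball (0::'a) (diameter K / 2)) ^ 2"
  proof (rule brunn_minkowski_midpoint)
    fix x y assume "x \<in> K" "y \<in> uminus ` K"
    then obtain z where z: "y = -z" "z \<in> K" by auto
    have "dist x z \<le> diameter K" using \<open>x \<in> K\<close> z assms by (auto intro: diameter_bounded_bound)
    then show "(1/2) *\<^sub>R (x + y) \<in> cball 0 (diameter K / 2)" using z by (simp add: dist_norm)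
  qed (use assms cl in auto)
  have "emeasure lebesgue (uminus ` K) = emeasure lebesgue K"
    using emeasure_lebesgue_affine[of "-1" 0 K] by (simp add: image_image)
  then have eq: "emeasure lborel (uminus ` K) = emeasure lborel K" using assms cl by simp
  have fin: "emeasure lborel K < top" using assms emeasure_bounded_finite by (metis infinity_ennreal_def)
  have cb: "emeasure lborel (cball (0::'a) (diameter K / 2)) = ennreal (unit_ball_vol (real DIM('a)) * (diameter K / 2) ^ DIM('a))"
    using d by (simp add: emeasure_cball)
  obtain k where k: "emeasure lborel K = ennreal k" "k \<ge> 0" using fin by (cases "emeasure lborel K") auto
  let ?c = "unit_ball_vol (real DIM('a)) * (diameter K / 2) ^ DIM('a)"
  have c0: "?c \<ge> 0" using d by simp
  have "ennreal (k^2) \<le> ennreal (?c^2)"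
    using b unfolding eq cb k using k c0 by (simp only: ennreal_power ennreal_mult[symmetric] power2_eq_square)
  then have "k^2 \<le> ?c^2" using c0 by (simp add: ennreal_le_iff)
  then have "k \<le> ?c" using c0 by (rule power2_le_imp_le)
  then show ?thesis unfolding k using d by (simp add: ennreal_leI powr_of_nat_dim)
qed simp

section \<open>Hausdorff measure\<close>

definition hausdorff_gauge :: "real \<Rightarrow> 'a::metric_space set \<Rightarrow> ennreal" where
  "hausdorff_gauge s A = ennreal (unit_ball_vol s * (diameter A / 2) powr s)"

lemma hausdorff_gauge_empty [simp]: "hausdorff_gauge s {} = 0"
  by (simp add: hausdorff_gauge_def)

lemma hausdorff_gauge_mono:
  assumes "A \<subseteq> B" "bounded B" "s > 0"
  shows "hausdorff_gauge s A \<le> hausdorff_gauge s B"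
  unfolding hausdorff_gauge_def using assms diameter_ge_0[of A] diameter_subset[of A B] bounded_subset[of B A]
  by (intro ennreal_leI mult_left_mono powr_mono2) auto

lemma hausdorff_content_le:
  assumes "A \<subseteq> (\<Union>i::nat. C i)" "\<And>i. bounded (C i)" "\<And>i. diameter (C i) \<le> d"
  shows "hausdorff_content s d A \<le> (\<Sum>i. hausdorff_gauge s (C i))"
  unfolding hausdorff_content_def hausdorff_gauge_def using assms by (intro INF_lower) auto

lemma hausdorff_content_ge:
  assumes "\<And>C::nat \<Rightarrow> _. A \<subseteq> (\<Union>i. C i) \<Longrightarrow> (\<And>i. bounded (C i)) \<Longrightarrow> (\<And>i. diameter (C i) \<le> d) \<Longrightarrow> x \<le> (\<Sum>i. hausdorff_gauge s (C i))"
  shows "x \<le> hausdorff_content s d A"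
  unfolding hausdorff_content_def using assms by (intro INF_greatest) (auto simp: hausdorff_gauge_def)

lemma hausdorff_content_le_measure: "d > 0 \<Longrightarrow> hausdorff_content s d A \<le> hausdorff_measure s A"
  unfolding hausdorff_measure_def by (intro SUP_upper) auto

lemma hausdorff_measure_le:
  "(\<And>d. d > 0 \<Longrightarrow> hausdorff_content s d A \<le> x) \<Longrightarrow> hausdorff_measure s A \<le> x"
  unfolding hausdorff_measure_def by (intro SUP_least) auto

lemma hausdorff_content_mono: "A \<subseteq> B \<Longrightarrow> hausdorff_content s d A \<le> hausdorff_content s d B"
  by (intro hausdorff_content_ge hausdorff_content_le) auto

lemma hausdorff_content_antimono: "d \<le> d' \<Longrightarrow> hausdorff_content s d' A \<le> hausdorff_content s d A"
  by (intro hausdorff_content_ge hausdorff_content_le) (auto intro: order_trans)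

lemma hausdorff_measure_mono: "A \<subseteq> B \<Longrightarrow> hausdorff_measure s A \<le> hausdorff_measure s B"
  unfolding hausdorff_measure_def by (intro SUP_mono) (auto intro: hausdorff_content_mono)

lemma diameter_leI:
  assumes "d \<ge> 0" "\<And>x y. x \<in> S \<Longrightarrow> y \<in> S \<Longrightarrow> dist x y \<le> d"
  shows "diameter S \<le> d"
  using assms by (auto simp: diameter_def intro!: cSUP_least)

text \<open>A cover of \<open>A\<close> at scale \<open>d / L\<close> is mapped to a cover of the
  image at scale \<open>d\<close>, and each gauge grows by at most the factor
  \<open>L powr s\<close>.\<close>

lemma hausdorff_measure_lipschitz_image:
  assumes L: "L > 0" and s: "s > 0" and lip: "\<And>x y. x \<in> A \<Longrightarrow> y \<in> A \<Longrightarrow> dist (f x) (f y) \<le> L * dist x y"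
  shows "hausdorff_measure s (f ` A) \<le> ennreal (L powr s) * hausdorff_measure s A"
proof (rule hausdorff_measure_le)
  fix d :: real assume d: "d > 0"
  have inv: "ennreal (1 / L powr s) * ennreal (L powr s) = 1" and inv': "ennreal (L powr s) * ennreal (1 / L powr s) = 1"
    using L by (simp_all only: ennreal_mult[symmetric] powr_ge_zero divide_nonneg_nonneg zero_le_one) simp_all
  have "hausdorff_content s d (f ` A) \<le> ennreal (L powr s) * hausdorff_content s (d / L) A"
  proof -
    \<comment> \<open>\<open>hausdorff_content_ge\<close> bounds a content from below, so the
      constant is moved to the left by its inverse.\<close>
    have "ennreal (1 / L powr s) * hausdorff_content s d (f ` A) \<le> hausdorff_content s (d / L) A"
    proof (rule hausdorff_content_ge)
      fix C :: "nat \<Rightarrow> _" assume C: "A \<subseteq> (\<Union>i. C i)" "\<And>i. bounded (C i)" "\<And>i. diameter (C i) \<le> d / L"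
      \<comment> \<open>The covering sets are cut down to \<open>A\<close>, where the Lipschitz
        bound is available.\<close>
      let ?D = "\<lambda>i. f ` (C i \<inter> A)"
      have pt: "dist (f x) (f y) \<le> L * diameter (C i)" if "x \<in> C i \<inter> A" "y \<in> C i \<inter> A" for x y i
        using lip[of x y] that diameter_bounded_bound[OF C(2), of x i y] L
        by (meson IntE mult_left_mono order_trans less_imp_le)
      have dd: "diameter (?D i) \<le> L * diameter (C i)" for i
      proof -
        have "L * diameter (C i) \<ge> 0" using diameter_ge_0[OF C(2)[of i]] L by simp
        then show ?thesis using pt[of _ i] by (intro diameter_leI) auto
      qed
      have bd: "bounded (?D i)" for i
        unfolding bounded_two_points using pt[of _ i] by (intro exI[of _ "L * diameter (C i)"]) auto
      have "hausdorff_content s d (f ` A) \<le> (\<Sum>i. hausdorff_gauge s (?D i))"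
      proof (rule hausdorff_content_le)
        show "diameter (?D i) \<le> d" for i
          using dd[of i] C(3)[of i] L by (metis mult.commute order_trans pos_le_divide_eq)
        show "f ` A \<subseteq> (\<Union>i. ?D i)" using C(1) by blast
      qed (use bd in auto)
      also have "\<dots> \<le> (\<Sum>i. ennreal (L powr s) * hausdorff_gauge s (C i))"
      proof (intro suminf_le)
        fix i
        have "unit_ball_vol s * (diameter (?D i) / 2) powr s \<le> unit_ball_vol s * (L * diameter (C i) / 2) powr s"
          using dd[of i] diameter_ge_0[OF bd[of i]] s by (intro mult_left_mono powr_mono2) auto
        also have "\<dots> = L powr s * (unit_ball_vol s * (diameter (C i) / 2) powr s)"
          using powr_mult[of L "diameter (C i) / 2" s] L diameter_ge_0[OF C(2)[of i]] by (simp add: algebra_simps)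
        finally show "hausdorff_gauge s (?D i) \<le> ennreal (L powr s) * hausdorff_gauge s (C i)"
          using s by (simp add: hausdorff_gauge_def ennreal_mult[symmetric] ennreal_leI)
      qed auto
      also have "\<dots> = ennreal (L powr s) * (\<Sum>i. hausdorff_gauge s (C i))" by simp
      finally have "ennreal (1 / L powr s) * hausdorff_content s d (f ` A) \<le> ennreal (1 / L powr s) * (ennreal (L powr s) * (\<Sum>i. hausdorff_gauge s (C i)))"
        by (rule mult_left_mono) simp
      then show "ennreal (1 / L powr s) * hausdorff_content s d (f ` A) \<le> (\<Sum>i. hausdorff_gauge s (C i))"
        by (simp only: mult.assoc[symmetric] inv mult_1)
    qed
    then have "ennreal (L powr s) * (ennreal (1 / L powr s) * hausdorff_content s d (f ` A)) \<le> ennreal (L powr s) * hausdorff_content s (d / L) A"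
      by (intro mult_left_mono) auto
    then show ?thesis by (simp only: mult.assoc[symmetric] inv' mult_1)
  qed
  also have "\<dots> \<le> ennreal (L powr s) * hausdorff_measure s A"
    using d L by (intro mult_left_mono hausdorff_content_le_measure) auto
  finally show "hausdorff_content s d (f ` A) \<le> ennreal (L powr s) * hausdorff_measure s A" .
qed

text \<open>The Lipschitz estimate with constant 1, applied to \<open>f\<close> and to its inverse
  on the image.\<close>

lemma hausdorff_measure_isometry:
  assumes s: "s > 0" and iso: "\<And>x y. x \<in> A \<Longrightarrow> y \<in> A \<Longrightarrow> dist (f x) (f y) = dist x y"
  shows "hausdorff_measure s (f ` A) = hausdorff_measure s A"
proof (rule antisym)
  show "hausdorff_measure s (f ` A) \<le> hausdorff_measure s A"
    using hausdorff_measure_lipschitz_image[of 1 s A f] s iso by auto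
  have "inj_on f A" using iso by (metis dist_eq_0_iff inj_onI)
  then have 1: "the_inv_into A f ` (f ` A) = A" and 2: "\<And>x. x \<in> A \<Longrightarrow> the_inv_into A f (f x) = x"
    by (auto simp: the_inv_into_onto the_inv_into_f_f)
  have "hausdorff_measure s (the_inv_into A f ` (f ` A)) \<le> ennreal (1 powr s) * hausdorff_measure s (f ` A)"
    by (rule hausdorff_measure_lipschitz_image) (use s iso 2 in auto)
  then show "hausdorff_measure s A \<le> hausdorff_measure s (f ` A)" unfolding 1 by simp
qed

lemma ennreal_minus_leI: "a \<le> b + c \<Longrightarrow> b \<noteq> top \<Longrightarrow> a - b \<le> (c::ennreal)"
  by (simp add: ennreal_minus_le_iff)

lemma ennreal_minus_leD: "a - b \<le> c \<Longrightarrow> a \<le> b + (c::ennreal)"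
  by (simp add: ennreal_minus_le_iff)

lemma hausdorff_content_Un: "hausdorff_content s d (A \<union> B) \<le> hausdorff_content s d A + hausdorff_content s d B"
proof -
  have *: "hausdorff_content s d (A \<union> B) \<le> (\<Sum>i. hausdorff_gauge s (C i)) + (\<Sum>i. hausdorff_gauge s (D i))"
    if C: "A \<subseteq> (\<Union>i. C i)" "\<And>i. bounded (C i)" "\<And>i. diameter (C i) \<le> d"
    and D: "B \<subseteq> (\<Union>i. D i)" "\<And>i. bounded (D i)" "\<And>i. diameter (D i) \<le> d" for C D :: "nat \<Rightarrow> _"
  proof -
    \<comment> \<open>The two covers are interleaved on even and odd indices.\<close>
    let ?E = "\<lambda>i. if even i then C (i div 2) else D (i div 2)"
    have E: "?E (2 * i) = C i" "?E (2 * i + 1) = D i" for i by simp_all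
    have "A \<union> B \<subseteq> (\<Union>i. ?E i)"
    proof
      fix x assume "x \<in> A \<union> B"
      then obtain i where "x \<in> C i \<or> x \<in> D i" using C(1) D(1) by blast
      then have "x \<in> ?E (2 * i) \<or> x \<in> ?E (2 * i + 1)" unfolding E .
      then show "x \<in> (\<Union>i. ?E i)" by blast
    qed
    then have "hausdorff_content s d (A \<union> B) \<le> (\<Sum>i. hausdorff_gauge s (?E i))"
      using C D by (intro hausdorff_content_le) auto
    also have "\<dots> \<le> (\<Sum>i. hausdorff_gauge s (C i)) + (\<Sum>i. hausdorff_gauge s (D i))"
    proof (rule suminf_le_const)
      fix n
      have eq: "(\<Sum>i<2*n. hausdorff_gauge s (?E i)) = (\<Sum>i<n. hausdorff_gauge s (C i)) + (\<Sum>i<n. hausdorff_gauge s (D i))"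
        by (induction n) (auto simp: algebra_simps)
      have le: "(\<Sum>i<n. hausdorff_gauge s (?E i)) \<le> (\<Sum>i<2*n. hausdorff_gauge s (?E i))"
        by (intro sum_mono2) auto
      have cd: "(\<Sum>i<n. hausdorff_gauge s (C i)) \<le> (\<Sum>i. hausdorff_gauge s (C i))"
         "(\<Sum>i<n. hausdorff_gauge s (D i)) \<le> (\<Sum>i. hausdorff_gauge s (D i))"
        by (intro sum_le_suminf; auto)+
      show "(\<Sum>i<n. hausdorff_gauge s (?E i)) \<le> (\<Sum>i. hausdorff_gauge s (C i)) + (\<Sum>i. hausdorff_gauge s (D i))"
        by (rule order_trans[OF le], subst eq, rule add_mono[OF cd])
    qed auto
    finally show ?thesis .
  qed
  show ?thesis
  proof (cases "hausdorff_content s d A = top")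
    case False
    \<comment> \<open>The two infima are taken one after the other. Subtraction isolates the cover
      over which the infimum is being taken; it can be undone because the subtracted term is
      finite.\<close>
    have "hausdorff_content s d (A \<union> B) - hausdorff_content s d A \<le> hausdorff_content s d B"
    proof (rule hausdorff_content_ge)
      fix D :: "nat \<Rightarrow> _" assume D: "B \<subseteq> (\<Union>i. D i)" "\<And>i. bounded (D i)" "\<And>i. diameter (D i) \<le> d"
      let ?d = "\<Sum>i. hausdorff_gauge s (D i)"
      show "hausdorff_content s d (A \<union> B) - hausdorff_content s d A \<le> ?d"
      proof (cases "?d = top")
        case dt: False
        have "hausdorff_content s d (A \<union> B) - ?d \<le> hausdorff_content s d A"
        proof (rule hausdorff_content_ge)
          fix C :: "nat \<Rightarrow> _" assume C: "A \<subseteq> (\<Union>i. C i)" "\<And>i. bounded (C i)" "\<And>i. diameter (C i) \<le> d"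
          show "hausdorff_content s d (A \<union> B) - ?d \<le> (\<Sum>i. hausdorff_gauge s (C i))"
            by (rule ennreal_minus_leI[OF _ dt], subst add.commute, rule *[OF C D])
        qed
        then have "hausdorff_content s d (A \<union> B) \<le> ?d + hausdorff_content s d A"
          by (rule ennreal_minus_leD)
        then show ?thesis by (intro ennreal_minus_leI[OF _ False]) (simp only: add.commute)
      next
        case True
        show ?thesis unfolding True by (rule top_greatest)
      qed
    qed
    then show ?thesis by (rule ennreal_minus_leD)
  qed simp
qed

lemma hausdorff_measure_Un: "hausdorff_measure s (A \<union> B) \<le> hausdorff_measure s A + hausdorff_measure s B"
proof (rule hausdorff_measure_le)
  fix d :: real assume "d > 0"
  then show "hausdorff_content s d (A \<union> B) \<le> hausdorff_measure s A + hausdorff_measure s B"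
    by (meson hausdorff_content_Un add_mono hausdorff_content_le_measure order_trans)
qed

lemma hausdorff_measure_empty [simp]: "hausdorff_measure s {} = 0"
proof -
  have "hausdorff_content s d {} \<le> 0" if "d > 0" for d
    using hausdorff_content_le[of "{}" "\<lambda>_. {}" d s] that by simp
  then have "hausdorff_measure s {} \<le> 0" by (intro hausdorff_measure_le)
  then show ?thesis by simp
qed

lemma hausdorff_measure_UN_le:
  "finite I \<Longrightarrow> hausdorff_measure s (\<Union>i\<in>I. A i) \<le> (\<Sum>i\<in>I. hausdorff_measure s (A i))"
proof (induction I rule: finite_induct)
  case (insert i I)
  have "hausdorff_measure s (\<Union>i\<in>insert i I. A i) \<le> hausdorff_measure s (A i) + hausdorff_measure s (\<Union>i\<in>I. A i)"
    using hausdorff_measure_Un by simp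
  also have "\<dots> \<le> hausdorff_measure s (A i) + (\<Sum>i\<in>I. hausdorff_measure s (A i))"
    by (intro add_left_mono insert.IH)
  finally show ?case using insert.hyps by simp
qed simp

text \<open>A covering set of diameter below \<open>e\<close> meets at most one of \<open>A\<close>
  and \<open>B\<close>, so a cover of the union splits into two separate covers. This is the source
  of all lower bounds for the measure of a union.\<close>

lemma hausdorff_measure_separated:
  assumes s: "s > 0" and e: "e > 0" and sep: "\<And>x y. x \<in> A \<Longrightarrow> y \<in> B \<Longrightarrow> e \<le> dist x y"
  shows "hausdorff_measure s A + hausdorff_measure s B \<le> hausdorff_measure s (A \<union> B)"
proof -
  have *: "hausdorff_content s d A + hausdorff_content s d B \<le> hausdorff_content s d (A \<union> B)" if d: "d < e" for d
  proof (rule hausdorff_content_ge)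
    fix C :: "nat \<Rightarrow> _" assume C: "A \<union> B \<subseteq> (\<Union>i. C i)" "\<And>i. bounded (C i)" "\<And>i. diameter (C i) \<le> d"
    have sub: "diameter (C i \<inter> X) \<le> d" for i X
      using C(3)[of i] diameter_subset[of "C i \<inter> X" "C i"] C(2)[of i] by auto
    have "hausdorff_content s d A + hausdorff_content s d B
       \<le> (\<Sum>i. hausdorff_gauge s (C i \<inter> A)) + (\<Sum>i. hausdorff_gauge s (C i \<inter> B))"
      using C sub by (intro add_mono hausdorff_content_le) (auto intro: bounded_Int)
    also have "\<dots> = (\<Sum>i. hausdorff_gauge s (C i \<inter> A) + hausdorff_gauge s (C i \<inter> B))"
      by (intro suminf_add) auto
    also have "\<dots> \<le> (\<Sum>i. hausdorff_gauge s (C i))"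
    proof (intro suminf_le)
      fix i
      have "C i \<inter> A = {} \<or> C i \<inter> B = {}"
      proof (rule ccontr)
        assume "\<not> ?thesis"
        then obtain x y where "x \<in> C i \<inter> A" "y \<in> C i \<inter> B" by auto
        then have "e \<le> dist x y" "dist x y \<le> diameter (C i)"
          using sep diameter_bounded_bound[OF C(2)] by auto
        then show False using C(3)[of i] d by linarith
      qed
      then show "hausdorff_gauge s (C i \<inter> A) + hausdorff_gauge s (C i \<inter> B) \<le> hausdorff_gauge s (C i)"
        using hausdorff_gauge_mono[of "C i \<inter> A" "C i" s] hausdorff_gauge_mono[of "C i \<inter> B" "C i" s] C(2)[of i] s
        by auto
    qed auto
    finally show "hausdorff_content s d A + hausdorff_content s d B \<le> (\<Sum>i. hausdorff_gauge s (C i))" .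
  qed
  have "hausdorff_content s d A + hausdorff_content s d' B \<le> hausdorff_measure s (A \<union> B)" if "d > 0" "d' > 0" for d d'
  proof -
    \<comment> \<open>A common scale below the separation; contents can only grow when the scale
      shrinks.\<close>
    let ?d = "min (min d d') (e/2)"
    have "hausdorff_content s d A + hausdorff_content s d' B \<le> hausdorff_content s ?d A + hausdorff_content s ?d B"
      by (intro add_mono hausdorff_content_antimono) auto
    also have "\<dots> \<le> hausdorff_content s ?d (A \<union> B)" using e by (intro *) auto
    also have "\<dots> \<le> hausdorff_measure s (A \<union> B)" using that e by (intro hausdorff_content_le_measure) auto
    finally show ?thesis .
  qed
  then have **: "hausdorff_content s d A + hausdorff_measure s B \<le> hausdorff_measure s (A \<union> B)" if "d > 0" for d
    using that unfolding hausdorff_measure_def[of s B]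
    by (subst ennreal_SUP_add_right) (auto intro!: SUP_least)
  then show ?thesis unfolding hausdorff_measure_def[of s A]
    by (subst ennreal_SUP_add_left[symmetric]) (auto intro!: SUP_least)
qed

text \<open>Disjoint compact sets have positive distance, so the separated case applies at each step
  of the induction.\<close>

lemma hausdorff_measure_disjoint_compact:
  assumes s: "s > 0" and "finite I" "\<And>i. i \<in> I \<Longrightarrow> compact (A i)" "disjoint_family_on A I"
  shows "(\<Sum>i\<in>I. hausdorff_measure s (A i)) \<le> hausdorff_measure s (\<Union>i\<in>I. A i :: 'a::heine_borel set)"
  using assms(2-)
proof (induction I rule: finite_induct)
  case (insert i I)
  have "A i \<inter> (\<Union>i\<in>I. A i) = {}" using insert.prems insert.hyps by (auto simp: disjoint_family_on_def)
  moreover have "compact (\<Union>i\<in>I. A i)" using insert by (intro compact_UN) auto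
  ultimately obtain e where "e > 0" "\<forall>x\<in>A i. \<forall>y\<in>(\<Union>i\<in>I. A i). e \<le> dist x y"
    using separate_compact_closed[of "A i" "\<Union>i\<in>I. A i"] insert.prems compact_imp_closed by blast
  then have "hausdorff_measure s (A i) + hausdorff_measure s (\<Union>i\<in>I. A i) \<le> hausdorff_measure s (A i \<union> (\<Union>i\<in>I. A i))"
    by (intro hausdorff_measure_separated[OF s]) auto
  moreover have "(\<Sum>i\<in>I. hausdorff_measure s (A i)) \<le> hausdorff_measure s (\<Union>i\<in>I. A i)"
    using insert.prems by (intro insert.IH) (auto simp: disjoint_family_on_def)
  ultimately show ?case using insert.hyps by (simp add: order_trans[OF add_left_mono])
qed simp

section \<open>Hausdorff and Lebesgue measure in full dimension\<close>

lemma hausdorff_content_countable_cover: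
  assumes "countable I" "A \<subseteq> (\<Union>i\<in>I. F i)" "\<And>i. i \<in> I \<Longrightarrow> bounded (F i)" "\<And>i. i \<in> I \<Longrightarrow> diameter (F i) \<le> d" "d \<ge> 0"
  shows "hausdorff_content s d A \<le> (\<integral>\<^sup>+i. hausdorff_gauge s (F i) \<partial>count_space I)"
proof -
  let ?N = "to_nat_on I ` I"
  let ?C = "\<lambda>n. if n \<in> ?N then F (from_nat_into I n) else {}"
  have inj: "inj_on (to_nat_on I) I" using assms(1) by (rule inj_on_to_nat_on)
  have fi: "from_nat_into I (to_nat_on I i) = i" if "i \<in> I" for i using assms(1) that by simp
  have "A \<subseteq> (\<Union>n. ?C n)"
  proof
    fix x assume "x \<in> A"
    then obtain i where "i \<in> I" "x \<in> F i" using assms(2) by auto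
    then have "x \<in> ?C (to_nat_on I i)" by (simp add: fi)
    then show "x \<in> (\<Union>n. ?C n)" by blast
  qed
  then have "hausdorff_content s d A \<le> (\<Sum>n. hausdorff_gauge s (?C n))"
    using assms by (intro hausdorff_content_le) (auto simp: fi)
  also have "\<dots> = (\<integral>\<^sup>+n. hausdorff_gauge s (?C n) \<partial>count_space UNIV)"
    by (simp add: nn_integral_count_space_nat)
  also have "\<dots> = (\<integral>\<^sup>+n. hausdorff_gauge s (?C n) * indicator ?N n \<partial>count_space UNIV)"
    by (intro nn_integral_cong) (auto simp: indicator_def)
  also have "\<dots> = (\<integral>\<^sup>+n. hausdorff_gauge s (?C n) \<partial>count_space ?N)"
    by (subst nn_integral_count_space_indicator) auto
  also have "\<dots> = (\<integral>\<^sup>+i. hausdorff_gauge s (?C (to_nat_on I i)) \<partial>count_space I)"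
    by (rule nn_integral_bij_count_space[symmetric]) (use inj in \<open>auto simp: bij_betw_def\<close>)
  also have "\<dots> = (\<integral>\<^sup>+i. hausdorff_gauge s (F i) \<partial>count_space I)"
    by (intro nn_integral_cong) (auto simp: fi)
  finally show ?thesis .
qed

text \<open>Disposes of the null set that a Vitali covering by balls leaves over. The set is covered
  by nonoverlapping cubes inside an open set of small measure, and the gauge of a cube is at most a
  constant times its volume.\<close>

lemma hausdorff_content_negligible:
  fixes N :: "'a::euclidean_space set"
  assumes N: "negligible N" "bounded N" and d: "d > 0"
  shows "hausdorff_content (real DIM('a)) d N = 0"
proof -
  let ?m = "DIM('a)"
  \<comment> \<open>A cube of side \<open>l\<close> has diameter at most \<open>?m * l\<close>,
    hence gauge at most \<open>K * l ^ ?m\<close>.\<close>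
  define K where "K = unit_ball_vol ?m * (real ?m / 2) ^ ?m"
  have K0: "K \<ge> 0" by (simp add: K_def)
  have *: "hausdorff_content (real ?m) d N \<le> 0 + ennreal e" if e: "e > 0" for e
  proof -
    obtain B where B: "B > 0" "\<And>x. x \<in> N \<Longrightarrow> norm x \<le> B" using N(2) bounded_pos by metis
    \<comment> \<open>The initial box is a cube, so the dyadic boxes supplied by
      \<open>covering_lemma\<close> are cubes too.\<close>
    define b where "b = B *\<^sub>R (One::'a)"
    have "N \<subseteq> cbox (-b) b"
    proof
      fix x assume "x \<in> N"
      then have "\<bar>x \<bullet> i\<bar> \<le> B" if "i \<in> Basis" for i using B(2) Basis_le_norm[OF that, of x] by fastforce
      then show "x \<in> cbox (-b) b" by (force simp: mem_box b_def abs_le_iff)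
    qed
    moreover have "box (-b) b \<noteq> {}" using B by (auto simp: box_ne_empty b_def)
    moreover obtain U where U: "open U" "N \<subseteq> U" "emeasure lebesgue (U - N) < ennreal (e / (K + 1))"
      using sets_lebesgue_outer_open[of N "e / (K+1)"] N e K0
      by (metis add_nonneg_pos divide_pos_pos negligible_iff_null_sets null_setsD2 zero_less_one)
    have eU: "emeasure lborel U \<le> ennreal (e / (K + 1))"
    proof -
      have "U = (U - N) \<union> N" using U by auto
      then have "emeasure lebesgue U = emeasure lebesgue (U - N)"
        using N(1) U(1) emeasure_Un_null_set[of "U - N" lebesgue N]
        by (metis borel_open negligible_iff_null_sets null_setsD2 sets.Diff sets_completionI_sets sets_lborel)
      then show ?thesis using U by simp
    qed
    \<comment> \<open>This gauge forces every cube of the covering into \<open>U\<close> and into a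
      ball of radius \<open>d / 2\<close>.\<close>
    define g where "g x = (if x \<in> U then U \<inter> ball x (d/2) else UNIV)" for x
    have "gauge g" using U d by (auto simp: gauge_def g_def)
    ultimately obtain \<D> where D: "countable \<D>" "\<And>K. K \<in> \<D> \<Longrightarrow> interior K \<noteq> {} \<and> (\<exists>c d. K = cbox c d)"
      "pairwise (\<lambda>A B. interior A \<inter> interior B = {}) \<D>" "\<And>K. K \<in> \<D> \<Longrightarrow> \<exists>x \<in> N \<inter> K. K \<subseteq> g x"
      "\<And>u v. cbox u v \<in> \<D> \<Longrightarrow> \<exists>n. \<forall>i \<in> Basis. v \<bullet> i - u \<bullet> i = (b \<bullet> i - (-b) \<bullet> i) / 2^n"
      "N \<subseteq> \<Union>\<D>"
      using covering_lemma[of N "-b" b g] by metis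
    have DU: "C \<subseteq> U" if "C \<in> \<D>" for C
      using D(4)[OF that] U(2) by (force simp: g_def split: if_splits)
    have bdC: "bounded C" if "C \<in> \<D>" for C using D(2)[OF that] by auto
    have dC: "diameter C \<le> d" if CD: "C \<in> \<D>" for C
    proof -
      obtain x where "x \<in> N \<inter> C" "C \<subseteq> g x" using D(4)[OF CD] by auto
      then have "C \<subseteq> ball x (d/2)" using U(2) by (auto simp: g_def split: if_splits)
      then have "diameter C \<le> diameter (ball x (d/2))" by (intro diameter_subset) auto
      then show ?thesis using d by simp
    qed
    have gC: "hausdorff_gauge ?m C \<le> ennreal K * emeasure lborel (interior C)" if C: "C \<in> \<D>" for C
    proof -
      obtain u v where uv: "C = cbox u v" using D(2)[OF C] by auto
      obtain n :: nat where "\<forall>i \<in> Basis. v \<bullet> i - u \<bullet> i = (b \<bullet> i - (-b) \<bullet> i) / 2^n" using D(5) C uv by blast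
      then obtain l where l: "\<forall>i \<in> Basis. v \<bullet> i - u \<bullet> i = l" "l > 0" using B
        by (auto simp: b_def intro!: that[of "2 * B / 2^n"])
      have le: "u \<bullet> i \<le> v \<bullet> i" if "i \<in> Basis" for i using l that by force
      have em: "emeasure lborel (interior C) = ennreal (l ^ ?m)"
        using l le by (simp add: uv interior_cbox emeasure_lborel_box_eq)
          (metis (no_types, lifting) inner_diff_left prod.cong prod_constant)
      have "diameter C \<le> real ?m * l"
      proof (rule diameter_le)
        show "C \<noteq> {} \<or> 0 \<le> real ?m * l" using l by auto
        fix x y assume xy: "x \<in> C" "y \<in> C"
        have "norm (x - y) \<le> (\<Sum>i\<in>Basis. \<bar>(x - y) \<bullet> i\<bar>)" by (rule norm_le_l1)
        also have "\<dots> \<le> (\<Sum>i\<in>(Basis::'a set). l)"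
          using xy l(1) uv by (intro sum_mono) (force simp: mem_box inner_diff_left abs_le_iff)
        finally show "norm (x - y) \<le> real ?m * l" by simp
      qed
      then have "unit_ball_vol ?m * (diameter C / 2) powr ?m \<le> unit_ball_vol ?m * (real ?m * l / 2) powr ?m"
        using diameter_ge_0[OF bdC[OF C]] by (intro mult_left_mono powr_mono2) auto
      also have "\<dots> = K * l ^ ?m" using l
        by (simp add: powr_of_nat_dim K_def power_mult_distrib power_divide)
      finally show ?thesis using K0 l unfolding hausdorff_gauge_def em
        by (simp add: ennreal_mult[symmetric] ennreal_leI)
    qed
    have "hausdorff_content ?m d N \<le> (\<integral>\<^sup>+C. hausdorff_gauge ?m C \<partial>count_space \<D>)"
      using D(6) d bdC dC by (intro hausdorff_content_countable_cover[where F="\<lambda>x. x", OF D(1)]) auto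
    also have "\<dots> \<le> (\<integral>\<^sup>+C. ennreal K * emeasure lborel (interior C) \<partial>count_space \<D>)"
      using gC by (intro nn_integral_mono) auto
    also have "\<dots> = ennreal K * (\<integral>\<^sup>+C. emeasure lborel (interior C) \<partial>count_space \<D>)"
      by (intro nn_integral_cmult) auto
    also have "(\<integral>\<^sup>+C. emeasure lborel (interior C) \<partial>count_space \<D>) = emeasure lborel (\<Union>C\<in>\<D>. interior C)"
      using D(1,3) by (intro emeasure_UN_countable[symmetric]) (auto simp: disjoint_family_on_def pairwise_def)
    also have "emeasure lborel (\<Union>C\<in>\<D>. interior C) \<le> emeasure lborel U"
      using U DU interior_subset by (intro emeasure_mono) force+
    also have "\<dots> \<le> ennreal (e / (K + 1))" by (rule eU)
    finally have "hausdorff_content ?m d N \<le> ennreal K * ennreal (e / (K + 1))"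
      by (simp add: mult_left_mono)
    also have "\<dots> \<le> ennreal e" using K0 e
      by (subst ennreal_mult[symmetric]) (auto intro!: ennreal_leI simp: field_simps)
    finally show ?thesis by simp
  qed
  have "hausdorff_content (real ?m) d N \<le> 0" by (rule ennreal_le_epsilon) (rule *)
  then show ?thesis by simp
qed

text \<open>For the upper bound, a Vitali covering by small disjoint balls is used, since the gauge
  of a ball is its volume. For the lower bound, the isodiametric inequality bounds the volume of the
  closure of each covering set by its gauge.\<close>

theorem hausdorff_measure_eq_lebesgue:
  fixes S :: "'a::euclidean_space set"
  assumes S: "S \<in> sets lebesgue" "bounded S"
  shows "hausdorff_measure (real DIM('a)) S = emeasure lebesgue S"
proof (rule antisym)
  let ?m = "DIM('a)"
  show "hausdorff_measure ?m S \<le> emeasure lebesgue S"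
  proof (rule hausdorff_measure_le)
    fix d :: real assume d: "d > 0"
    show "hausdorff_content ?m d S \<le> emeasure lebesgue S"
    proof (rule ennreal_le_epsilon)
      fix e :: real assume e: "e > 0"
      obtain U where U: "open U" "S \<subseteq> U" "emeasure lebesgue (U - S) < ennreal e" "U - S \<in> lmeasurable"
        using sets_lebesgue_outer_open[OF S(1) e] by metis
      let ?K = "{(x::'a,r). 0 < r \<and> r < d/2 \<and> ball x r \<subseteq> U}"
      obtain C where C: "countable C" "C \<subseteq> ?K" "pairwise (\<lambda>i j. disjnt (ball (fst i) (snd i)) (ball (fst j) (snd j))) C"
        "negligible (S - (\<Union>i\<in>C. ball (fst i) (snd i)))"
      proof (rule Vitali_covering_theorem_balls[of S ?K fst snd])
        fix x :: 'a and h :: real assume x: "x \<in> S" "0 < h"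
        obtain k where k: "k > 0" "ball x k \<subseteq> U" using U x openE by blast
        let ?r = "min k (min (h/2) (d/4))"
        have "ball x ?r \<subseteq> U" using k by (meson subset_ball min.cobounded1 order_trans)
        then show "\<exists>i. i \<in> ?K \<and> x \<in> ball (fst i) (snd i) \<and> snd i < h"
          using k x d by (intro exI[of _ "(x, ?r)"]) auto
      qed
      let ?B = "\<Union>i\<in>C. ball (fst i) (snd i)"
      have "hausdorff_content ?m d S \<le> hausdorff_content ?m d (?B \<union> (S - ?B))"
        by (intro hausdorff_content_mono) auto
      also have "\<dots> \<le> hausdorff_content ?m d ?B + hausdorff_content ?m d (S - ?B)"
        by (rule hausdorff_content_Un)
      also have "hausdorff_content ?m d (S - ?B) = 0"
        using C(4) S(2) d by (intro hausdorff_content_negligible) (auto intro: bounded_subset)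
      also have "hausdorff_content ?m d ?B \<le> (\<integral>\<^sup>+i. hausdorff_gauge ?m (ball (fst i) (snd i)) \<partial>count_space C)"
        using C(1,2) d by (intro hausdorff_content_countable_cover) auto
      also have "\<dots> = (\<integral>\<^sup>+i. emeasure lborel (ball (fst i) (snd i)) \<partial>count_space C)"
        using C(2) by (intro nn_integral_cong) (auto simp: hausdorff_gauge_def emeasure_ball powr_of_nat_dim)
      also have "\<dots> = emeasure lborel ?B"
        using C(1,3) by (intro emeasure_UN_countable[symmetric]) (auto simp: disjoint_family_on_def pairwise_def disjnt_def)
      also have "\<dots> \<le> emeasure lborel U" using C(2) U(1) by (intro emeasure_mono) (fastforce, simp)
      also have "\<dots> = emeasure lebesgue (S \<union> (U - S))" using U by (simp add: Un_absorb1)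
      also have "\<dots> \<le> emeasure lebesgue S + emeasure lebesgue (U - S)"
        using S U by (intro emeasure_subadditive) auto
      also have "\<dots> \<le> emeasure lebesgue S + ennreal e" using U by (intro add_left_mono) auto
      finally show "hausdorff_content ?m d S \<le> emeasure lebesgue S + ennreal e" by simp
    qed
  qed
  \<comment> \<open>The isodiametric estimate does not depend on the scale, so any one scale will
    do.\<close>
  have "emeasure lebesgue S \<le> hausdorff_content ?m 1 S"
  proof (rule hausdorff_content_ge)
    fix C :: "nat \<Rightarrow> 'a set" assume C: "S \<subseteq> (\<Union>i. C i)" "\<And>i. bounded (C i)" "\<And>i. diameter (C i) \<le> 1"
    have "emeasure lebesgue S \<le> emeasure lebesgue (\<Union>i. closure (C i))"
    proof (rule emeasure_mono)
      show "S \<subseteq> (\<Union>i. closure (C i))" using C(1) closure_subset by (meson SUP_mono' order_trans)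
      show "(\<Union>i. closure (C i)) \<in> sets lebesgue" by (intro sets.countable_UN) auto
    qed
    also have "\<dots> \<le> (\<Sum>i. emeasure lebesgue (closure (C i)))"
      by (intro emeasure_subadditive_countably) auto
    also have "\<dots> \<le> (\<Sum>i. hausdorff_gauge ?m (C i))"
      using isodiametric[of "closure (C _)"] C(2)
      by (intro suminf_le) (auto simp: hausdorff_gauge_def diameter_closure)
    finally show "emeasure lebesgue S \<le> (\<Sum>i. hausdorff_gauge ?m (C i))" .
  qed
  also have "\<dots> \<le> hausdorff_measure ?m S" by (rule hausdorff_content_le_measure) simp
  finally show "emeasure lebesgue S \<le> hausdorff_measure ?m S" .
qed

text \<open>Hausdorff measure depends on the metric alone. Therefore the map may be nonlinear and
  may connect different types of equal dimension, such as a product with the real line and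
  \<open>real ^ 'n\<close>.\<close>

corollary emeasure_isometric_image:
  fixes f :: "'a::euclidean_space \<Rightarrow> 'b::euclidean_space"
  assumes "DIM('a) = DIM('b)" "compact S" and iso: "\<And>x y. x \<in> S \<Longrightarrow> y \<in> S \<Longrightarrow> dist (f x) (f y) = dist x y"
  shows "emeasure lborel (f ` S) = emeasure lborel S"
proof -
  have "continuous_on S f" unfolding continuous_on_iff using iso by auto
  then have c: "compact (f ` S)" using assms(2) compact_continuous_image by blast
  have "emeasure lebesgue (f ` S) = hausdorff_measure (real DIM('b)) (f ` S)"
    using c by (intro hausdorff_measure_eq_lebesgue[symmetric]) (auto simp: compact_imp_bounded borel_compact)
  also have "\<dots> = hausdorff_measure (real DIM('a)) S" using assms by (simp add: hausdorff_measure_isometry)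
  also have "\<dots> = emeasure lebesgue S"
    using assms(2) by (intro hausdorff_measure_eq_lebesgue) (auto simp: compact_imp_bounded borel_compact)
  finally show ?thesis using c assms(2) by (simp add: borel_compact)
qed

section \<open>Flat pieces\<close>

text \<open>
  An index type with one element fewer, so that \<open>real ^ 'n minus_one\<close> has the dimension of a
  hyperplane. As types are nonempty, nothing is removed if \<open>'n\<close> has a single element.
\<close>

typedef ('n::finite) minus_one = "if CARD('n) \<ge> 2 then - {undefined} else (UNIV :: 'n set)"
proof (cases "CARD('n) \<ge> 2")
  case True
  then have "- {undefined} \<noteq> ({} :: 'n set)"
    by (metis Compl_empty_eq card.empty card.insert card_1_singleton_iff double_complement finite.emptyI empty_iff not_numeral_le_zero numeral_2_eq_2 le_antisym One_nat_def not_less_eq_eq order_refl)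
  then show ?thesis using True by auto
qed auto

instance minus_one :: (finite) finite
proof
  show "finite (UNIV :: 'a minus_one set)"
    using type_definition.univ[OF type_definition_minus_one] by (metis finite finite_imageI)
qed

lemma card_minus_one: "CARD('n::finite) \<ge> 2 \<Longrightarrow> CARD('n minus_one) = CARD('n) - 1"
  using type_definition.card[OF type_definition_minus_one[where 'n='n]] by (simp add: Compl_eq_Diff_UNIV card_Diff_singleton)

context
  fixes a :: "real ^ 'n::finite" and b :: real and f :: "real ^ 'n minus_one \<Rightarrow> real ^ 'n"
  assumes dim: "CARD('n) \<ge> 2" and na: "norm a = 1"
    and f: "linear f" "range f = {x. a \<bullet> x = 0}" "\<And>y. norm (f y) = norm y"
begin

text \<open>An isometric parametrization of the hyperplane with unit normal \<open>a\<close> and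
  offset \<open>b\<close>.\<close>

definition chart :: "real ^ 'n minus_one \<Rightarrow> real ^ 'n" where
  "chart y = f y + b *\<^sub>R a"

lemma inner_chart: "a \<bullet> f y = 0" "a \<bullet> chart y = b"
proof -
  show 1: "a \<bullet> f y = 0" using f(2) by blast
  show "a \<bullet> chart y = b" using na by (simp add: chart_def inner_add_right 1 dot_square_norm)
qed

lemma dist_chart: "dist (chart x) (chart y) = dist x y"
  by (simp add: chart_def dist_norm f(3) linear_diff[OF f(1), symmetric])

lemma continuous_chart: "continuous_on UNIV chart"
  unfolding chart_def[abs_def] using f(1) by (intro continuous_intros linear_continuous_on) (simp add: linear_conv_bounded_linear)

lemma range_chart: "range chart = {x. a \<bullet> x = b}"
proof (intro equalityI subsetI)
  fix x assume "x \<in> {x. a \<bullet> x = b}"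
  then have "x - b *\<^sub>R a \<in> range f" using na by (simp add: f(2) inner_diff_right dot_square_norm)
  then obtain y where "x - b *\<^sub>R a = f y" by blast
  then have "x = chart y" by (simp add: chart_def algebra_simps)
  then show "x \<in> range chart" by blast
qed (use inner_chart in auto)

lemma chart_vimage:
  assumes "compact F" "F \<subseteq> {x. a \<bullet> x = b}"
  shows "compact (chart -` F)" "chart ` (chart -` F) = F"
proof -
  show "chart ` (chart -` F) = F" using assms(2) range_chart by auto
  have "closed (chart -` F)"
    using continuous_chart assms(1) by (simp add: closed_vimage compact_imp_closed continuous_on_eq_continuous_at)
  moreover have "bounded (chart -` F)"
  proof -
    obtain B where "\<And>x y. x \<in> F \<Longrightarrow> y \<in> F \<Longrightarrow> dist x y \<le> B"
      using assms(1) compact_imp_bounded bounded_two_points by metis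
    then show ?thesis unfolding bounded_two_points by (metis dist_chart vimageE)
  qed
  ultimately show "compact (chart -` F)" by (simp add: compact_eq_bounded_closed)
qed

lemma hausdorff_measure_chart:
  assumes "compact F"
  shows "hausdorff_measure (real CARD('n) - 1) (chart ` F) = emeasure lborel F"
proof -
  have d: "real CARD('n) - 1 = real DIM(real ^ 'n minus_one)" using dim by (simp add: card_minus_one)
  have "hausdorff_measure (real CARD('n) - 1) (chart ` F) = hausdorff_measure (real CARD('n) - 1) F"
    using dim by (intro hausdorff_measure_isometry) (auto simp: dist_chart)
  also have "\<dots> = emeasure lebesgue F" unfolding d
    using assms by (intro hausdorff_measure_eq_lebesgue) (auto simp: borel_compact compact_imp_bounded)
  finally show ?thesis using assms by (simp add: borel_compact)
qed

text \<open>By Pythagoras the map from \<open>(y, t)\<close> to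
  \<open>chart y + t *\<^sub>R a\<close> is an isometry, so the prism has the volume of the product
  of \<open>F\<close> with an interval.\<close>

lemma emeasure_prism_chart:
  assumes F: "compact F" and e: "e \<ge> 0"
  shows "emeasure lborel ((\<lambda>(x,t). x + t *\<^sub>R a) ` (chart ` F \<times> {0..e})) = ennreal e * emeasure lborel F"
proof -
  let ?T = "\<lambda>(y,t). chart y + t *\<^sub>R a"
  have d: "DIM((real ^ 'n minus_one) \<times> real) = DIM(real ^ 'n)" using dim by (simp add: card_minus_one)
  have "dist (chart x + s *\<^sub>R a) (chart y + t *\<^sub>R a) = dist (x, s) (y, t)" for x y s t
  proof -
    have "chart x + s *\<^sub>R a - (chart y + t *\<^sub>R a) = f (x - y) + (s - t) *\<^sub>R a"
      by (simp add: chart_def linear_diff[OF f(1)] algebra_simps)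
    moreover have "(norm (f (x - y) + (s - t) *\<^sub>R a))^2 = (norm (x - y))^2 + (s - t)^2"
    proof -
      have "(norm (f (x - y) + (s - t) *\<^sub>R a))^2 = f (x - y) \<bullet> f (x - y) + (s - t)^2 * (a \<bullet> a)"
        using inner_chart(1)[of "x - y"] inner_commute[of a "f (x - y)"]
        unfolding power2_norm_eq_inner by (simp add: inner_add_left inner_add_right power2_eq_square)
      then show ?thesis using na by (simp add: dot_square_norm f(3))
    qed
    ultimately have "(dist (chart x + s *\<^sub>R a) (chart y + t *\<^sub>R a))^2 = (dist x y)^2 + (dist s t)^2"
      by (simp add: dist_norm)
    then show ?thesis unfolding dist_Pair_Pair by (metis real_sqrt_unique zero_le_dist)
  qed
  then have "emeasure lborel (?T ` (F \<times> {0..e})) = emeasure lborel (F \<times> {0..e})"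
    using F by (intro emeasure_isometric_image[OF d]) (auto intro: compact_Times)
  also have "\<dots> = emeasure (lborel \<Otimes>\<^sub>M lborel) (F \<times> {0..e})" by (simp add: lborel_prod)
  also have "\<dots> = emeasure lborel F * ennreal e"
    using F e by (subst lborel.emeasure_pair_measure_Times) (auto simp: borel_compact)
  also have "?T ` (F \<times> {0..e}) = (\<lambda>(x,t). x + t *\<^sub>R a) ` (chart ` F \<times> {0..e})" by force
  finally show ?thesis by (simp add: mult.commute)
qed

text \<open>Seen through the chart, a hyperplane with normal \<open>c\<close> is the hyperplane with
  normal \<open>adjoint f c\<close>. That normal is nonzero because \<open>c\<close> is not parallel
  to \<open>a\<close>.\<close>

lemma negligible_chart_hyperplane:
  assumes "norm c = 1" "c \<noteq> a" "c \<noteq> - a"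
  shows "negligible {y. c \<bullet> chart y = \<beta>}"
proof -
  have "{y. c \<bullet> chart y = \<beta>} = {y. adjoint f c \<bullet> y = \<beta> - b * (c \<bullet> a)}"
    using adjoint_works[OF f(1)] by (auto simp: chart_def inner_add_right inner_commute algebra_simps)
  moreover have "adjoint f c \<noteq> 0"
  proof
    assume "adjoint f c = 0"
    \<comment> \<open>Otherwise \<open>c\<close> would be orthogonal to the range of
      \<open>f\<close>, hence a multiple of \<open>a\<close>, and as a unit vector equal to
      \<open>a\<close> or \<open>- a\<close>.\<close>
    then have z: "c \<bullet> f y = 0" for y using adjoint_works[OF f(1), of y c] by (simp add: inner_commute)
    have "c - (a \<bullet> c) *\<^sub>R a \<in> range f" using na by (simp add: f(2) inner_diff_right dot_square_norm)
    then have "c \<bullet> (c - (a \<bullet> c) *\<^sub>R a) = 0" using z by auto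
    then have "(a \<bullet> c)^2 = 1" using assms(1) by (simp add: inner_diff_right dot_square_norm power2_eq_square inner_commute)
    then have "a \<bullet> c = 1 \<or> a \<bullet> c = -1" by (simp add: power2_eq_1_iff)
    moreover have "(norm (c - s *\<^sub>R a))^2 = 1 - 2 * s * (a \<bullet> c) + s^2" for s
    proof -
      have "(norm (c - s *\<^sub>R a))^2 = c \<bullet> c - 2 * s * (a \<bullet> c) + s^2 * (a \<bullet> a)"
        unfolding power2_norm_eq_inner
        by (simp add: inner_diff_left inner_diff_right inner_commute[of c a] power2_eq_square algebra_simps)
      then show ?thesis using assms(1) na by (simp add: dot_square_norm)
    qed
    from this[of 1] this[of "-1"] have "a \<bullet> c = 1 \<Longrightarrow> c = a" "a \<bullet> c = -1 \<Longrightarrow> c = -a"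
      by (auto simp: add_eq_0_iff2)
    ultimately show False using assms by auto
  qed
  ultimately show ?thesis using negligible_hyperplane[of "adjoint f c" "\<beta> - b * (c \<bullet> a)"] by auto
qed

end

lemma hyperplane_isometry:
  fixes a :: "real ^ 'n::finite"
  assumes "CARD('n) \<ge> 2" "a \<noteq> 0"
  obtains f :: "real ^ 'n minus_one \<Rightarrow> real ^ 'n" where "linear f" "range f = {x. a \<bullet> x = 0}" "\<And>y. norm (f y) = norm y"
proof -
  have "dim (UNIV :: (real ^ 'n minus_one) set) = dim {x. a \<bullet> x = 0}"
    using assms by (simp add: dim_hyperplane card_minus_one)
  then show ?thesis
    using isometry_subspaces[of "UNIV :: (real ^ 'n minus_one) set" "{x. a \<bullet> x = 0}"] that
    by (metis UNIV_I subspace_UNIV subspace_hyperplane)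
qed

lemma emeasure_prism:
  fixes a :: "real ^ 'n::finite"
  assumes dim: "CARD('n) \<ge> 2" and na: "norm a = 1" and F: "compact F" "F \<subseteq> {x. a \<bullet> x = b}" and e: "e \<ge> 0"
  shows "emeasure lborel ((\<lambda>(x,t). x + t *\<^sub>R a) ` (F \<times> {0..e})) = ennreal e * hausdorff_measure (real CARD('n) - 1) F"
    "hausdorff_measure (real CARD('n) - 1) F < top"
proof -
  have "a \<noteq> 0" using na by auto
  from hyperplane_isometry[OF dim this] obtain f :: "real ^ 'n minus_one \<Rightarrow> real ^ 'n"
    where f: "linear f" "range f = {x. a \<bullet> x = 0}" "\<And>y. norm (f y) = norm y" by metis
  note ch = chart_vimage[OF dim na f F]
  show "emeasure lborel ((\<lambda>(x,t). x + t *\<^sub>R a) ` (F \<times> {0..e})) = ennreal e * hausdorff_measure (real CARD('n) - 1) F"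
    using emeasure_prism_chart[OF dim na f ch(1) e, where b=b] hausdorff_measure_chart[OF dim na f ch(1), where b=b]
    unfolding ch(2) by simp
  show "hausdorff_measure (real CARD('n) - 1) F < top"
    using hausdorff_measure_chart[OF dim na f ch(1), where b=b] emeasure_compact_finite[OF ch(1)]
    unfolding ch(2) by simp
qed

text \<open>Facets of a polytope meet along their edges. Shrinking a facet so that it stays strictly
  inside the other half-spaces costs arbitrarily little area and makes different facets
  disjoint.\<close>

lemma facet_inner_approximation:
  fixes a :: "real ^ 'n::finite"
  assumes dim: "CARD('n) \<ge> 2" and na: "norm a = 1" and F: "compact F" "F \<subseteq> {x. a \<bullet> x = b}"
    and C: "finite C" "\<And>c. c \<in> C \<Longrightarrow> norm c = 1 \<and> c \<noteq> a \<and> c \<noteq> - a" "\<And>c x. c \<in> C \<Longrightarrow> x \<in> F \<Longrightarrow> c \<bullet> x \<le> \<beta> c"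
    and e: "e > 0"
  obtains G where "compact G" "G \<subseteq> F" "\<And>c x. c \<in> C \<Longrightarrow> x \<in> G \<Longrightarrow> c \<bullet> x < \<beta> c"
    "hausdorff_measure (real CARD('n) - 1) F \<le> hausdorff_measure (real CARD('n) - 1) G + ennreal e"
proof -
  have "a \<noteq> 0" using na by auto
  from hyperplane_isometry[OF dim this] obtain f :: "real ^ 'n minus_one \<Rightarrow> real ^ 'n"
    where f: "linear f" "range f = {x. a \<bullet> x = 0}" "\<And>y. norm (f y) = norm y" by metis
  let ?ch = "chart a b f"
  note ch = chart_vimage[OF dim na f F]
  let ?F = "?ch -` F"
  \<comment> \<open>The points keep a margin of \<open>1 / Suc j\<close> from every other bounding
    hyperplane. These sets increase, and what they miss of \<open>?F\<close> lies on finitely many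
    hyperplanes of the chart.\<close>
  define G where "G j = ?F \<inter> (\<Inter>c\<in>C. {y. c \<bullet> ?ch y \<le> \<beta> c - 1 / real (Suc j)})" for j
  have cG: "compact (G j)" for j
    unfolding G_def using ch(1)
    by (intro compact_Int_closed closed_INT ballI closed_Collect_le continuous_intros
         continuous_on_subset[OF continuous_chart[OF dim na f]]) auto
  have inc: "incseq G"
  proof (rule incseq_SucI)
    fix j
    have "\<beta> c - 1 / real (Suc j) \<le> \<beta> c - 1 / real (Suc (Suc j))" for c by (simp add: frac_le)
    then show "G j \<subseteq> G (Suc j)" unfolding G_def by (fastforce intro: order_trans)
  qed
  let ?N = "\<Union>c\<in>C. {y. c \<bullet> ?ch y = \<beta> c}"
  have neg: "negligible ?N"
    using C(1,2) negligible_chart_hyperplane[OF dim na f] by (intro negligible_Union) auto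
  have "?F - ?N \<subseteq> (\<Union>j. G j)"
  proof
    fix y assume y: "y \<in> ?F - ?N"
    then have lt: "c \<bullet> ?ch y < \<beta> c" if "c \<in> C" for c using that C(3)[OF that, of "?ch y"] by force
    have "\<forall>c\<in>C. \<forall>\<^sub>F j in sequentially. 1 / real (Suc j) < \<beta> c - c \<bullet> ?ch y"
    proof
      fix c assume "c \<in> C"
      then have "0 < \<beta> c - c \<bullet> ?ch y" using lt by simp
      from order_tendstoD(2)[OF LIMSEQ_inverse_real_of_nat this]
      show "\<forall>\<^sub>F j in sequentially. 1 / real (Suc j) < \<beta> c - c \<bullet> ?ch y"
        by (simp only: inverse_eq_divide)
    qed
    then have "\<forall>\<^sub>F j in sequentially. \<forall>c\<in>C. 1 / real (Suc j) < \<beta> c - c \<bullet> ?ch y"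
      using C(1) by (simp add: eventually_ball_finite_distrib)
    then obtain j where "\<forall>c\<in>C. 1 / real (Suc j) < \<beta> c - c \<bullet> ?ch y" by (auto simp: eventually_sequentially)
    then have "y \<in> G j" using y by (force simp: G_def)
    then show "y \<in> (\<Union>j. G j)" by auto
  qed
  then have FU: "?F \<subseteq> (\<Union>j. G j) \<union> ?N" by auto
  have lmF: "?F \<in> lmeasurable" "G j \<in> lmeasurable" for j using ch(1) cG by (auto intro: lmeasurable_compact)
  have UG: "(\<Union>j. G j) \<in> lmeasurable"
  proof (rule fmeasurableI2[OF lmF(1)])
    show "(\<Union>j. G j) \<subseteq> ?F" by (auto simp: G_def)
    show "(\<Union>j. G j) \<in> sets lebesgue" using lmF(2) by (intro sets.countable_UN) auto
  qed
  have "measure lebesgue ?F \<le> measure lebesgue ((\<Union>j. G j) \<union> ?N)"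
    using FU lmF UG neg by (intro measure_mono_fmeasurable) (auto intro: negligible_imp_measurable fmeasurable.Un)
  also have "\<dots> = measure lebesgue (\<Union>j. G j)"
    using neg UG by (simp add: measure_Un_null_set negligible_iff_null_sets fmeasurableD)
  finally have le: "measure lebesgue ?F \<le> measure lebesgue (\<Union>j. G j)" .
  have "(\<lambda>j. measure lebesgue (G j)) \<longlonglongrightarrow> measure lebesgue (\<Union>j. G j)"
    using lmF(2) inc UG by (intro Lim_measure_incseq) (auto simp: fmeasurable_def)
  then have "\<forall>\<^sub>F j in sequentially. measure lebesgue (G j) > measure lebesgue (\<Union>j. G j) - e"
    using e by (intro order_tendstoD) auto
  then obtain j where "measure lebesgue (\<Union>j. G j) - e < measure lebesgue (G j)"
    using eventually_happens'[OF sequentially_bot] by blast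
  then have j: "measure lebesgue ?F < measure lebesgue (G j) + e" using le by linarith
  have m: "emeasure lborel X = ennreal (measure lebesgue X)" if "compact X" for X :: "(real ^ 'n minus_one) set"
  proof -
    have "emeasure lebesgue X = emeasure lborel X" using borel_compact[OF that] by simp
    moreover have "emeasure lebesgue X = ennreal (measure lebesgue X)"
      by (rule emeasure_eq_measure2[OF lmeasurable_compact[OF that]])
    ultimately show ?thesis by (rule subst)
  qed
  show ?thesis
  proof
    show "compact (?ch ` G j)" using cG continuous_chart[OF dim na f]
      by (metis compact_continuous_image continuous_on_subset subset_UNIV)
    show "?ch ` G j \<subseteq> F" by (auto simp: G_def)
    fix c x assume c: "c \<in> C" "x \<in> ?ch ` G j"
    then have "c \<bullet> x \<le> \<beta> c - 1 / real (Suc j)" by (auto simp: G_def)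
    moreover have "1 / real (Suc j) > 0" by simp
    ultimately show "c \<bullet> x < \<beta> c" by linarith
  next
    have "ennreal (measure lebesgue ?F) \<le> ennreal (measure lebesgue (G j)) + ennreal e"
      using j e by (simp add: ennreal_plus[symmetric] del: ennreal_plus)
    then show "hausdorff_measure (real CARD('n) - 1) F \<le> hausdorff_measure (real CARD('n) - 1) (?ch ` G j) + ennreal e"
      using hausdorff_measure_chart[OF dim na f ch(1), where b=b] hausdorff_measure_chart[OF dim na f cG[of j], where b=b] m[OF ch(1)] m[OF cG[of j]]
      unfolding ch(2) by simp
  qed
qed

section \<open>Surface area and parallel volumes\<close>

abbreviation surface :: "(real ^ 'n::finite) set \<Rightarrow> ennreal" where
  "surface K \<equiv> hausdorff_measure (real CARD('n) - 1) (frontier K)"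

lemma surface_mono:
  fixes K L :: "(real ^ 'n::finite) set"
  assumes dim: "CARD('n) \<ge> 2" and K: "convex K" "closed K" "interior K \<noteq> {}" and L: "K \<subseteq> L" "bounded L"
  shows "surface K \<le> surface L"
proof -
  \<comment> \<open>The nearest-point projection is 1-Lipschitz and maps the outer boundary onto the inner one.\<close>
  have "frontier K \<subseteq> closest_point K ` frontier L"
  proof
    fix x assume x: "x \<in> frontier K"
    then have xK: "x \<in> K" using K(2) frontier_subset_closed by blast
    have "x \<notin> rel_interior K" using x K(3) by (simp add: rel_interior_nonempty_interior frontier_def)
    then obtain a where a: "a \<noteq> 0" "\<And>y. y \<in> K \<Longrightarrow> a \<bullet> x \<le> a \<bullet> y"
      using supporting_hyperplane_rel_boundary[OF K(1) xK] by metis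
    obtain B where B: "\<And>y. y \<in> L \<Longrightarrow> norm y \<le> B" using L(2) bounded_iff by blast
    \<comment> \<open>A point far enough out along the outer normal \<open>- a\<close> at
      \<open>x\<close> to be outside \<open>L\<close>. The segment to it crosses
      \<open>frontier L\<close>, and each of its points has \<open>x\<close> as nearest point in
      \<open>K\<close>, because the hyperplane through \<open>x\<close> supports
      \<open>K\<close>.\<close>
    define z where "z = x - ((\<bar>B\<bar> + 1 + norm x) / norm a) *\<^sub>R a"
    have "norm (x - z) = \<bar>B\<bar> + 1 + norm x" using a by (simp add: z_def)
    then have "norm z > B" using norm_triangle_ineq4[of x z] by linarith
    then have "z \<notin> L" using B by force
    moreover have "x \<in> L" using xK L(1) by auto
    ultimately have "closed_segment x z \<inter> frontier L \<noteq> {}"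
      by (intro connected_Int_frontier) (auto intro: convex_connected)
    then obtain u where u: "u \<in> frontier L" "u \<in> closed_segment x z" by auto
    then obtain v where v: "v \<ge> 0" "u = (1 - v) *\<^sub>R x + v *\<^sub>R z" by (auto simp: in_segment)
    obtain s where s: "s \<ge> 0" "u = x - s *\<^sub>R a"
    proof
      show "v * ((\<bar>B\<bar> + 1 + norm x) / norm a) \<ge> 0" using v by simp
      show "u = x - (v * ((\<bar>B\<bar> + 1 + norm x) / norm a)) *\<^sub>R a"
        unfolding v(2) z_def by (simp add: algebra_simps)
    qed
    have "x = closest_point K u"
    proof (rule closest_point_unique[OF K(1,2) xK], intro ballI)
      fix y assume "y \<in> K"
      have "(norm (u - y))^2 = (norm (u - x))^2 + (norm (x - y))^2 + 2 * s * (a \<bullet> y - a \<bullet> x)"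
        unfolding power2_norm_eq_inner s(2)
        by (simp add: inner_diff_left inner_diff_right inner_commute algebra_simps)
      moreover have "s * (a \<bullet> y - a \<bullet> x) \<ge> 0" using s a(2)[OF \<open>y \<in> K\<close>] by simp
      ultimately have "(norm (u - x))^2 \<le> (norm (u - y))^2" using zero_le_power2[of "norm (x - y)"] by linarith
      then show "dist u x \<le> dist u y" by (simp add: dist_norm)
    qed
    then show "x \<in> closest_point K ` frontier L" using u by auto
  qed
  then have "surface K \<le> hausdorff_measure (real CARD('n) - 1) (closest_point K ` frontier L)"
    by (rule hausdorff_measure_mono)
  also have "\<dots> \<le> ennreal (1 powr (real CARD('n) - 1)) * surface L"
    using dim K(3) interior_subset closest_point_lipschitz[OF K(1,2)] by (intro hausdorff_measure_lipschitz_image) auto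
  finally show ?thesis by simp
qed

text \<open>A segment from \<open>x\<close> that leaves \<open>S\<close> must cross the frontier, so
  the point outside is at least as far away as the frontier.\<close>

lemma ball_subset_of_infdist_frontier:
  fixes S :: "'a::euclidean_space set"
  assumes "x \<in> S" "d \<le> infdist x (frontier S)"
  shows "ball x d \<subseteq> S"
proof
  fix y assume y: "y \<in> ball x d"
  show "y \<in> S"
  proof (rule ccontr)
    assume "y \<notin> S"
    then have "closed_segment x y \<inter> frontier S \<noteq> {}"
      using assms by (intro connected_Int_frontier) (auto intro: convex_connected)
    then obtain u where u: "u \<in> frontier S" "u \<in> closed_segment x y" by auto
    then have "infdist x (frontier S) \<le> dist x u" by (simp add: infdist_le)
    also have "\<dots> \<le> dist x y" using u(2) by (metis dist_commute dist_in_closed_segment)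
    finally show False using y assms by simp
  qed
qed

section \<open>Polytopes: surface area and parallel volumes\<close>

locale polytope_halfspaces =
  fixes A :: "(real ^ 'n::finite) set" and b :: "real ^ 'n \<Rightarrow> real" and z :: "real ^ 'n"
  assumes dim: "CARD('n) \<ge> 2" and finA: "finite A" and unit: "\<And>a. a \<in> A \<Longrightarrow> norm a = 1"
    and interior_point: "\<And>a. a \<in> A \<Longrightarrow> a \<bullet> z < b a"
    and bounded_poly: "bounded {x. \<forall>a\<in>A. a \<bullet> x \<le> b a}"
begin

definition poly :: "(real ^ 'n) set" where "poly = {x. \<forall>a\<in>A. a \<bullet> x \<le> b a}"

definition facet :: "real ^ 'n \<Rightarrow> (real ^ 'n) set" where "facet a = {x \<in> poly. a \<bullet> x = b a}"

definition area :: "real ^ 'n \<Rightarrow> real" where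
  "area a = enn2real (hausdorff_measure (real CARD('n) - 1) (facet a))"

lemma poly_alt: "poly = (\<Inter>a\<in>A. {x. a \<bullet> x \<le> b a})" by (auto simp: poly_def)

lemma closed_poly: "closed poly"
  unfolding poly_alt by (intro closed_INT ballI closed_halfspace_le)

lemma convex_poly: "convex poly"
  unfolding poly_alt by (intro convex_INT convex_halfspace_le)

lemma compact_poly: "compact poly"
  using closed_poly bounded_poly by (simp add: compact_eq_bounded_closed poly_def)

lemma compact_facet: "compact (facet a)"
proof -
  have "facet a = poly \<inter> {x. a \<bullet> x = b a}" by (auto simp: facet_def)
  then show ?thesis using compact_Int_closed[OF compact_poly closed_hyperplane[of a "b a"]] by metis
qed

lemma facet_subset: "facet a \<subseteq> {x. a \<bullet> x = b a}" "facet a \<subseteq> poly"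
  by (auto simp: facet_def)

lemma hausdorff_facet: "a \<in> A \<Longrightarrow> hausdorff_measure (real CARD('n) - 1) (facet a) = ennreal (area a)"
  using emeasure_prism(2)[OF dim unit compact_facet facet_subset(1), of a 0]
  by (simp add: area_def)

lemma area_nonneg: "area a \<ge> 0" by (simp add: area_def)

lemma frontier_poly: "frontier poly = (\<Union>a\<in>A. facet a)"
proof (intro equalityI subsetI)
  fix x assume x: "x \<in> frontier poly"
  then have xp: "x \<in> poly" using closed_poly frontier_subset_closed by blast
  have "open (\<Inter>a\<in>A. {x. a \<bullet> x < b a})" using finA by (intro open_INT) (auto simp: open_halfspace_lt)
  moreover have "(\<Inter>a\<in>A. {x. a \<bullet> x < b a}) \<subseteq> poly" by (auto simp: poly_def intro: less_imp_le)
  ultimately have "(\<Inter>a\<in>A. {x. a \<bullet> x < b a}) \<subseteq> interior poly" by (simp add: interior_maximal)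
  then have "x \<notin> (\<Inter>a\<in>A. {x. a \<bullet> x < b a})" using x by (auto simp: frontier_def)
  then obtain a where "a \<in> A" "\<not> a \<bullet> x < b a" by auto
  then show "x \<in> (\<Union>a\<in>A. facet a)" using xp by (force simp: facet_def poly_def)
next
  fix x assume "x \<in> (\<Union>a\<in>A. facet a)"
  then obtain a where a: "a \<in> A" "x \<in> poly" "a \<bullet> x = b a" by (auto simp: facet_def)
  have "x \<notin> interior poly"
  proof
    assume "x \<in> interior poly"
    then obtain e where e: "e > 0" "cball x e \<subseteq> poly" by (meson mem_interior_cball)
    have "x + e *\<^sub>R a \<in> cball x e" using e unit[OF a(1)] by (simp add: dist_norm)
    then have "a \<bullet> (x + e *\<^sub>R a) \<le> b a" using e a(1) by (auto simp: poly_def)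
    then show False using e a unit[OF a(1)] by (simp add: inner_add_right dot_square_norm)
  qed
  then show "x \<in> frontier poly" using a closure_subset by (auto simp: frontier_def)
qed

text \<open>Subadditivity gives one inequality. For the other, each facet is replaced by a slightly
  smaller compact piece; the pieces are disjoint, so their measures add up.\<close>

lemma surface_poly: "surface poly = ennreal (\<Sum>a\<in>A. area a)"
proof (rule antisym)
  show "surface poly \<le> ennreal (\<Sum>a\<in>A. area a)"
    unfolding frontier_poly using hausdorff_measure_UN_le[OF finA, where s="real CARD('n) - 1" and A=facet]
    by (simp add: hausdorff_facet area_nonneg cong: sum.cong)
  show "ennreal (\<Sum>a\<in>A. area a) \<le> surface poly"
  proof (rule ennreal_le_epsilon)
    fix e :: real assume e: "e > 0"
    \<comment> \<open>The area that each facet may lose; the \<open>+ 1\<close> keeps the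
      denominator positive.\<close>
    define h where "h = e / (real (card A) + 1)"
    have h: "h > 0" "real (card A) * h \<le> e" using e by (auto simp: h_def field_simps)
    have "\<exists>G. compact G \<and> G \<subseteq> facet a \<and> (\<forall>c\<in>A - {a}. \<forall>x\<in>G. c \<bullet> x < b c) \<and>
       hausdorff_measure (real CARD('n) - 1) (facet a) \<le> hausdorff_measure (real CARD('n) - 1) G + ennreal h"
      if a: "a \<in> A" for a
    proof -
      obtain G where G: "compact G" "G \<subseteq> facet a" "\<And>c x. c \<in> A - {a, -a} \<Longrightarrow> x \<in> G \<Longrightarrow> c \<bullet> x < b c"
        "hausdorff_measure (real CARD('n) - 1) (facet a) \<le> hausdorff_measure (real CARD('n) - 1) G + ennreal h"
        by (rule facet_inner_approximation[OF dim unit[OF a] compact_facet facet_subset(1), of "A - {a,-a}" b h])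
           (use finA unit h in \<open>auto simp: facet_def poly_def\<close>)
      \<comment> \<open>The opposite normal is excluded from the approximation lemma. Its facet is
        parallel to that of \<open>a\<close> and disjoint from it, since \<open>z\<close> lies
        strictly between the two hyperplanes.\<close>
      moreover have "(- a) \<bullet> x < b (- a)" if "- a \<in> A" "x \<in> G" for x
        using interior_point[OF a] interior_point[OF that(1)] G(2) that(2) by (auto simp: facet_def)
      ultimately show ?thesis by blast
    qed
    then obtain G where G: "\<And>a. a \<in> A \<Longrightarrow> compact (G a) \<and> G a \<subseteq> facet a \<and> (\<forall>c\<in>A - {a}. \<forall>x\<in>G a. c \<bullet> x < b c) \<and>
       hausdorff_measure (real CARD('n) - 1) (facet a) \<le> hausdorff_measure (real CARD('n) - 1) (G a) + ennreal h"
      by metis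
    have dj: "disjoint_family_on G A"
      unfolding disjoint_family_on_def
    proof (intro ballI impI)
      fix c d assume cd: "c \<in> A" "d \<in> A" "c \<noteq> d"
      have "c \<bullet> x = b c" if "x \<in> G c" for x using G[OF cd(1)] that by (auto simp: facet_def)
      moreover have "c \<bullet> x < b c" if "x \<in> G d" for x using G[OF cd(2)] that cd by auto
      ultimately show "G c \<inter> G d = {}" by fastforce
    qed
    have "ennreal (\<Sum>a\<in>A. area a) = (\<Sum>a\<in>A. hausdorff_measure (real CARD('n) - 1) (facet a))"
      by (simp add: hausdorff_facet area_nonneg cong: sum.cong)
    also have "\<dots> \<le> (\<Sum>a\<in>A. hausdorff_measure (real CARD('n) - 1) (G a) + ennreal h)"
      using G by (intro sum_mono) auto
    also have "\<dots> = (\<Sum>a\<in>A. hausdorff_measure (real CARD('n) - 1) (G a)) + ennreal (real (card A) * h)"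
      using h by (simp add: sum.distrib ennreal_mult ennreal_of_nat_eq_real_of_nat)
    also have "\<dots> \<le> surface poly + ennreal e"
    proof (intro add_mono)
      have "(\<Sum>a\<in>A. hausdorff_measure (real CARD('n) - 1) (G a)) \<le> hausdorff_measure (real CARD('n) - 1) (\<Union>a\<in>A. G a)"
        using dim G dj by (intro hausdorff_measure_disjoint_compact finA) auto
      also have "\<dots> \<le> surface poly" unfolding frontier_poly using G by (intro hausdorff_measure_mono) blast
      finally show "(\<Sum>a\<in>A. hausdorff_measure (real CARD('n) - 1) (G a)) \<le> surface poly" .
      show "ennreal (real (card A) * h) \<le> ennreal e" using h by (intro ennreal_leI)
    qed
    finally show "ennreal (\<Sum>a\<in>A. area a) \<le> surface poly + ennreal e" .
  qed
qed

text \<open>The sign \<sigma> selects the prism erected outward (\<open>1\<close>) or inward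
  (\<open>-1\<close>).\<close>

definition prism :: "real \<Rightarrow> real \<Rightarrow> real ^ 'n \<Rightarrow> (real ^ 'n) set" where
  "prism \<sigma> e a = (\<lambda>(x,t). x + t *\<^sub>R (\<sigma> *\<^sub>R a)) ` (facet a \<times> {0..e})"

lemma prism:
  assumes "a \<in> A" "e \<ge> 0" "\<sigma> = 1 \<or> \<sigma> = -1"
  shows "compact (prism \<sigma> e a)" "vol (prism \<sigma> e a) = e * area a"
proof -
  show c: "compact (prism \<sigma> e a)"
    unfolding prism_def case_prod_beta
    by (intro compact_continuous_image continuous_intros compact_Times compact_facet compact_Icc)
  have "facet a \<subseteq> {x. (\<sigma> *\<^sub>R a) \<bullet> x = \<sigma> * b a}" by (auto simp: facet_def)
  then have "emeasure lborel (prism \<sigma> e a) = ennreal e * ennreal (area a)"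
    unfolding prism_def using assms unit[OF assms(1)]
    by (subst emeasure_prism(1)[OF dim _ compact_facet, where b="\<sigma> * b a"]) (auto simp: hausdorff_facet)
  also have "\<dots> = ennreal (e * area a)" using assms area_nonneg by (simp add: ennreal_mult)
  finally have "measure lborel (prism \<sigma> e a) = e * area a"
    using assms area_nonneg by (simp add: measure_def)
  then show "vol (prism \<sigma> e a) = e * area a" using c by (simp add: borel_compact)
qed

lemma negligible_facet: "a \<in> A \<Longrightarrow> negligible (facet a)"
proof -
  assume "a \<in> A"
  then have "a \<noteq> 0" using unit[of a] by auto
  then show ?thesis by (intro negligible_subset[OF negligible_hyperplane facet_subset(1)]) simp
qed

text \<open>The nearest-point projection recovers the base point of an outward prism. This is what
  keeps prisms over different facets from overlapping.\<close>

lemma closest_point_prism: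
  assumes "a \<in> A" "x \<in> facet a" "t \<ge> 0"
  shows "closest_point poly (x + t *\<^sub>R a) = x"
proof (rule closest_point_unique[OF convex_poly closed_poly, symmetric])
  show "x \<in> poly" using assms facet_subset by blast
  show "\<forall>y\<in>poly. dist (x + t *\<^sub>R a) x \<le> dist (x + t *\<^sub>R a) y"
  proof
    fix y assume "y \<in> poly"
    then have "a \<bullet> y \<le> a \<bullet> x" using assms by (auto simp: poly_def facet_def)
    then have "t \<le> a \<bullet> (x + t *\<^sub>R a - y)"
      using unit[OF assms(1)] by (simp add: inner_diff_right inner_add_right dot_square_norm)
    also have "\<dots> \<le> norm a * norm (x + t *\<^sub>R a - y)" by (rule norm_cauchy_schwarz)
    finally show "dist (x + t *\<^sub>R a) x \<le> dist (x + t *\<^sub>R a) y"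
      using assms unit[OF assms(1)] by (simp add: dist_norm)
  qed
qed

text \<open>The outward prisms are disjoint from each other and from the polytope up to facets,
  which are null sets. The parallel set also contains the regions around lower-dimensional faces;
  leaving these out gives the inequality.\<close>

lemma outer_parallel_poly:
  assumes e: "e > 0"
  shows "vol poly + e * (\<Sum>a\<in>A. area a) \<le> vol {x. infdist x poly \<le> e}"
proof -
  let ?P = "\<Union>a\<in>A. prism 1 e a"
  have z: "z \<in> poly" using interior_point by (auto simp: poly_def intro: less_imp_le)
  \<comment> \<open>A common point has the same base point in both prisms, so the two displacements
    agree; as the unit normals differ, the displacement is zero.\<close>
  have pc: "p \<in> prism 1 e a \<Longrightarrow> p \<in> prism 1 e c \<Longrightarrow> a \<noteq> c \<Longrightarrow> p \<in> facet a" if ac: "a \<in> A" "c \<in> A" for a c p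
  proof -
    assume p: "p \<in> prism 1 e a" "p \<in> prism 1 e c" "a \<noteq> c"
    obtain x s where x: "p = x + s *\<^sub>R a" "x \<in> facet a" "s \<ge> 0" using p(1) by (auto simp: prism_def)
    obtain y t where y: "p = y + t *\<^sub>R c" "y \<in> facet c" "t \<ge> 0" using p(2) by (auto simp: prism_def)
    have xy: "x = y" using closest_point_prism[OF ac(1) x(2,3)] closest_point_prism[OF ac(2) y(2,3)] x(1) y(1) by simp
    then have *: "s *\<^sub>R a = t *\<^sub>R c" using x(1) y(1) by simp
    then have "norm (s *\<^sub>R a) = norm (t *\<^sub>R c)" by simp
    then have "s = t" using unit ac x y by simp
    then have "s = 0" using * p(3) by simp
    then show "p \<in> facet a" using x by simp
  qed
  have "vol ?P = (\<Sum>a\<in>A. vol (prism 1 e a))"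
  proof (rule measure_negligible_finite_Union_image[OF finA])
    show "pairwise (\<lambda>a c. negligible (prism 1 e a \<inter> prism 1 e c)) A"
      unfolding pairwise_def
    proof (intro ballI impI)
      fix a c assume "a \<in> A" "c \<in> A" "a \<noteq> c"
      then show "negligible (prism 1 e a \<inter> prism 1 e c)"
        using pc by (intro negligible_subset[OF negligible_facet[of a]]) auto
    qed
  qed (use prism(1) e in \<open>auto intro!: lmeasurable_compact\<close>)
  then have vP: "vol ?P = e * (\<Sum>a\<in>A. area a)" using prism(2) e by (simp add: sum_distrib_left)
  have lP: "?P \<in> lmeasurable" using prism(1) e finA by (intro lmeasurable_compact compact_UN) auto
  have lp: "poly \<in> lmeasurable" using compact_poly by (rule lmeasurable_compact)
  have "negligible (poly \<inter> ?P)"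
  proof (rule negligible_subset)
    show "negligible (\<Union>a\<in>A. facet a)" using finA negligible_facet by (intro negligible_Union) auto
    show "poly \<inter> ?P \<subseteq> (\<Union>a\<in>A. facet a)"
    proof
      fix p assume "p \<in> poly \<inter> ?P"
      then obtain a x t where a: "a \<in> A" "p \<in> poly" "x \<in> facet a" "t \<ge> 0" "p = x + t *\<^sub>R a" by (auto simp: prism_def)
      then have "x = p" using closest_point_prism[of a x t] closest_point_self by metis
      then show "p \<in> (\<Union>a\<in>A. facet a)" using a by auto
    qed
  qed
  then have "vol (poly \<union> ?P) = vol poly + vol ?P" using lP lp
    by (simp add: measure_Un3 negligible_imp_measure0)
  moreover have "vol (poly \<union> ?P) \<le> vol {x. infdist x poly \<le> e}"
  proof (rule measure_mono_fmeasurable)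
    have "infdist (x + t *\<^sub>R a) poly \<le> e" if "a \<in> A" "x \<in> facet a" "0 \<le> t" "t \<le> e" for x t a
      using infdist_le[of x poly "x + t *\<^sub>R a"] that subsetD[OF facet_subset(2), of x a] unit[of a] by (simp add: dist_norm)
    then show "poly \<union> ?P \<subseteq> {x. infdist x poly \<le> e}" using e by (auto simp: prism_def)
    show "poly \<union> ?P \<in> sets lebesgue" using lP lp by auto
    show "{x. infdist x poly \<le> e} \<in> lmeasurable"
      using compact_infdist_le[OF _ compact_poly, of e] z e by (auto intro!: lmeasurable_compact)
  qed
  ultimately show ?thesis using vP by simp
qed

text \<open>A point of the polytope at distance less than \<open>e\<close> from the frontier lies in
  the inward prism over the facet that contains its nearest frontier point. The prisms may overlap,
  hence an inequality.\<close>

lemma inner_parallel_poly: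
  assumes e: "e \<ge> 0"
  shows "vol poly - e * (\<Sum>a\<in>A. area a) \<le> vol {x \<in> poly. e \<le> infdist x (frontier poly)}"
proof -
  let ?P = "\<Union>a\<in>A. prism (-1) e a" and ?I = "{x \<in> poly. e \<le> infdist x (frontier poly)}"
  have lP: "?P \<in> lmeasurable" using prism(1) e finA by (intro lmeasurable_compact compact_UN) auto
  have "?I = poly \<inter> {x. e \<le> infdist x (frontier poly)}" by auto
  then have lI: "?I \<in> lmeasurable"
    using compact_poly by (auto intro!: lmeasurable_compact compact_Int_closed closed_Collect_le continuous_intros)
  have "poly \<subseteq> ?I \<union> ?P"
  proof
    fix x assume x: "x \<in> poly"
    show "x \<in> ?I \<union> ?P"
    proof (cases "e \<le> infdist x (frontier poly)")
      case False
      have ne: "frontier poly \<noteq> {}" 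
        using x compact_poly by (metis compact_imp_bounded empty_iff frontier_eq_empty not_bounded_UNIV)
      obtain y where y: "y \<in> frontier poly" "infdist x (frontier poly) = dist x y"
        using infdist_attains_inf[OF frontier_closed ne, of x] by metis
      then obtain a where a: "a \<in> A" "y \<in> facet a" by (auto simp: frontier_poly)
      let ?d = "dist x y"
      \<comment> \<open>The closed ball of radius \<open>?d\<close> around \<open>x\<close> lies in
        the polytope and touches the hyperplane of the facet at \<open>y\<close>. Its extreme point
        in direction \<open>a\<close> must therefore be \<open>y\<close>, so that
        \<open>y - x\<close> equals \<open>?d *\<^sub>R a\<close>.\<close>
      have "x + ?d *\<^sub>R a \<in> poly"
      proof (cases "?d = 0")
        case False
        then have "cball x ?d \<subseteq> poly"
          using ball_subset_of_infdist_frontier[OF x, of ?d] y closed_poly closure_minimal[of "ball x ?d" poly] by simp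
        then show ?thesis using unit[OF a(1)] by (auto simp: dist_norm)
      qed (use x in auto)
      then have "a \<bullet> x + ?d \<le> b a" using a(1) unit[OF a(1)] by (auto simp: poly_def inner_add_right dot_square_norm)
      then have ge: "?d \<le> a \<bullet> (y - x)" using a(2) by (simp add: facet_def inner_diff_right)
      have "(norm (y - x - ?d *\<^sub>R a))^2 = (norm (y - x))^2 - 2 * ?d * (a \<bullet> (y - x)) + ?d^2 * (norm a)^2"
        unfolding power2_norm_eq_inner by (simp add: inner_diff_left inner_diff_right inner_commute algebra_simps power2_eq_square)
      also have "\<dots> \<le> ?d^2 - 2 * ?d * ?d + ?d^2"
        using mult_left_mono[OF ge, of "2 * ?d"] unit[OF a(1)] by (simp add: dist_norm norm_minus_commute)
      finally have "(norm (y - x - ?d *\<^sub>R a))^2 \<le> 0" by (simp add: power2_eq_square)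
      then have "y - x - ?d *\<^sub>R a = 0" by simp
      then have "x = y + ?d *\<^sub>R (- 1 *\<^sub>R a)" by (simp add: algebra_simps)
      then have "x \<in> prism (-1) e a" using False y a unfolding prism_def by (intro image_eqI[of _ _ "(y, ?d)"]) auto
      then show ?thesis using a by auto
    qed (use x in auto)
  qed
  then have "vol poly \<le> vol (?I \<union> ?P)" using lP lI compact_poly
    by (intro measure_mono_fmeasurable) (auto intro: fmeasurable.Un lmeasurable_compact fmeasurableD)
  also have "\<dots> \<le> vol ?I + vol ?P" using lP lI by (intro measure_Un_le) auto
  also have "vol ?P \<le> (\<Sum>a\<in>A. vol (prism (-1) e a))"
    using finA prism(1) e by (intro measure_UNION_le) (auto intro!: lmeasurable_compact fmeasurableD)
  also have "\<dots> = e * (\<Sum>a\<in>A. area a)" using prism(2) e by (simp add: sum_distrib_left)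
  finally show ?thesis by simp
qed

end

section \<open>From polytopes to convex bodies\<close>

lemma vol_dilation:
  fixes K :: "'a::euclidean_space set"
  assumes "\<mu> > 0"
  shows "vol ((\<lambda>x. p + \<mu> *\<^sub>R (x - p)) ` K) = \<mu> ^ DIM('a) * vol K"
proof -
  have eq: "(\<lambda>x. p + \<mu> *\<^sub>R (x - p)) = (\<lambda>x. \<mu> *\<^sub>R x + (p - \<mu> *\<^sub>R p))"
    by (auto simp: algebra_simps)
  show ?thesis unfolding eq using measure_lebesgue_affine[of \<mu> "p - \<mu> *\<^sub>R p" K] assms by simp
qed

text \<open>Every frontier point of the dilated body \<open>L\<close> is cut off by some half-space
  containing \<open>K\<close>. By compactness finitely many half-spaces cut off the whole frontier
  of \<open>L\<close>; their intersection contains \<open>p\<close> and cannot leave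
  \<open>L\<close> without crossing that frontier.\<close>

lemma convex_body_polytope_approximation:
  fixes K :: "(real ^ 'n::finite) set"
  assumes dim: "CARD('n) \<ge> 2" and K: "compact K" "convex K" and p: "p \<in> interior K" and \<mu>: "\<mu> > 1"
  obtains A b where "polytope_halfspaces A b p" "K \<subseteq> polytope_halfspaces.poly A b"
    "polytope_halfspaces.poly A b \<subseteq> (\<lambda>x. p + \<mu> *\<^sub>R (x - p)) ` K"
proof -
  let ?h = "\<lambda>x. p + \<mu> *\<^sub>R (x - p)"
  define L where "L = ?h ` K"
  have pK: "p \<in> K" using p interior_subset by blast
  have hinv: "x \<in> L \<longleftrightarrow> p + (1/\<mu>) *\<^sub>R (x - p) \<in> K" for x
  proof
    assume "p + (1/\<mu>) *\<^sub>R (x - p) \<in> K"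
    moreover have "x = ?h (p + (1/\<mu>) *\<^sub>R (x - p))" using \<mu> by simp
    ultimately show "x \<in> L" unfolding L_def by blast
  qed (use \<mu> in \<open>auto simp: L_def\<close>)
  have cL: "compact L" unfolding L_def by (intro compact_continuous_image continuous_intros K)
  have KL: "K \<subseteq> L"
  proof
    fix x assume "x \<in> K"
    then have "(1 - 1/\<mu>) *\<^sub>R p + (1/\<mu>) *\<^sub>R x \<in> K" using K(2) pK \<mu> by (intro convexD) auto
    then show "x \<in> L" unfolding hinv by (simp add: algebra_simps)
  qed
  have pL: "p \<in> interior L" using p KL interior_mono by blast
  \<comment> \<open>The support function of \<open>K\<close>, so that the half-space with normal
    \<open>a\<close> is the smallest one containing \<open>K\<close>.\<close>
  define b where "b a = (SUP x\<in>K. a \<bullet> x)" for a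
  have bdd: "bdd_above ((\<lambda>x. a \<bullet> x) ` K)" for a
    using K(1) by (intro bounded_imp_bdd_above compact_imp_bounded compact_continuous_image continuous_intros)
  have ble: "a \<bullet> x \<le> b a" if "x \<in> K" for a x unfolding b_def using that bdd by (rule cSUP_upper)
  have "\<exists>a. norm a = 1 \<and> b a < a \<bullet> y" if y: "y \<in> frontier L" for y
  proof -
    have "y \<notin> K"
    proof
      assume "y \<in> K"
      obtain e where e: "e > 0" "ball p e \<subseteq> K" using p by (meson mem_interior)
      \<comment> \<open>After contraction by \<mu> towards \<open>p\<close>, each point of this ball
        becomes a convex combination of \<open>y\<close> and a point \<open>w\<close> of the ball
        around \<open>p\<close>; the radius is chosen to make \<open>w\<close> fall there. So a
        point of \<open>K\<close> is interior to \<open>L\<close>.\<close>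
      have "ball y ((\<mu> - 1) * e) \<subseteq> L"
      proof
        fix z assume z: "z \<in> ball y ((\<mu> - 1) * e)"
        define w where "w = p + (1 / (\<mu> - 1)) *\<^sub>R (z - y)"
        have "norm (z - y) < (\<mu> - 1) * e" using z by (simp add: dist_norm norm_minus_commute)
        moreover have "dist p w = norm (z - y) / (\<mu> - 1)" using \<mu> by (simp add: w_def dist_norm)
        ultimately have "w \<in> ball p e" using \<mu> by (simp add: pos_divide_less_eq mult.commute)
        then have "w \<in> K" using e by auto
        then have "(1/\<mu>) *\<^sub>R y + (1 - 1/\<mu>) *\<^sub>R w \<in> K" using \<open>y \<in> K\<close> K(2) \<mu> by (intro convexD) auto
        moreover have eq: "(1 - 1/\<mu>) *\<^sub>R w = (1 - 1/\<mu>) *\<^sub>R p + (1/\<mu>) *\<^sub>R (z - y)"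
          using \<mu> by (simp add: w_def scaleR_add_right) (simp add: field_simps)
        moreover have "(1/\<mu>) *\<^sub>R y + (1 - 1/\<mu>) *\<^sub>R w = p + (1/\<mu>) *\<^sub>R (z - p)"
          unfolding eq by (simp add: algebra_simps)
        ultimately show "z \<in> L" unfolding hinv by metis
      qed
      then have "y \<in> interior L" using \<mu> e by (meson centre_in_ball interior_maximal mult_pos_pos open_ball subsetD diff_gt_0_iff_gt)
      then show False using y by (simp add: frontier_def)
    qed
    then obtain a c where ac: "a \<bullet> y < c" "\<And>x. x \<in> K \<Longrightarrow> a \<bullet> x > c"
      using separating_hyperplane_closed_point[of K y] K compact_imp_closed by blast
    have a0: "a \<noteq> 0" using ac pK by (metis inner_zero_left less_asym)
    let ?a = "- (1 / norm a) *\<^sub>R a"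
    have "b ?a \<le> - c / norm a" unfolding b_def
    proof (rule cSUP_least)
      fix x assume "x \<in> K"
      then show "?a \<bullet> x \<le> - c / norm a" using ac(2)[of x] a0 by (simp add: divide_right_mono)
    qed (use pK in auto)
    also have "\<dots> < ?a \<bullet> y" using ac(1) a0 by (simp add: divide_strict_right_mono)
    finally show ?thesis using a0 by (intro exI[of _ ?a]) simp
  qed
  then obtain N where N: "\<And>y. y \<in> frontier L \<Longrightarrow> norm (N y) = 1 \<and> b (N y) < N y \<bullet> y" by metis
  have cf: "compact (frontier L)" using cL by (simp add: compact_frontier)
  have cov: "frontier L \<subseteq> (\<Union>y\<in>frontier L. {x. N y \<bullet> x > b (N y)})" using N by auto
  obtain Y where Y: "Y \<subseteq> frontier L" "finite Y" "frontier L \<subseteq> (\<Union>y\<in>Y. {x. N y \<bullet> x > b (N y)})"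
    by (rule compactE_image[OF cf _ cov]) (auto simp: open_halfspace_gt)
  define A where "A = N ` Y"
  let ?Q = "{x. \<forall>a\<in>A. a \<bullet> x \<le> b a}"
  have KQ: "K \<subseteq> ?Q" using ble by auto
  have fQ: "?Q \<inter> frontier L = {}" using Y(3) by (force simp: A_def)
  have cQ: "convex ?Q"
  proof -
    have "?Q = (\<Inter>a\<in>A. {x. a \<bullet> x \<le> b a})" by auto
    then show ?thesis by (simp add: convex_INT convex_halfspace_le)
  qed
  have QL: "?Q \<subseteq> L"
  proof
    fix x assume x: "x \<in> ?Q"
    show "x \<in> L"
    proof (rule ccontr)
      assume "x \<notin> L"
      then have "closed_segment p x \<inter> frontier L \<noteq> {}"
        using pK KL by (intro connected_Int_frontier) (auto intro: convex_connected)
      moreover have "closed_segment p x \<subseteq> ?Q" using x pK KQ cQ by (intro closed_segment_subset) auto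
      ultimately show False using fQ by blast
    qed
  qed
  have poly: "polytope_halfspaces A b p"
  proof
    show "CARD('n) \<ge> 2" by (rule dim)
    show "finite A" using Y by (simp add: A_def)
    show n1: "norm a = 1" if "a \<in> A" for a using that N Y(1) by (auto simp: A_def)
    show "a \<bullet> p < b a" if a: "a \<in> A" for a
    proof -
      obtain e where e: "e > 0" "cball p e \<subseteq> K" using p by (meson mem_interior_cball)
      have "p + e *\<^sub>R a \<in> K" using e n1[OF a] by (auto simp: dist_norm)
      then have "a \<bullet> (p + e *\<^sub>R a) \<le> b a" by (rule ble)
      then show ?thesis using e n1[OF a] by (simp add: inner_add_right dot_square_norm)
    qed
    show "bounded ?Q" using QL cL compact_imp_bounded bounded_subset by blast
  qed
  show ?thesis
    using that[OF poly] KQ QL unfolding polytope_halfspaces.poly_def[OF poly] L_def by blast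
qed

text \<open>Converse to \<open>ball_subset_of_infdist_frontier\<close>; with it, estimates of the
  distance to the frontier become inclusions of balls.\<close>

lemma infdist_frontier_ge:
  fixes S :: "'a::euclidean_space set"
  assumes "ball x d \<subseteq> S" "frontier S \<noteq> {}"
  shows "d \<le> infdist x (frontier S)"
proof -
  have "d \<le> dist x y" if y: "y \<in> frontier S" for y
  proof (rule ccontr)
    assume "\<not> ?thesis"
    then have "y \<in> ball x d" by simp
    then have "y \<in> interior S" using assms(1) by (meson interior_maximal open_ball subsetD)
    then show False using y by (simp add: frontier_def)
  qed
  then show ?thesis using assms(2) by (auto simp: infdist_def intro!: cINF_greatest)
qed

context
  fixes K :: "(real ^ 'n::finite) set"
  assumes dim: "CARD('n) \<ge> 2" and K: "compact K" "convex K" "interior K \<noteq> {}"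
begin

lemma frontier_body_nonempty: "frontier K \<noteq> {}"
  using K by (metis compact_imp_bounded frontier_eq_empty interior_empty not_bounded_UNIV)

text \<open>Monotonicity with respect to a circumscribed polytope, whose surface is a finite sum of
  facet areas.\<close>

lemma surface_finite: "surface K < top"
proof -
  obtain p where p: "p \<in> interior K" using K(3) by auto
  obtain A b where Ab: "polytope_halfspaces A b p" "K \<subseteq> polytope_halfspaces.poly A b"
    by (rule convex_body_polytope_approximation[OF dim K(1,2) p, of 2]) auto
  have "surface K \<le> surface (polytope_halfspaces.poly A b)"
    using Ab K polytope_halfspaces.compact_poly[OF Ab(1)] dim
    by (intro surface_mono) (auto simp: compact_imp_closed compact_imp_bounded)
  also have "\<dots> < top" by (simp add: polytope_halfspaces.surface_poly[OF Ab(1)])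
  finally show ?thesis .
qed

text \<open>Lets the dilation factor tend to 1 from above.\<close>

lemma limit_dilation_le:
  fixes x y u :: real
  assumes "\<And>\<mu>::real. \<mu> > 1 \<Longrightarrow> x \<le> \<mu> ^ CARD('n) * y + u"
  shows "x \<le> y + u"
proof -
  have "((\<lambda>\<mu>::real. \<mu> ^ CARD('n) * y + u) \<longlongrightarrow> 1 ^ CARD('n) * y + u) (at_right 1)"
    by (intro tendsto_intros)
  moreover have "\<forall>\<^sub>F \<mu>::real in at_right 1. x \<le> \<mu> ^ CARD('n) * y + u"
    using assms by (auto simp: eventually_at_right_field intro!: exI[of _ 2])
  ultimately have "x \<le> 1 ^ CARD('n) * y + u"
    using tendsto_lowerbound trivial_limit_at_right_real by blast
  then show ?thesis by simp
qed

text \<open>The polytope is taken outside \<open>K\<close>, so that monotonicity bounds the surface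
  of \<open>K\<close> by that of the polytope, as a lower estimate of the parallel volume requires.
  The dilation then relates the parallel set of the polytope to that of \<open>K\<close>.\<close>

lemma outer_parallel_body:
  assumes e: "e > 0"
  shows "vol K + e * enn2real (surface K) \<le> vol {x. infdist x K \<le> e}"
proof -
  obtain p where p: "p \<in> interior K" using K(3) by auto
  have pK: "p \<in> K" using p interior_subset by blast
  have "vol K + e * enn2real (surface K) \<le> \<mu> ^ CARD('n) * vol {x. infdist x K \<le> e} + 0" if \<mu>: "\<mu> > 1" for \<mu>
  proof -
    let ?h = "\<lambda>x. p + \<mu> *\<^sub>R (x - p)"
    obtain A b where Ab: "polytope_halfspaces A b p" "K \<subseteq> polytope_halfspaces.poly A b"
       "polytope_halfspaces.poly A b \<subseteq> ?h ` K"
      by (rule convex_body_polytope_approximation[OF dim K(1,2) p \<mu>])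
    let ?Q = "polytope_halfspaces.poly A b"
    note cQ = polytope_halfspaces.compact_poly[OF Ab(1)]
    have sum0: "(\<Sum>a\<in>A. polytope_halfspaces.area A b a) \<ge> 0"
      by (intro sum_nonneg polytope_halfspaces.area_nonneg[OF Ab(1)])
    have "surface K \<le> surface ?Q"
      using Ab K cQ dim by (intro surface_mono) (auto simp: compact_imp_closed compact_imp_bounded)
    then have "enn2real (surface K) \<le> (\<Sum>a\<in>A. polytope_halfspaces.area A b a)"
      using sum0 unfolding polytope_halfspaces.surface_poly[OF Ab(1)] by (simp add: enn2real_leI)
    moreover have "vol K \<le> vol ?Q"
      using Ab(2) K(1) cQ by (intro measure_mono_fmeasurable) (auto intro: lmeasurable_compact fmeasurableD)
    ultimately have "vol K + e * enn2real (surface K) \<le> vol ?Q + e * (\<Sum>a\<in>A. polytope_halfspaces.area A b a)"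
      using e by (intro add_mono mult_left_mono) auto
    also have "\<dots> \<le> vol {x. infdist x ?Q \<le> e}" by (rule polytope_halfspaces.outer_parallel_poly[OF Ab(1) e])
    also have "\<dots> \<le> vol (?h ` {x. infdist x K \<le> e})"
    proof (rule measure_mono_fmeasurable)
      have cK: "compact {x. infdist x K \<le> e}" using compact_infdist_le[OF _ K(1) e] pK by auto
      show "?h ` {x. infdist x K \<le> e} \<in> lmeasurable"
        by (intro lmeasurable_compact compact_continuous_image continuous_intros cK)
      have "compact {x. infdist x ?Q \<le> e}" using compact_infdist_le[OF _ cQ e] pK Ab(2) by auto
      then show "{x. infdist x ?Q \<le> e} \<in> sets lebesgue" by (auto intro: lmeasurable_compact fmeasurableD)
      show "{x. infdist x ?Q \<le> e} \<subseteq> ?h ` {x. infdist x K \<le> e}"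
      proof
        fix x assume x: "x \<in> {x. infdist x ?Q \<le> e}"
        have Qne: "?Q \<noteq> {}" using pK Ab(2) by auto
        obtain y where y: "y \<in> ?Q" "infdist x ?Q = dist x y"
          using infdist_attains_inf[OF compact_imp_closed[OF cQ] Qne] by metis
        obtain k where k: "k \<in> K" "y = ?h k" using y(1) Ab(3) by auto
        \<comment> \<open>The contraction towards \<open>p\<close> sends the nearest point of the
          polytope into \<open>K\<close> and shortens distances, so \<open>w\<close> stays within
          \<open>e\<close> of \<open>K\<close>.\<close>
        define w where "w = p + (1/\<mu>) *\<^sub>R (x - p)"
        have "w - k = (1/\<mu>) *\<^sub>R (x - y)" using \<mu> unfolding k(2) w_def by (simp add: algebra_simps)
        then have "dist w k = dist x y / \<mu>" using \<mu> by (simp add: dist_norm)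
        also have "\<dots> \<le> dist x y"
          using \<mu> mult_right_mono[of 1 \<mu> "dist x y"] by (simp add: pos_divide_le_eq mult.commute)
        also have "\<dots> \<le> e" using x y by simp
        finally have "infdist w K \<le> e" using infdist_le[OF k(1), of w] by simp
        moreover have "x = ?h w" using \<mu> by (simp add: w_def)
        ultimately show "x \<in> ?h ` {x. infdist x K \<le> e}" by blast
      qed
    qed
    also have "\<dots> = \<mu> ^ CARD('n) * vol {x. infdist x K \<le> e}" using \<mu> by (subst vol_dilation) auto
    finally show ?thesis by simp
  qed
  from limit_dilation_le[OF this] show ?thesis by simp
qed

text \<open>Here the surface must be bounded from above, so the polytope has to lie inside
  \<open>K\<close>. It is obtained by approximating the contracted body \<open>?K\<close>, whose
  dilation is \<open>K\<close> again.\<close>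

lemma inner_parallel_body:
  assumes e: "e > 0"
  shows "vol K - e * enn2real (surface K) \<le> vol {x \<in> K. e \<le> infdist x (frontier K)}"
proof -
  obtain p where p: "p \<in> interior K" using K(3) by auto
  let ?I = "{x \<in> K. e \<le> infdist x (frontier K)}"
  have "?I = K \<inter> {x. e \<le> infdist x (frontier K)}" by auto
  then have lI: "?I \<in> lmeasurable"
    using K(1) by (auto intro!: lmeasurable_compact compact_Int_closed closed_Collect_le continuous_intros)
  have "vol K \<le> \<mu> ^ CARD('n) * (e * enn2real (surface K) + vol ?I) + 0" if \<mu>: "\<mu> > 1" for \<mu>
  proof -
    let ?h = "\<lambda>x. p + \<mu> *\<^sub>R (x - p)" and ?g = "\<lambda>x. p + (1/\<mu>) *\<^sub>R (x - p)"
    let ?K = "?g ` K"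
    have cK: "compact ?K" by (intro compact_continuous_image continuous_intros K(1))
    have geq: "?g = (\<lambda>x. (p - (1/\<mu>) *\<^sub>R p) + (1/\<mu>) *\<^sub>R x)" by (auto simp: algebra_simps)
    have vK: "convex ?K" unfolding geq
      using convex_affinity[OF K(2), of "p - (1/\<mu>) *\<^sub>R p" "1/\<mu>"] by (simp add: image_image)
    have pK: "p \<in> interior ?K"
    proof -
      obtain r where r: "r > 0" "ball p r \<subseteq> K" using p by (meson mem_interior)
      have "ball p (r/\<mu>) \<subseteq> ?K"
      proof
        fix x assume "x \<in> ball p (r/\<mu>)"
        moreover have "dist p (?h x) = \<mu> * dist p x" using \<mu> by (simp add: dist_norm norm_minus_commute)
        ultimately have "?h x \<in> ball p r" using \<mu> by (simp add: field_simps)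
        moreover have "x = ?g (?h x)" using \<mu> by simp
        ultimately show "x \<in> ?K" using r by blast
      qed
      moreover have "p \<in> ball p (r/\<mu>)" using r \<mu> by simp
      ultimately show ?thesis by (meson interior_maximal open_ball subsetD)
    qed
    obtain A b where Ab: "polytope_halfspaces A b p" "?K \<subseteq> polytope_halfspaces.poly A b"
       "polytope_halfspaces.poly A b \<subseteq> ?h ` ?K"
      by (rule convex_body_polytope_approximation[OF dim cK vK pK \<mu>])
    let ?Q = "polytope_halfspaces.poly A b"
    have "?h ` ?K = K" using \<mu> by (simp add: image_image)
    then have QK: "?Q \<subseteq> K" using Ab(3) by simp
    note cQ = polytope_halfspaces.compact_poly[OF Ab(1)]
    have pQ: "p \<in> interior ?Q" using pK Ab(2) interior_mono by blast
    have sum0: "(\<Sum>a\<in>A. polytope_halfspaces.area A b a) \<ge> 0"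
      by (intro sum_nonneg polytope_halfspaces.area_nonneg[OF Ab(1)])
    have "surface ?Q \<le> surface K"
      using QK K(1) cQ pQ dim by (intro surface_mono polytope_halfspaces.convex_poly[OF Ab(1)])
         (auto simp: compact_imp_closed compact_imp_bounded)
    then have S: "(\<Sum>a\<in>A. polytope_halfspaces.area A b a) \<le> enn2real (surface K)"
      using enn2real_mono[OF _ surface_finite] sum0 unfolding polytope_halfspaces.surface_poly[OF Ab(1)] by fastforce
    have "vol K = \<mu> ^ CARD('n) * vol ?K"
      using vol_dilation[of \<mu> p ?K] \<mu> \<open>?h ` ?K = K\<close> by simp
    also have "\<dots> \<le> \<mu> ^ CARD('n) * (e * enn2real (surface K) + vol ?I)"
    proof (rule mult_left_mono)
      have "vol ?K \<le> vol ?Q"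
        using Ab(2) cK cQ by (intro measure_mono_fmeasurable) (auto intro: lmeasurable_compact fmeasurableD)
      also have "\<dots> \<le> e * (\<Sum>a\<in>A. polytope_halfspaces.area A b a) + vol {x \<in> ?Q. e \<le> infdist x (frontier ?Q)}"
        using polytope_halfspaces.inner_parallel_poly[OF Ab(1), of e] e by simp
      also have "\<dots> \<le> e * enn2real (surface K) + vol ?I"
      proof (intro add_mono mult_left_mono S measure_mono_fmeasurable)
        show "{x \<in> ?Q. e \<le> infdist x (frontier ?Q)} \<subseteq> ?I"
        proof
          fix x assume x: "x \<in> {x \<in> ?Q. e \<le> infdist x (frontier ?Q)}"
          then have "ball x e \<subseteq> ?Q" by (intro ball_subset_of_infdist_frontier) auto
          then have "e \<le> infdist x (frontier K)"
            using QK frontier_body_nonempty by (intro infdist_frontier_ge) auto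
          then show "x \<in> ?I" using x QK by auto
        qed
        have "{x \<in> ?Q. e \<le> infdist x (frontier ?Q)} = ?Q \<inter> {x. e \<le> infdist x (frontier ?Q)}" by auto
        then show "{x \<in> ?Q. e \<le> infdist x (frontier ?Q)} \<in> sets lebesgue"
          using cQ by (auto intro!: fmeasurableD lmeasurable_compact compact_Int_closed closed_Collect_le continuous_intros)
      qed (use e lI in auto)
      finally show "vol ?K \<le> e * enn2real (surface K) + vol ?I" .
    qed (use \<mu> in auto)
    finally show ?thesis by simp
  qed
  from limit_dilation_le[OF this] show ?thesis by simp
qed

end

section \<open>Inner parallel sets of a convex body\<close>

text \<open>After subtracting the chord, a negative minimum would be attained at a leftmost point
  \<open>p\<close> inside the interval. At equal distance to its left the value is strictly larger
  and to its right not smaller, against midpoint concavity.\<close>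

lemma midpoint_concave_imp_concave:
  fixes f :: "real \<Rightarrow> real"
  assumes cont: "continuous_on {a..b} f"
    and mid: "\<And>x y. x \<in> {a..b} \<Longrightarrow> y \<in> {a..b} \<Longrightarrow> f x + f y \<le> 2 * f ((x + y) / 2)"
    and t: "0 \<le> t" "t \<le> 1" and ab: "a < b"
  shows "(1 - t) * f a + t * f b \<le> f ((1 - t) * a + t * b)"
proof -
  define k where "k = (f b - f a) / (b - a)"
  have k: "(b - a) * k = f b - f a" using ab by (simp add: k_def)
  define g where "g s = f s - (f a + (s - a) * k)" for s
  have gmid: "g x + g y \<le> 2 * g ((x + y) / 2)" if "x \<in> {a..b}" "y \<in> {a..b}" for x y
    using mid[OF that] by (simp add: g_def algebra_simps add_divide_distrib)
  have gc: "continuous_on {a..b} g" unfolding g_def[abs_def] by (intro continuous_intros cont)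
  have g0: "g a = 0" "g b = 0" using k by (auto simp: g_def)
  have "g s \<ge> 0" if s: "s \<in> {a..b}" for s
  proof (rule ccontr)
    assume neg: "\<not> g s \<ge> 0"
    obtain m where m: "m \<in> {a..b}" "\<And>x. x \<in> {a..b} \<Longrightarrow> g m \<le> g x"
      using continuous_attains_inf[OF compact_Icc _ gc] s by fastforce
    have gm: "g m < 0" using m(2)[OF s] neg by simp
    define S where "S = {x \<in> {a..b}. g x = g m}"
    have S: "S \<noteq> {}" "bdd_below S" "closed S"
      using m(1) continuous_closed_preimage_constant[OF gc closed_atLeastAtMost]
      by (auto simp: S_def intro: bdd_belowI[of _ a])
    define p where "p = Inf S"
    have pS: "p \<in> S" unfolding p_def by (rule closed_contains_Inf[OF S])
    then have p: "p \<in> {a..b}" "g p = g m" by (auto simp: S_def)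
    have "p \<noteq> a" "p \<noteq> b" using p gm g0 by auto
    then have pab: "a < p" "p < b" using p by auto
    define e where "e = min (p - a) (b - p)"
    have e: "e > 0" "p - e \<in> {a..b}" "p + e \<in> {a..b}" using pab by (auto simp: e_def)
    have "p - e \<notin> S" using e(1) cInf_lower[OF _ S(2), of "p - e"] by (auto simp: p_def)
    then have "g (p - e) > g m" using e m(2)[OF e(2)] by (auto simp: S_def)
    moreover have "g (p + e) \<ge> g m" by (rule m(2)[OF e(3)])
    moreover have "g (p - e) + g (p + e) \<le> 2 * g p" using gmid[OF e(2,3)] by simp
    ultimately show False using p(2) by simp
  qed
  moreover have "(1 - t) * a + t * b \<in> {a..b}"
  proof -
    have "a \<le> a + t * (b - a)" "a + t * (b - a) \<le> a + 1 * (b - a)" proof -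
      have "t * (b - a) \<le> 1 * (b - a)" using t ab by (intro mult_right_mono) auto
      then show "a + t * (b - a) \<le> a + 1 * (b - a)" by simp
      show "a \<le> a + t * (b - a)" using t ab by simp
    qed
    then show ?thesis by (simp add: algebra_simps)
  qed
  ultimately have "g ((1 - t) * a + t * b) \<ge> 0" by blast
  moreover have "((1 - t) * a + t * b - a) * k = t * (f b - f a)"
  proof -
    have "(1 - t) * a + t * b - a = t * (b - a)" by (simp add: algebra_simps)
    then show ?thesis using k by (simp add: mult.assoc)
  qed
  ultimately show ?thesis by (simp add: g_def algebra_simps)
qed

locale convex_domain =
  fixes \<Omega> :: "(real ^ 'n::finite) set"
  assumes dim: "CARD('n) \<ge> 2"
    and \<Omega>: "\<Omega> \<noteq> {}" "open \<Omega>" "bounded \<Omega>" "convex \<Omega>"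
begin

abbreviation d where "d x \<equiv> infdist x (frontier \<Omega>)"
abbreviation R where "R \<equiv> inradius \<Omega>"
abbreviation V where "V r \<equiv> vol (inner_set \<Omega> r)"
abbreviation P where "P r \<equiv> perimeter (inner_set \<Omega> r)"

text \<open>For \<open>0 < r < R\<close> the closure of \<open>inner_set \<Omega> r\<close>; the
  results on convex bodies apply to compact sets.\<close>

definition K :: "real \<Rightarrow> (real ^ 'n) set" where "K r = {x \<in> \<Omega>. r \<le> d x}"

lemma frontier_ne: "frontier \<Omega> \<noteq> {}"
  using \<Omega> by (metis frontier_eq_empty not_bounded_UNIV)

lemma d_nonneg: "d x \<ge> 0" by (rule infdist_nonneg)

lemma frontier_disjoint: "frontier \<Omega> \<inter> \<Omega> = {}"
  using \<Omega>(2) by (simp add: frontier_disjoint_eq)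

lemma d_pos: "x \<in> \<Omega> \<Longrightarrow> d x > 0"
proof -
  assume "x \<in> \<Omega>"
  then have "x \<notin> frontier \<Omega>" using frontier_disjoint by blast
  then show "d x > 0" using in_closed_iff_infdist_zero[OF frontier_closed frontier_ne, of x] d_nonneg[of x] by auto
qed

lemma d_lipschitz: "\<bar>d x - d y\<bar> \<le> dist x y"
  using infdist_triangle_abs by (metis)

lemma continuous_d: "continuous_on S d"
  by (intro continuous_intros)

lemma d_frontier: "x \<in> frontier \<Omega> \<Longrightarrow> d x = 0"
  by simp

lemma nearest_frontier: obtains y where "y \<in> frontier \<Omega>" "d x = dist x y"
  using infdist_attains_inf[OF frontier_closed frontier_ne, of x] by metis

lemma ball_d: "x \<in> \<Omega> \<Longrightarrow> ball x (d x) \<subseteq> \<Omega>"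
  by (rule ball_subset_of_infdist_frontier) auto

text \<open>By convexity \<Omega> contains the convex combination of the inscribed balls around
  \<open>x\<close> and \<open>y\<close>, which is the ball of the interpolated radius. In the proof
  a displacement \<open>e\<close> is shared between the two balls in proportion to their
  radii.\<close>

lemma d_concave:
  assumes "x \<in> \<Omega>" "y \<in> \<Omega>" "0 \<le> t" "t \<le> 1"
  shows "(1 - t) * d x + t * d y \<le> d ((1 - t) *\<^sub>R x + t *\<^sub>R y)"
proof (rule infdist_frontier_ge[OF _ frontier_ne])
  let ?a = "d x" and ?b = "d y" and ?z = "(1 - t) *\<^sub>R x + t *\<^sub>R y"
  let ?r = "(1 - t) * ?a + t * ?b"
  show "ball ?z ?r \<subseteq> \<Omega>"
  proof
    fix w assume w: "w \<in> ball ?z ?r"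
    define e where "e = w - ?z"
    have e: "norm e < ?r" using w by (simp add: e_def dist_norm norm_minus_commute)
    then have r: "?r > 0" using norm_ge_zero[of e] by linarith
    have "c / ?r * norm e < c" if "c > 0" for c
      using mult_strict_left_mono[OF e, of "c / ?r"] that r by simp
    then have "x + (?a / ?r) *\<^sub>R e \<in> ball x ?a" "y + (?b / ?r) *\<^sub>R e \<in> ball y ?b"
      using r d_pos[OF assms(1)] d_pos[OF assms(2)] by (auto simp: dist_norm)
    then have "x + (?a / ?r) *\<^sub>R e \<in> \<Omega>" "y + (?b / ?r) *\<^sub>R e \<in> \<Omega>" using ball_d assms by blast+
    then have "(1 - t) *\<^sub>R (x + (?a / ?r) *\<^sub>R e) + t *\<^sub>R (y + (?b / ?r) *\<^sub>R e) \<in> \<Omega>"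
      using \<Omega>(4) assms by (intro convexD) auto
    moreover have "(1 - t) *\<^sub>R (x + (?a / \<rho>) *\<^sub>R e) + t *\<^sub>R (y + (?b / \<rho>) *\<^sub>R e) = ?z + (((1 - t) * ?a + t * ?b) / \<rho>) *\<^sub>R e" for \<rho>
      by (simp add: algebra_simps add_divide_distrib diff_divide_distrib)
    moreover have "?z + (?r / ?r) *\<^sub>R e = w"
    proof -
      have "?r / ?r = 1" using r by simp
      then show ?thesis by (simp only: scaleR_one) (simp add: e_def)
    qed
    ultimately show "w \<in> \<Omega>" by metis
  qed
qed

lemma inradius_attained: obtains x0 where "x0 \<in> \<Omega>" "d x0 = R" "\<And>x. x \<in> closure \<Omega> \<Longrightarrow> d x \<le> R" "R > 0"
proof -
  have "compact (closure \<Omega>)" using \<Omega>(3) by simp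
  then obtain x0 where x0: "x0 \<in> closure \<Omega>" "\<And>x. x \<in> closure \<Omega> \<Longrightarrow> d x \<le> d x0"
    using continuous_attains_sup[OF _ _ continuous_d, of "closure \<Omega>"] \<Omega>(1) by auto
  obtain c where c: "c \<in> \<Omega>" using \<Omega>(1) by auto
  then have "d c \<le> d x0" using x0(2) closure_subset by blast
  then have "d x0 > 0" using d_pos[OF c] by linarith
  then have "x0 \<notin> frontier \<Omega>" using d_frontier by force
  then have x0\<Omega>: "x0 \<in> \<Omega>" using x0(1) closure_Un_frontier by blast
  have "R = d x0" unfolding inradius_def
    using x0 x0\<Omega> closure_subset by (intro cSup_eq_maximum) auto
  then show ?thesis using that x0\<Omega> x0 \<open>d x0 > 0\<close> by metis
qed

lemma R_pos: "R > 0" using inradius_attained by metis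

lemma K_subset: "K r \<subseteq> \<Omega>" by (auto simp: K_def)

lemma compact_K: "r > 0 \<Longrightarrow> compact (K r)"
proof -
  assume r: "r > 0"
  have "K r = closure \<Omega> \<inter> {x. r \<le> d x}"
    using closure_subset closure_Un_frontier d_frontier r by (fastforce simp: K_def)
  moreover have "closed {x. r \<le> d x}" by (intro closed_Collect_le continuous_intros)
  ultimately show ?thesis using \<Omega>(3) by (simp add: compact_Int_closed)
qed

lemma convex_K: "convex (K r)"
proof (rule convexI)
  fix x y and u v :: real assume a: "x \<in> K r" "y \<in> K r" "0 \<le> u" "0 \<le> v" "u + v = 1"
  then have u: "u = 1 - v" by simp
  have "r = (1 - v) * r + v * r" by (simp add: algebra_simps)
  also have "\<dots> \<le> (1 - v) * d x + v * d y" using a u by (intro add_mono mult_left_mono) (auto simp: K_def)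
  also have "\<dots> \<le> d ((1 - v) *\<^sub>R x + v *\<^sub>R y)" using a u by (intro d_concave) (auto simp: K_def)
  finally show "u *\<^sub>R x + v *\<^sub>R y \<in> K r"
    using a u convexD[OF \<Omega>(4), of x y u v] by (auto simp: K_def)
qed

lemma open_inner_set: "open (inner_set \<Omega> r)"
proof -
  have "inner_set \<Omega> r = \<Omega> \<inter> {x. r < d x}" by (auto simp: inner_set_def)
  moreover have "open {x. r < d x}" by (intro open_Collect_less continuous_intros)
  ultimately show ?thesis using \<Omega>(2) by auto
qed

lemma convex_inner_set: "convex (inner_set \<Omega> r)"
proof (rule convexI)
  fix x y and u v :: real assume a: "x \<in> inner_set \<Omega> r" "y \<in> inner_set \<Omega> r" "0 \<le> u" "0 \<le> v" "u + v = 1"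
  then have u: "u = 1 - v" by simp
  let ?m = "min (d x) (d y)"
  have "r < ?m" using a by (simp add: inner_set_def)
  also have "?m = (1 - v) * ?m + v * ?m" by (simp add: algebra_simps)
  also have "\<dots> \<le> (1 - v) * d x + v * d y" using a u by (intro add_mono mult_left_mono) auto
  also have "\<dots> \<le> d ((1 - v) *\<^sub>R x + v *\<^sub>R y)" using a u by (intro d_concave) (auto simp: inner_set_def)
  finally show "u *\<^sub>R x + v *\<^sub>R y \<in> inner_set \<Omega> r"
    using a u convexD[OF \<Omega>(4), of x y u v] by (auto simp: inner_set_def)
qed

lemma inner_set_nonempty: "r < R \<Longrightarrow> inner_set \<Omega> r \<noteq> {}"
  using inradius_attained by (metis (mono_tags, lifting) empty_iff inner_set_def mem_Collect_eq)

text \<open>Moving a point of \<open>K r\<close> slightly towards a point of maximal distance makes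
  its distance strictly larger than \<open>r\<close>, by concavity.\<close>

lemma closure_inner_set:
  assumes "0 < r" "r < R"
  shows "closure (inner_set \<Omega> r) = K r"
proof
  have "inner_set \<Omega> r \<subseteq> K r" by (auto simp: inner_set_def K_def)
  then show "closure (inner_set \<Omega> r) \<subseteq> K r" using compact_K[OF assms(1)] by (simp add: closure_minimal compact_imp_closed)
  obtain x0 where x0: "x0 \<in> \<Omega>" "d x0 = R" using inradius_attained by metis
  show "K r \<subseteq> closure (inner_set \<Omega> r)"
  proof
    fix x assume x: "x \<in> K r"
    define s where "s n = inverse (real (Suc n))" for n
    have s: "s \<longlonglongrightarrow> 0" unfolding s_def[abs_def] by (rule LIMSEQ_inverse_real_of_nat)
    have s01: "0 < s n" "s n \<le> 1" for n by (auto simp: s_def inverse_le_1_iff)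
    have "(1 - s n) *\<^sub>R x + s n *\<^sub>R x0 \<in> inner_set \<Omega> r" for n
    proof -
      have "r = (1 - s n) * r + s n * r" by (simp add: algebra_simps)
      also have "\<dots> < (1 - s n) * d x + s n * d x0"
        using x x0 assms s01[of n] by (intro add_le_less_mono mult_left_mono mult_strict_left_mono) (auto simp: K_def)
      also have "\<dots> \<le> d ((1 - s n) *\<^sub>R x + s n *\<^sub>R x0)" using x x0 s01[of n] by (intro d_concave) (auto simp: K_def)
      finally show ?thesis using x x0 s01[of n] convexD[OF \<Omega>(4), of x x0 "1 - s n" "s n"]
        by (auto simp: inner_set_def K_def)
    qed
    moreover have "(\<lambda>n. (1 - s n) *\<^sub>R x + s n *\<^sub>R x0) \<longlonglongrightarrow> (1 - 0) *\<^sub>R x + 0 *\<^sub>R x0"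
      by (intro tendsto_intros s)
    ultimately show "x \<in> closure (inner_set \<Omega> r)"
      unfolding closure_sequential by (intro exI[of _ "\<lambda>n. (1 - s n) *\<^sub>R x + s n *\<^sub>R x0"]) simp
  qed
qed

lemma frontier_K:
  assumes "0 < r" "r < R"
  shows "frontier (K r) = frontier (inner_set \<Omega> r)" "interior (K r) \<noteq> {}"
proof -
  have i: "interior (K r) = inner_set \<Omega> r"
    using convex_interior_closure[OF convex_inner_set[of r]] closure_inner_set[OF assms] open_inner_set[of r]
    by (simp add: interior_open)
  then show "interior (K r) \<noteq> {}" using inner_set_nonempty[OF assms(2)] by simp
  show "frontier (K r) = frontier (inner_set \<Omega> r)"
    using compact_K[OF assms(1)] closure_inner_set[OF assms] i open_inner_set[of r]
    by (simp add: frontier_def closure_closed compact_imp_closed interior_open)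
qed

lemma inner_set_lmeasurable: "inner_set \<Omega> r \<in> lmeasurable"
  using open_inner_set \<Omega>(3) by (intro lmeasurable_open) (auto simp: inner_set_def intro: bounded_subset)

lemma vol_K:
  assumes "0 < r" "r < R"
  shows "vol (K r) = V r"
proof -
  have "K r = inner_set \<Omega> r \<union> frontier (inner_set \<Omega> r)"
    using closure_inner_set[OF assms] closure_Un_frontier by metis
  moreover have "frontier (inner_set \<Omega> r) \<in> null_sets lebesgue"
    using negligible_convex_frontier[OF convex_inner_set] by (simp add: negligible_iff_null_sets)
  ultimately show ?thesis using inner_set_lmeasurable by (simp add: measure_Un_null_set fmeasurableD)
qed

lemma P_eq: "0 < r \<Longrightarrow> r < R \<Longrightarrow> P r = enn2real (surface (K r))"
  by (simp add: perimeter_def frontier_K)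

lemma P_nonneg: "P r \<ge> 0" by (simp add: perimeter_def)

lemma V_pos: "r < R \<Longrightarrow> V r > 0"
  using open_inner_set[of r] inner_set_nonempty[of r] inner_set_lmeasurable[of r] open_not_negligible[of "inner_set \<Omega> r"]
    negligible_iff_measure[of "inner_set \<Omega> r"] measure_nonneg[of lebesgue "inner_set \<Omega> r"] by (metis less_eq_real_def)

text \<open>The \<open>e\<close>-neighbourhood of \<open>K (r + e)\<close> lies in
  \<open>K r\<close>, and the part of \<open>K r\<close> at distance at least \<open>e\<close> from
  its frontier lies in \<open>K (r + e)\<close>. The outer estimate is applied to the smaller body
  and the inner one to the larger.\<close>

lemma V_increment_bounds:
  assumes "0 < r" "0 < e" "r + e < R"
  shows "e * P (r + e) \<le> V r - V (r + e)" "V r - V (r + e) \<le> e * P r"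
proof -
  have r: "0 < r" "r < R" and re: "0 < r + e" "r + e < R" using assms by auto
  note body = compact_K[OF r(1)] convex_K[of r] frontier_K(2)[OF r]
  note body' = compact_K[OF re(1)] convex_K[of "r + e"] frontier_K(2)[OF re]
  have ne: "K (r + e) \<noteq> {}" using body'(3) interior_subset by blast
  have "vol (K (r + e)) + e * enn2real (surface (K (r + e))) \<le> vol {x. infdist x (K (r + e)) \<le> e}"
    by (rule outer_parallel_body[OF dim body' assms(2)])
  also have "\<dots> \<le> vol (K r)"
  proof (rule measure_mono_fmeasurable)
    show "{x. infdist x (K (r + e)) \<le> e} \<subseteq> K r"
    proof
      fix x assume x: "x \<in> {x. infdist x (K (r + e)) \<le> e}"
      obtain y where y: "y \<in> K (r + e)" "infdist x (K (r + e)) = dist x y"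
        using infdist_attains_inf[OF compact_imp_closed[OF body'(1)] ne] by metis
      have dxy: "dist x y \<le> e" using x y by simp
      then have "x \<in> ball y (d y)" using y(1) assms by (auto simp: K_def dist_commute)
      then have "x \<in> \<Omega>" using ball_d[of y] y(1) by (auto simp: K_def)
      moreover have "d x \<ge> r" using d_lipschitz[of x y] dxy y(1) by (auto simp: K_def abs_le_iff)
      ultimately show "x \<in> K r" by (simp add: K_def)
    qed
    show "{x. infdist x (K (r + e)) \<le> e} \<in> sets lebesgue"
      using compact_infdist_le[OF ne body'(1) assms(2)] by (auto intro: lmeasurable_compact fmeasurableD)
    show "K r \<in> lmeasurable" using body(1) by (rule lmeasurable_compact)
  qed
  finally show "e * P (r + e) \<le> V r - V (r + e)" using vol_K[OF r] vol_K[OF re] P_eq[OF re] by simp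
  have "vol (K r) - e * enn2real (surface (K r)) \<le> vol {x \<in> K r. e \<le> infdist x (frontier (K r))}"
    by (rule inner_parallel_body[OF dim body assms(2)])
  also have "\<dots> \<le> vol (K (r + e))"
  proof (rule measure_mono_fmeasurable)
    show "{x \<in> K r. e \<le> infdist x (frontier (K r))} \<subseteq> K (r + e)"
    proof
      fix x assume x: "x \<in> {x \<in> K r. e \<le> infdist x (frontier (K r))}"
      then have b: "ball x e \<subseteq> K r" by (intro ball_subset_of_infdist_frontier) auto
      have "ball x (r + e) \<subseteq> \<Omega>"
      proof
        fix w assume w: "w \<in> ball x (r + e)"
        \<comment> \<open>The step from \<open>x\<close> to \<open>w\<close> is divided in the ratio
          of \<open>e\<close> to \<open>r\<close>: the first part stays in \<open>K r\<close>, and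
          the second is shorter than the distance of \<open>y\<close> from the frontier.\<close>
        define y where "y = x + (e / (r + e)) *\<^sub>R (w - x)"
        have wx: "norm (w - x) < r + e" using w by (simp add: dist_norm norm_minus_commute)
        have part: "c / (r + e) * norm (w - x) < c" if "c > 0" for c
          using mult_strict_left_mono[OF wx, of "c / (r + e)"] that assms by simp
        have "dist x y = e / (r + e) * norm (w - x)" using assms by (simp add: y_def dist_norm)
        then have "y \<in> K r" using b part[of e] assms by auto
        moreover have "dist y w < r"
        proof -
          have "w - y = (1 - e / (r + e)) *\<^sub>R (w - x)" by (simp add: y_def algebra_simps)
          also have "1 - e / (r + e) = r / (r + e)" using assms by (simp add: field_simps)
          finally have "dist w y = r / (r + e) * norm (w - x)" using assms by (simp add: dist_norm)
          then show ?thesis using part[of r] assms by (simp add: dist_commute)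
        qed
        ultimately show "w \<in> \<Omega>" using ball_d[of y] by (auto simp: K_def)
      qed
      then have "r + e \<le> d x" using frontier_ne by (rule infdist_frontier_ge)
      then show "x \<in> K (r + e)" using x by (auto simp: K_def)
    qed
    have "{x \<in> K r. e \<le> infdist x (frontier (K r))} = K r \<inter> {x. e \<le> infdist x (frontier (K r))}" by auto
    then show "{x \<in> K r. e \<le> infdist x (frontier (K r))} \<in> sets lebesgue"
      using body(1) by (auto intro!: fmeasurableD lmeasurable_compact compact_Int_closed closed_Collect_le continuous_intros)
    show "K (r + e) \<in> lmeasurable" using body'(1) by (rule lmeasurable_compact)
  qed
  finally show "V r - V (r + e) \<le> e * P r" using vol_K[OF r] vol_K[OF re] P_eq[OF r] by simp
qed

section \<open>Log-concavity of the volume of inner parallel sets\<close>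

lemma V_mono: "s \<le> r \<Longrightarrow> V r \<le> V s"
  using inner_set_lmeasurable by (intro measure_mono_fmeasurable) (auto simp: inner_set_def fmeasurableD)

text \<open>Concavity of the distance places midpoints of the inner sets for \<open>x\<close> and
  \<open>y\<close> in the inner set for \<open>(x + y) / 2\<close>, so Brunn-Minkowski
  applies.\<close>

lemma V_midpoint: "V x * V y \<le> (V ((x + y) / 2))^2"
proof -
  have e: "emeasure lborel (inner_set \<Omega> r) = ennreal (V r)" for r
  proof -
    have "emeasure lebesgue (inner_set \<Omega> r) = ennreal (V r)" by (rule emeasure_eq_measure2[OF inner_set_lmeasurable])
    moreover have "emeasure lebesgue (inner_set \<Omega> r) = emeasure lborel (inner_set \<Omega> r)" using open_inner_set[of r] by simp
    ultimately show ?thesis by simp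
  qed
  have "emeasure lborel (inner_set \<Omega> x) * emeasure lborel (inner_set \<Omega> y) \<le> (emeasure lborel (inner_set \<Omega> ((x + y)/2)))^2"
  proof (rule brunn_minkowski_midpoint)
    fix p q assume p: "p \<in> inner_set \<Omega> x" and q: "q \<in> inner_set \<Omega> y"
    have "(x + y)/2 < (1 - 1/2) * d p + (1/2) * d q" using p q by (auto simp: inner_set_def)
    also have "\<dots> \<le> d ((1 - 1/2) *\<^sub>R p + (1/2) *\<^sub>R q)" using p q by (intro d_concave) (auto simp: inner_set_def)
    finally show "(1/2) *\<^sub>R (p + q) \<in> inner_set \<Omega> ((x + y)/2)"
      using p q convexD[OF \<Omega>(4), of p q "1/2" "1/2"] by (auto simp: inner_set_def algebra_simps)
  qed (use open_inner_set in auto)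
  then have "ennreal (V x * V y) \<le> ennreal ((V ((x + y)/2))^2)"
    unfolding e by (simp add: ennreal_mult ennreal_power)
  then show ?thesis by (simp add: ennreal_le_iff)
qed

lemma P_antimono:
  assumes "0 < s" "s \<le> r" "r < R"
  shows "P r \<le> P s"
proof -
  have s: "0 < s" "s < R" and r: "0 < r" "r < R" using assms by auto
  have "K r \<subseteq> K s" using assms(2) by (auto simp: K_def)
  then have "surface (K r) \<le> surface (K s)"
    using compact_K[OF r(1)] compact_K[OF s(1)] frontier_K(2)[OF r] dim
    by (intro surface_mono convex_K) (auto simp: compact_imp_closed compact_imp_bounded)
  then show ?thesis unfolding P_eq[OF s] P_eq[OF r]
    using surface_finite[OF dim compact_K[OF s(1)] convex_K frontier_K(2)[OF s]] by (intro enn2real_mono)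
qed

lemma V_lipschitz:
  assumes "0 < c" "c \<le> x" "c \<le> y" "x < R" "y < R"
  shows "\<bar>V x - V y\<bar> \<le> P c * \<bar>x - y\<bar>"
proof -
  have *: "\<bar>V x - V y\<bar> \<le> P c * \<bar>x - y\<bar>" if "c \<le> x" "x < y" "y < R" for x y
  proof -
    have "V x - V y \<le> (y - x) * P x" using V_increment_bounds(2)[of x "y - x"] that assms(1) by simp
    also have "\<dots> \<le> (y - x) * P c" using P_antimono[of c x] that assms(1) by (intro mult_left_mono) auto
    finally show ?thesis using V_mono[of x y] that by (simp add: mult.commute)
  qed
  show ?thesis using *[of x y] *[of y x] assms by (cases x y rule: linorder_cases) (auto simp: abs_minus_commute)
qed

lemma continuous_V:
  assumes "0 < a" "b < R"
  shows "continuous_on {a..b} V"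
  by (rule lipschitz_on_continuous_on[of "P a"], rule lipschitz_onI)
     (use V_lipschitz[of a] assms P_nonneg in \<open>auto simp: dist_real_def\<close>)

lemma ln_V_concave:
  assumes "0 < a" "a < b" "b < R" "0 \<le> t" "t \<le> 1"
  shows "(1 - t) * ln (V a) + t * ln (V b) \<le> ln (V ((1 - t) * a + t * b))"
proof (rule midpoint_concave_imp_concave[OF _ _ assms(4,5,2)])
  show "continuous_on {a..b} (\<lambda>r. ln (V r))"
  proof (rule continuous_on_ln[OF continuous_V])
    show "\<forall>x\<in>{a..b}. V x \<noteq> 0"
    proof
      fix x assume "x \<in> {a..b}"
      then have "V x > 0" using assms(3) by (intro V_pos) auto
      then show "V x \<noteq> 0" by simp
    qed
  qed (use assms in auto)
  fix x y assume xy: "x \<in> {a..b}" "y \<in> {a..b}"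
  then have p: "V x > 0" "V y > 0" "V ((x + y)/2) > 0" using assms V_pos by auto
  have "ln (V x) + ln (V y) = ln (V x * V y)" using p by (simp add: ln_mult)
  also have "\<dots> \<le> ln ((V ((x + y)/2))^2)" using p V_midpoint[of x y] by (subst ln_le_cancel_iff) auto
  also have "\<dots> = 2 * ln (V ((x + y)/2))" using p by (simp add: ln_realpow)
  finally show "ln (V x) + ln (V y) \<le> 2 * ln (V ((x + y)/2))" .
qed

lemma ln_V_slopes:
  assumes "0 < x" "x < r" "r < y" "y < R"
  shows "(ln (V y) - ln (V r)) * (r - x) \<le> (ln (V r) - ln (V x)) * (y - r)"
proof -
  define t where "t = (r - x) / (y - x)"
  have t: "0 \<le> t" "t \<le> 1" using assms by (auto simp: t_def)
  have eq: "(1 - t) * x + t * y = r"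
  proof -
    have "(1 - t) * x + t * y = x + t * (y - x)" by (simp add: algebra_simps)
    then show ?thesis using assms by (simp add: t_def)
  qed
  have "(1 - t) * ln (V x) + t * ln (V y) \<le> ln (V r)"
    using ln_V_concave[of x y t] assms t unfolding eq by simp
  then have le: "((1 - t) * ln (V x) + t * ln (V y)) * (y - x) \<le> ln (V r) * (y - x)"
    using assms by (intro mult_right_mono) auto
  have e1: "t * (y - x) = r - x" using assms by (simp add: t_def)
  then have e2: "(1 - t) * (y - x) = y - r" by (simp add: algebra_simps)
  have "((1 - t) * ln (V x) + t * ln (V y)) * (y - x) = ((1 - t) * (y - x)) * ln (V x) + (t * (y - x)) * ln (V y)"
    by (simp add: algebra_simps)
  then have "(y - r) * ln (V x) + (r - x) * ln (V y) \<le> ln (V r) * (y - x)"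
    using le unfolding e1 e2 by simp
  then show ?thesis by (simp add: algebra_simps)
qed

text \<open>
  The increment bounds place \<open>- P r\<close> between the left and right derivatives of \<open>V\<close> in the order
  opposite to that forced by concavity of \<open>ln V\<close>, so that \<open>- P r / V r\<close> is a supergradient.
\<close>

lemma ln_V_supergradient:
  assumes r: "0 < r" "r < R" and x: "0 < x" "x < R"
  shows "ln (V x) \<le> ln (V r) - P r / V r * (x - r)"
proof (cases x r rule: linorder_cases)
  case greater
  \<comment> \<open>The factor \<open>V y\<close> clears the denominator that arises when the
    logarithm is estimated; by continuity it tends to \<open>V r\<close>.\<close>
  have "((\<lambda>y. (ln (V x) - ln (V r)) * V y) \<longlongrightarrow> (ln (V x) - ln (V r)) * V r) (at_left r)"
  proof -
    have "continuous_on {r/2..r} V" using r by (intro continuous_V) auto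
    then have "(V \<longlongrightarrow> V r) (at r within {r/2..r})" using r by (auto simp: continuous_on_def)
    then have "(V \<longlongrightarrow> V r) (at_left r)" using r by (simp add: at_within_Icc_at_left)
    then show ?thesis by (intro tendsto_intros)
  qed
  moreover have "\<forall>\<^sub>F y in at_left r. (ln (V x) - ln (V r)) * V y \<le> - P r * (x - r)"
  proof (rule eventually_at_leftI[of 0])
    fix y assume y: "y \<in> {0<..<r}"
    have Vy: "V y > 0" "V r > 0" using V_pos y r by auto
    have "(ln (V x) - ln (V r)) * (r - y) \<le> (ln (V r) - ln (V y)) * (x - r)"
      using ln_V_slopes[of y r x] y greater x by simp
    \<comment> \<open>The inequality \<open>ln t \<le> t - 1\<close> at \<open>t = V r / V y\<close>
      replaces a difference of logarithms by a difference of volumes, to which the increment bounds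
      apply.\<close>
    also have "\<dots> \<le> ((V r - V y) / V y) * (x - r)"
      using ln_le_minus_one[of "V r / V y"] Vy greater by (intro mult_right_mono) (auto simp: ln_div diff_divide_distrib)
    also have "\<dots> \<le> (- ((r - y) * P r) / V y) * (x - r)"
      using V_increment_bounds(1)[of y "r - y"] y r Vy greater by (intro mult_right_mono divide_right_mono) auto
    finally have "(ln (V x) - ln (V r)) * (r - y) * V y \<le> (- ((r - y) * P r) / V y) * (x - r) * V y"
      using Vy by (intro mult_right_mono) auto
    moreover have "(ln (V x) - ln (V r)) * (r - y) * V y = (r - y) * ((ln (V x) - ln (V r)) * V y)"
      by (simp only: mult_ac)
    moreover have "(- ((r - y) * P r) / V y) * (x - r) * V y = (r - y) * (- P r * (x - r))"
      using Vy by simp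
    ultimately have "(r - y) * ((ln (V x) - ln (V r)) * V y) \<le> (r - y) * (- P r * (x - r))" by linarith
    then show "(ln (V x) - ln (V r)) * V y \<le> - P r * (x - r)" by (rule mult_left_le_imp_le) (use y in simp)
  qed (use r in auto)
  ultimately have "(ln (V x) - ln (V r)) * V r \<le> - P r * (x - r)"
    using tendsto_upperbound trivial_limit_at_left_real by blast
  then show ?thesis using V_pos[OF r(2)] by (simp add: field_simps)
next
  case less
  have "((\<lambda>y. (ln (V r) - ln (V x)) * V y) \<longlongrightarrow> (ln (V r) - ln (V x)) * V r) (at_right r)"
  proof -
    have "continuous_on {r..(r + R)/2} V" using r by (intro continuous_V) auto
    then have "(V \<longlongrightarrow> V r) (at r within {r..(r+R)/2})" using r by (auto simp: continuous_on_def)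
    then have "(V \<longlongrightarrow> V r) (at_right r)" using r by (simp add: at_within_Icc_at_right)
    then show ?thesis by (intro tendsto_intros)
  qed
  moreover have "\<forall>\<^sub>F y in at_right r. - P r * (r - x) \<le> (ln (V r) - ln (V x)) * V y"
  proof (rule eventually_at_rightI[of _ R])
    fix y assume y: "y \<in> {r<..<R}"
    have Vy: "V y > 0" "V r > 0" using V_pos y r by auto
    have "(- ((y - r) * P r) / V y) * (r - x) \<le> ((V y - V r) / V y) * (r - x)"
      using V_increment_bounds(2)[of r "y - r"] y r Vy less by (intro mult_right_mono divide_right_mono) auto
    also have "\<dots> \<le> (ln (V y) - ln (V r)) * (r - x)"
      using ln_le_minus_one[of "V r / V y"] Vy less by (intro mult_right_mono) (auto simp: ln_div diff_divide_distrib)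
    also have "\<dots> \<le> (ln (V r) - ln (V x)) * (y - r)"
      using ln_V_slopes[of x r y] y less x by simp
    finally have "(- ((y - r) * P r) / V y) * (r - x) * V y \<le> (ln (V r) - ln (V x)) * (y - r) * V y"
      using Vy by (intro mult_right_mono) auto
    moreover have "(- ((y - r) * P r) / V y) * (r - x) * V y = (y - r) * (- P r * (r - x))"
      using Vy by simp
    moreover have "(ln (V r) - ln (V x)) * (y - r) * V y = (y - r) * ((ln (V r) - ln (V x)) * V y)"
      by (simp only: mult_ac)
    ultimately have "(y - r) * (- P r * (r - x)) \<le> (y - r) * ((ln (V r) - ln (V x)) * V y)" by linarith
    then show "- P r * (r - x) \<le> (ln (V r) - ln (V x)) * V y" by (rule mult_left_le_imp_le) (use y in simp)
  qed (use r in auto)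
  ultimately have "- P r * (r - x) \<le> (ln (V r) - ln (V x)) * V r"
    using tendsto_lowerbound trivial_limit_at_right_real by blast
  then show ?thesis using V_pos[OF r(2)] by (simp add: field_simps)
qed simp

end

section \<open>The critical radius and the optimal radius\<close>

context convex_domain
begin

text \<open>Moving from a point of \<open>K R\<close> towards its nearest frontier point lowers the
  distance below \<open>R\<close>. So this convex set has empty interior and is therefore
  null.\<close>

lemma negligible_K_inradius: "negligible (K R)"
proof -
  have "interior (K R) = {}"
  proof (rule ccontr)
    assume "interior (K R) \<noteq> {}"
    then obtain p e where p: "e > 0" "cball p e \<subseteq> K R" by (meson all_not_in_conv mem_interior_cball)
    obtain z where z: "z \<in> frontier \<Omega>" "d p = dist p z" using nearest_frontier by metis
    have "p \<in> K R" using p by auto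
    then have dp: "dist p z \<ge> R" using z by (simp add: K_def)
    have dz: "dist p z > 0" using dp R_pos by linarith
    define s where "s = min 1 (e / dist p z)"
    have s: "0 < s" "s \<le> 1" using p(1) dz by (auto simp: s_def)
    define y where "y = p + s *\<^sub>R (z - p)"
    have "dist p y = s * dist p z" using s by (simp add: y_def dist_norm norm_minus_commute)
    also have "\<dots> \<le> e" using dz by (simp add: s_def min_def field_simps)
    finally have "y \<in> K R" using p(2) by auto
    then have "R \<le> d y" by (simp add: K_def)
    also have "\<dots> \<le> dist y z" using z(1) by (rule infdist_le)
    also have "\<dots> = (1 - s) * dist p z"
    proof -
      have "y - z = (1 - s) *\<^sub>R (p - z)" by (simp add: y_def algebra_simps)
      then show ?thesis using s by (simp add: dist_norm)
    qed
    also have "\<dots> < dist p z" using s dz by simp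
    also have "\<dots> \<le> R"
    proof -
      have "p \<in> closure \<Omega>" using \<open>p \<in> K R\<close> closure_subset by (auto simp: K_def)
      then show ?thesis using inradius_attained z(2) by metis
    qed
    finally show False by simp
  qed
  then show ?thesis using negligible_convex_interior[OF convex_K] by blast
qed

text \<open>The inner sets for radii increasing to \<open>R\<close> shrink to a subset of the null
  set \<open>K R\<close>.\<close>

lemma V_arbitrarily_small:
  assumes "e > 0"
  obtains r where "0 < r" "r < R" "V r < e"
proof -
  \<comment> \<open>The denominator starts at 2, so that already \<open>r 0\<close> is
    positive.\<close>
  define r where "r n = R - R * inverse (real (Suc (Suc n)))" for n
  have r: "0 < r n" "r n < R" for n
  proof -
    have "inverse (real (Suc (Suc n))) < 1" by (intro inverse_less_1_iff[THEN iffD2]) auto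
    then have "R * inverse (real (Suc (Suc n))) < R * 1" using R_pos by (intro mult_strict_left_mono) auto
    moreover have "R * inverse (real (Suc (Suc n))) > 0" using R_pos by simp
    ultimately show "0 < r n" "r n < R" by (auto simp: r_def)
  qed
  have lim: "r \<longlonglongrightarrow> R"
  proof -
    have "(\<lambda>n. R - R * inverse (real (Suc (Suc n)))) \<longlonglongrightarrow> R - R * 0"
      by (intro tendsto_intros LIMSEQ_Suc[OF LIMSEQ_inverse_real_of_nat])
    then show ?thesis by (simp add: r_def[abs_def])
  qed
  have dec: "decseq (\<lambda>n. inner_set \<Omega> (r n))"
  proof (rule decseq_SucI)
    fix n
    have "r n \<le> r (Suc n)" unfolding r_def using R_pos by (intro diff_left_mono mult_left_mono le_imp_inverse_le) auto
    then show "inner_set \<Omega> (r (Suc n)) \<subseteq> inner_set \<Omega> (r n)" by (auto simp: inner_set_def)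
  qed
  have "(\<lambda>n. V (r n)) \<longlonglongrightarrow> vol (\<Inter>n. inner_set \<Omega> (r n))"
  proof (rule Lim_measure_decseq[OF _ dec])
    show "range (\<lambda>n. inner_set \<Omega> (r n)) \<subseteq> sets lebesgue" using inner_set_lmeasurable by (auto intro: fmeasurableD)
    show "emeasure lebesgue (inner_set \<Omega> (r n)) \<noteq> \<infinity>" for n
      using fmeasurableD2[OF inner_set_lmeasurable[of "r n"]] by (simp only: infinity_ennreal_def not_False_eq_True)
  qed
  moreover have "vol (\<Inter>n. inner_set \<Omega> (r n)) = 0"
  proof -
    have "(\<Inter>n. inner_set \<Omega> (r n)) \<subseteq> K R"
    proof
      fix x assume x: "x \<in> (\<Inter>n. inner_set \<Omega> (r n))"
      then have "r n \<le> d x" for n by (auto simp: inner_set_def intro: less_imp_le)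
      then have "R \<le> d x" by (intro LIMSEQ_le_const2[OF lim]) auto
      then show "x \<in> K R" using x by (auto simp: inner_set_def K_def)
    qed
    then show ?thesis using negligible_K_inradius negligible_subset negligible_imp_measure0 by blast
  qed
  ultimately have "\<forall>\<^sub>F n in sequentially. V (r n) < e" using assms by (intro order_tendstoD) auto
  then obtain n where "V (r n) < e" using eventually_happens'[OF sequentially_bot] by blast
  then show ?thesis using that r by blast
qed

text \<open>Minus the logarithmic derivative of \<open>V\<close>, in view of
  \<open>DERIV_V\<close>.\<close>

definition Q where "Q r = P r / V r"

text \<open>The sum of the supergradient inequalities at \<open>s\<close> and at
  \<open>r\<close>.\<close>

lemma Q_mono:
  assumes "0 < s" "s \<le> r" "r < R"
  shows "Q s \<le> Q r"
proof (cases "s = r")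
  case False
  then have sr: "s < r" using assms by simp
  have "ln (V s) \<le> ln (V r) - Q r * (s - r)" "ln (V r) \<le> ln (V s) - Q s * (r - s)"
    using ln_V_supergradient[of r s] ln_V_supergradient[of s r] assms sr by (auto simp: Q_def)
  then have "Q s * (r - s) \<le> Q r * (r - s)" by (simp add: algebra_simps)
  then show ?thesis using sr by simp
qed simp

lemma P_Q: "r < R \<Longrightarrow> P r = Q r * V r" using V_pos[of r] by (simp add: Q_def)

lemma Q_nonneg: "r < R \<Longrightarrow> Q r \<ge> 0" using V_pos[of r] P_nonneg[of r] by (simp add: Q_def)

text \<open>\<open>P\<close> decreases, and it cannot decrease fast: as \<open>Q\<close> increases,
  the relative loss of \<open>P\<close> is at most that of \<open>V\<close>, which is
  Lipschitz.\<close>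

lemma P_lipschitz:
  assumes "0 < a" "b < R" "x \<in> {a..b}" "y \<in> {a..b}"
  shows "\<bar>P x - P y\<bar> \<le> (P a)\<^sup>2 / V b * \<bar>x - y\<bar>"
proof -
  have *: "\<bar>P x - P y\<bar> \<le> (P a)\<^sup>2 / V b * \<bar>x - y\<bar>" if xy: "a \<le> x" "x < y" "y \<le> b" for x y
  proof -
    have lt: "x < R" "y < R" "0 < x" "0 < y" using xy assms by auto
    have Vp: "V x > 0" "V y > 0" "V b > 0" using V_pos lt assms(2) by auto
    have py: "P y \<le> P x" using P_antimono[of x y] lt xy by simp
    have "P x / V x \<le> P y / V y" using Q_mono[of x y] lt xy by (simp add: Q_def)
    then have "P x \<le> P y * V x / V y" using Vp by (simp add: field_simps)
    then have "P x - P y \<le> P y * ((V x - V y) / V y)" using Vp by (simp add: field_simps)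
    also have "\<dots> \<le> P a * ((P a * (y - x)) / V b)"
    proof (intro mult_mono frac_le)
      show "P y \<le> P a" using P_antimono[of a y] assms(1) xy lt by simp
      show "V x - V y \<le> P a * (y - x)" using V_lipschitz[of a x y] assms(1) xy lt by (simp add: abs_le_iff)
      show "V b \<le> V y" using V_mono xy by simp
      show "0 \<le> (V x - V y) / V y" using V_mono[of x y] xy Vp by simp
    qed (use Vp P_nonneg xy in \<open>auto simp: V_mono\<close>)
    also have "\<dots> = (P a)\<^sup>2 / V b * (y - x)" by (simp add: power2_eq_square)
    finally show ?thesis using py xy by simp
  qed
  show ?thesis using *[of x y] *[of y x] assms by (cases x y rule: linorder_cases) (auto simp: abs_minus_commute)
qed

lemma continuous_P:
  assumes "0 < a" "b < R"
  shows "continuous_on {a..b} P"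
  by (rule lipschitz_on_continuous_on[of "(P a)\<^sup>2 / V b"], rule lipschitz_onI)
     (use P_lipschitz[OF assms] V_pos[OF assms(2)] in \<open>auto simp: dist_real_def\<close>)

text \<open>The increment bounds enclose the difference quotient between \<open>- P r\<close> and
  \<open>- P (r + h)\<close>, and these differ by at most a multiple of the absolute value of
  \<open>h\<close>.\<close>

lemma DERIV_V:
  assumes r: "0 < r" "r < R"
  shows "(V has_real_derivative - P r) (at r)"
proof -
  define a b where "a = r / 2" and "b = (r + R) / 2"
  have ab: "0 < a" "a < r" "r < b" "b < R" using r by (auto simp: a_def b_def)
  define C where "C = (P a)\<^sup>2 / V b"
  have bound: "\<bar>(V (r + h) - V r) / h - (- P r)\<bar> \<le> C * \<bar>h\<bar>" if h: "h \<noteq> 0" "a \<le> r + h" "r + h \<le> b" for h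
  proof -
    have "\<bar>P (r + h) - P r\<bar> \<le> C * \<bar>h\<bar>"
      using P_lipschitz[OF ab(1,4), of "r + h" r] h ab by (simp add: C_def)
    moreover have "\<bar>(V (r + h) - V r) / h - (- P r)\<bar> \<le> \<bar>P (r + h) - P r\<bar>"
    proof (cases "h > 0")
      case True
      have "h * P (r + h) \<le> V r - V (r + h)" "V r - V (r + h) \<le> h * P r"
        using V_increment_bounds[of r h] True h ab r by auto
      then have "- P r \<le> (V (r + h) - V r) / h" "(V (r + h) - V r) / h \<le> - P (r + h)"
        using True by (auto simp: field_simps)
      then show ?thesis by linarith
    next
      case False
      define k where "k = - h"
      have k: "k > 0" "h = - k" using False h by (auto simp: k_def)
      have "k * P r \<le> V (r - k) - V r" "V (r - k) - V r \<le> k * P (r - k)"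
        using V_increment_bounds[of "r - k" k] k h ab r by auto
      then have "- P (r + h) \<le> (V (r + h) - V r) / h" "(V (r + h) - V r) / h \<le> - P r"
        using k by (auto simp: field_simps)
      then show ?thesis by linarith
    qed
    ultimately show ?thesis by linarith
  qed
  have "((\<lambda>h. (V (r + h) - V r) / h - (- P r)) \<longlongrightarrow> 0) (at 0)"
  proof (rule Lim_null_comparison)
    have "\<forall>\<^sub>F h in at 0. \<bar>h\<bar> < min (r - a) (b - r)"
      using ab by (auto simp: eventually_at intro!: exI[of _ "min (r - a) (b - r)"])
    moreover have "\<forall>\<^sub>F h in at (0::real). h \<noteq> 0" by (simp add: eventually_at_filter)
    ultimately show "\<forall>\<^sub>F h in at 0. norm ((V (r + h) - V r) / h - (- P r)) \<le> C * \<bar>h\<bar>"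
    proof eventually_elim
      fix h :: real assume "\<bar>h\<bar> < min (r - a) (b - r)" "h \<noteq> 0"
      then show "norm ((V (r + h) - V r) / h - (- P r)) \<le> C * \<bar>h\<bar>"
        unfolding real_norm_def by (intro bound) auto
    qed
    have "((\<lambda>h. C * \<bar>h\<bar>) \<longlongrightarrow> C * \<bar>0\<bar>) (at (0::real))" by (intro tendsto_intros)
    then show "((\<lambda>h. C * \<bar>h\<bar>) \<longlongrightarrow> 0) (at (0::real))" by simp
  qed
  then show ?thesis unfolding DERIV_def by (rule LIM_zero_cancel)
qed

lemma critical_radius_iff: "critical_radius \<Omega> r \<longleftrightarrow> 0 < r \<and> r < R \<and> r * Q r = 1"
  unfolding critical_radius_def Q_def by (auto simp: field_simps)

lemma rQ_strict_mono:
  assumes "0 < s" "s < r" "r < R" "r * Q r \<noteq> 0"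
  shows "s * Q s < r * Q r"
proof -
  have "Q r > 0" using assms Q_nonneg[of r] by (auto simp: less_le)
  have "s * Q s \<le> s * Q r" using Q_mono[of s r] assms by (intro mult_left_mono) auto
  also have "\<dots> < r * Q r" using assms \<open>Q r > 0\<close> by simp
  finally show ?thesis .
qed

text \<open>\<open>r * Q r\<close> is below 1 near 0, because \<open>Q\<close> is bounded there. It
  reaches 1 before \<open>R\<close>, since otherwise the supergradient would keep
  \<open>ln (V x)\<close> above \<open>ln (V (R/2)) - 1\<close> although \<open>V\<close> tends to
  0. The intermediate value theorem is applied to \<open>r * P r - V r\<close>, and strict
  monotonicity gives uniqueness.\<close>

lemma ex1_critical_radius: "\<exists>!r. critical_radius \<Omega> r"
proof -
  have R2: "0 < R/2" "R/2 < R" using R_pos by auto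
  \<comment> \<open>Chosen so that \<open>a * Q (R/2)\<close> is below 1; the \<open>+ 1\<close>
    covers the case that \<open>Q (R/2)\<close> vanishes.\<close>
  define a where "a = min (R/2) (1 / (2 * (Q (R/2) + 1)))"
  have a: "0 < a" "a \<le> R/2" using R_pos Q_nonneg[OF R2(2)] by (auto simp: a_def)
  have aQ: "a * Q a < 1"
  proof -
    have "a * Q a \<le> a * Q (R/2)" using Q_mono[of a "R/2"] a R2 by (intro mult_left_mono) auto
    also have "\<dots> \<le> 1 / (2 * (Q (R/2) + 1)) * Q (R/2)" using Q_nonneg[OF R2(2)] by (intro mult_right_mono) (auto simp: a_def)
    also have "\<dots> < 1" using Q_nonneg[OF R2(2)] by (simp add: field_simps)
    finally show ?thesis .
  qed
  have "\<exists>b. 0 < b \<and> b < R \<and> b * Q b \<ge> 1"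
  proof (rule ccontr)
    assume "\<not> ?thesis"
    then have small: "x * Q x < 1" if "0 < x" "x < R" for x using that by force
    have low: "ln (V (R/2)) - 1 \<le> ln (V x)" if x: "R/2 < x" "x < R" for x
    proof -
      have "ln (V (R/2)) \<le> ln (V x) - Q x * (R/2 - x)"
        using ln_V_supergradient[of x "R/2"] x R2 by (simp add: Q_def)
      also have "- (Q x * (R/2 - x)) \<le> x * Q x"
        using Q_nonneg[OF x(2)] R2 mult_nonneg_nonneg[of "Q x" "R/2"] by (simp add: algebra_simps)
      then have "ln (V x) - Q x * (R/2 - x) \<le> ln (V x) + 1" using small[of x] x R2 by linarith
      finally show ?thesis by simp
    qed
    obtain r where r: "0 < r" "r < R" "V r < exp (ln (V (R/2)) - 1)" using V_arbitrarily_small[of "exp (ln (V (R/2)) - 1)"] by auto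
    \<comment> \<open>A radius beyond both \<open>r\<close> and \<open>R/2\<close>, where the small
      volume and the lower bound contradict each other.\<close>
    define x where "x = max r (3 * R / 4)"
    have x: "R/2 < x" "x < R" "r \<le> x" using r R_pos by (auto simp: x_def)
    have "V x \<le> V r" using V_mono x by simp
    then have "V x < exp (ln (V (R/2)) - 1)" using r by simp
    moreover have "exp (ln (V (R/2)) - 1) \<le> exp (ln (V x))" using low[OF x(1,2)] by simp
    ultimately show False using V_pos[OF x(2)] by simp
  qed
  then obtain b where b: "0 < b" "b < R" "b * Q b \<ge> 1" by blast
  have ab: "a \<le> b"
  proof (rule ccontr)
    assume "\<not> a \<le> b"
    then have "b * Q b \<le> a * Q a" using Q_mono[of b a] a b R2 Q_nonneg[of b] by (intro mult_mono) auto
    then show False using aQ b by simp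
  qed
  have "continuous_on {a..b} (\<lambda>r. r * P r - V r)"
    using a b by (intro continuous_intros continuous_P continuous_V) auto
  moreover have "a * P a - V a \<le> 0"
    using aQ P_Q[of a] V_pos[of a] a R2 mult_right_mono[of "a * Q a" 1 "V a"] by (simp add: mult.assoc)
  moreover have "b * P b - V b \<ge> 0"
    using b P_Q[of b] V_pos[of b] mult_right_mono[of 1 "b * Q b" "V b"] by (simp add: mult.assoc)
  ultimately obtain r where r: "a \<le> r" "r \<le> b" "r * P r - V r = 0"
    using IVT'[of "\<lambda>r. r * P r - V r" a 0 b] ab by auto
  have "critical_radius \<Omega> r"
    unfolding critical_radius_iff using r a b V_pos[of r] by (auto simp: Q_def)
  moreover have "r = s" if "critical_radius \<Omega> r" "critical_radius \<Omega> s" for r s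
    using that rQ_strict_mono[of r s] rQ_strict_mono[of s r] unfolding critical_radius_iff
    by (cases r s rule: linorder_cases) auto
  ultimately show ?thesis by blast
qed

text \<open>If \<open>P r\<close> vanished, the increment bound would stop \<open>V\<close> from
  decreasing after \<open>r\<close>, yet \<open>V\<close> takes arbitrarily small values.\<close>

lemma P_pos:
  assumes "0 < r" "r < R"
  shows "P r > 0"
proof (rule ccontr)
  assume "\<not> P r > 0"
  then have P0: "P r = 0" using P_nonneg[of r] by simp
  obtain s where s: "0 < s" "s < R" "V s < V r" using V_arbitrarily_small[OF V_pos[OF assms(2)]] by metis
  have "r < s" using s V_mono[of s r] by force
  then have "V r - V s \<le> (s - r) * P r" using V_increment_bounds(2)[of r "s - r"] assms s by simp
  then show False using P0 s by simp
qed

context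
  fixes rs :: real
  assumes rs: "critical_radius \<Omega> rs"
begin

lemma rs_bounds: "0 < rs" "rs < R" "rs * P rs = V rs" "Q rs = 1 / rs"
  using rs V_pos[of rs] unfolding critical_radius_iff Q_def by (auto simp: field_simps)

text \<open>At \<open>rs\<close> the supergradient of \<open>ln V\<close> has slope
  \<open>- 1 / rs\<close>. Combined with the strict form of \<open>ln t \<le> t - 1\<close> at
  \<open>t = x / rs\<close>, this makes \<open>rs\<close> the only maximum of
  \<open>x * V x\<close>.\<close>

lemma rV_less:
  assumes "0 < x" "x < R" "x \<noteq> rs"
  shows "x * V x < rs * V rs"
proof -
  have "ln (V x) \<le> ln (V rs) - Q rs * (x - rs)"
    using ln_V_supergradient[of rs x] rs_bounds(1,2) assms by (simp add: Q_def)
  also have "Q rs * (x - rs) = x / rs - 1" using rs_bounds by (simp add: field_simps)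
  finally have "ln (V x) \<le> ln (V rs) - (x / rs - 1)" .
  moreover have "ln (x / rs) < x / rs - 1"
  proof -
    have "x / rs > 0" "x / rs \<noteq> 1" using assms rs_bounds by auto
    then have "ln (x / rs) \<le> x / rs - 1" "ln (x / rs) \<noteq> x / rs - 1"
      using ln_le_minus_one ln_eq_minus_one by blast+
    then show ?thesis by linarith
  qed
  moreover have "ln (x / rs) = ln x - ln rs" using assms rs_bounds by (simp add: ln_div)
  ultimately have "ln x + ln (V x) < ln rs + ln (V rs)" by linarith
  then have "ln (x * V x) < ln (rs * V rs)" using assms rs_bounds V_pos[of x] V_pos[of rs] by (simp add: ln_mult)
  then show ?thesis using assms rs_bounds V_pos[of x] V_pos[of rs] by (subst (asm) ln_less_cancel_iff) auto
qed

text \<open>\<open>r\<^sup>2 * P r\<close> is the product of \<open>r\<^sup>2 * V r\<close> and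
  \<open>Q r\<close>. The second factor is nondecreasing; the first is strictly increasing up to
  \<open>rs\<close>, because its logarithmic derivative \<open>2 / r - Q r\<close> is at least
  \<open>1 / r\<close> as long as \<open>r * Q r \<le> 1\<close>.\<close>

lemma r2P_strict_mono:
  assumes "0 < s" "s < r" "r \<le> rs"
  shows "s\<^sup>2 * P s < r\<^sup>2 * P r"
proof -
  have rR: "r < R" "s < R" using assms rs_bounds by auto
  have "ln (V s) \<le> ln (V r) - Q r * (s - r)"
    using ln_V_supergradient[of r s] assms rR by (simp add: Q_def)
  then have "ln (V s) \<le> ln (V r) + Q r * (r - s)" by (simp add: algebra_simps)
  also have "Q r * (r - s) \<le> (1 / r) * (r - s)"
  proof (rule mult_right_mono)
    have "r * Q r \<le> rs * Q rs"
      using Q_mono[of r rs] assms rs_bounds Q_nonneg[of r] rR by (intro mult_mono) auto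
    then have "r * Q r \<le> 1" using rs_bounds by simp
    then show "Q r \<le> 1 / r" using assms by (simp add: field_simps)
  qed (use assms in auto)
  also have "(1 / r) * (r - s) = 1 - s / r" using assms by (simp add: field_simps)
  finally have "ln (V s) \<le> ln (V r) + (1 - s / r)" by simp
  moreover have "ln (s / r) \<le> s / r - 1" using assms by (intro ln_le_minus_one) auto
  moreover have "ln (s / r) < 0" using assms by (subst ln_less_zero_iff) auto
  moreover have "ln (s / r) = ln s - ln r" using assms by (simp add: ln_div)
  ultimately have "2 * ln s + ln (V s) < 2 * ln r + ln (V r)" by linarith
  then have "ln (s\<^sup>2 * V s) < ln (r\<^sup>2 * V r)"
    using assms V_pos[OF rR(1)] V_pos[OF rR(2)] by (simp add: ln_mult ln_realpow)
  then have lt: "s\<^sup>2 * V s < r\<^sup>2 * V r"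
    using assms V_pos[OF rR(1)] V_pos[OF rR(2)] by (subst (asm) ln_less_cancel_iff) auto
  have Qp: "Q r > 0" using P_pos[of r] V_pos[OF rR(1)] assms rR by (simp add: Q_def)
  have "s\<^sup>2 * P s = (s\<^sup>2 * V s) * Q s" using P_Q[OF rR(2)] by simp
  also have "\<dots> \<le> (s\<^sup>2 * V s) * Q r" using Q_mono[of s r] assms rR V_pos[OF rR(2)] by (intro mult_left_mono) auto
  also have "\<dots> < (r\<^sup>2 * V r) * Q r" using lt Qp by (rule mult_strict_right_mono)
  also have "\<dots> = r\<^sup>2 * P r" using P_Q[OF rR(1)] by simp
  finally show ?thesis .
qed

lemma roots_iff: "\<Lambda> > 0 \<Longrightarrow> r \<in> roots \<Omega> \<Lambda> \<longleftrightarrow> 0 < r \<and> r < R \<and> r\<^sup>2 * P r = 1 / \<Lambda>"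
proof -
  assume "\<Lambda> > 0"
  then have "1 / x = \<Lambda> \<longleftrightarrow> x = 1 / \<Lambda>" for x :: real by auto
  then show ?thesis unfolding roots_def by simp
qed

text \<open>The derivative of \<open>1 / r - \<Lambda> * V r\<close> is
  \<open>(\<Lambda> * r\<^sup>2 * P r - 1) / r\<^sup>2\<close>, and on the radii up to
  \<open>rs\<close> it changes sign exactly once, at the root \<rho>. The root exists because
  \<open>r\<^sup>2 * P r\<close> is small near 0 and equals \<open>rs * V rs\<close>, which is at
  least \<open>1 / \<Lambda>\<close>, at \<open>rs\<close>.\<close>

lemma optimal_radius:
  assumes \<Lambda>: "\<Lambda> \<ge> 1 / (rs * V rs)"
  obtains \<rho> where "0 < \<rho>" "\<rho> \<le> rs" "\<rho> \<in> roots \<Omega> \<Lambda>" "\<And>r. r \<in> roots \<Omega> \<Lambda> \<Longrightarrow> \<rho> \<le> r"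
    "\<And>r. 0 < r \<Longrightarrow> r < R \<Longrightarrow> r \<noteq> \<rho> \<Longrightarrow> 1 / \<rho> - \<Lambda> * V \<rho> < 1 / r - \<Lambda> * V r"
    "\<Lambda> = 1 / (rs * V rs) \<Longrightarrow> \<rho> = rs"
proof -
  let ?h = "\<lambda>r. r\<^sup>2 * P r" and ?L = "1 / (rs * V rs)" and ?G = "\<lambda>r. 1 / r - \<Lambda> * V r"
  note b = rs_bounds
  have Vs: "V rs > 0" using V_pos b by simp
  have L0: "?L > 0" using Vs b by simp
  have L: "\<Lambda> > 0" using L0 \<Lambda> by linarith
  have hs: "?h rs = 1 / ?L" using b by (simp add: power2_eq_square mult.assoc)
  have hs2: "1 / \<Lambda> \<le> ?h rs" unfolding hs using \<Lambda> L0 by (intro frac_le) auto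
  obtain c where c: "0 < c" "c \<le> rs" "?h c \<le> 1 / \<Lambda>"
  proof -
    define W where "W = V (0::real)"
    have W0: "W \<ge> V rs" unfolding W_def using b by (intro V_mono) auto
    \<comment> \<open>\<open>P c\<close> is at most \<open>Q rs * W\<close>, so
      \<open>c \<le> 1\<close> and \<open>c \<le> 1 / k\<close> give
      \<open>c\<^sup>2 * P c \<le> 1 / \<Lambda>\<close>.\<close>
    define k where "k = Q rs * W * \<Lambda>"
    have k: "k > 0" using L Vs W0 b by (simp add: k_def)
    define c where "c = min (min rs 1) (1 / k)"
    have c: "0 < c" "c \<le> rs" "c \<le> 1" "c \<le> 1 / k" using b k by (auto simp: c_def)
    have "c\<^sup>2 * P c \<le> c * (Q rs * W)"
    proof -
      have "P c \<le> Q rs * W"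
        unfolding P_Q[of c, OF le_less_trans[OF c(2) b(2)]] W_def
        using Q_mono[of c rs] V_mono[of 0 c] Q_nonneg[of rs] b c by (intro mult_mono) auto
      then have "c\<^sup>2 * P c \<le> c * (Q rs * W)"
        using c P_nonneg[of c] by (intro mult_mono) (auto simp: power2_eq_square mult_le_cancel_right1)
      then show ?thesis .
    qed
    also have "\<dots> \<le> 1 / \<Lambda>"
    proof -
      have "c * k \<le> 1" using c(4) k by (simp add: field_simps)
      then show ?thesis using L by (simp add: k_def field_simps)
    qed
    finally show ?thesis using that c by blast
  qed
  have "continuous_on {c..rs} ?h" using c b by (intro continuous_intros continuous_P) auto
  then obtain \<rho> where \<rho>: "c \<le> \<rho>" "\<rho> \<le> rs" "?h \<rho> = 1 / \<Lambda>"
    using IVT'[of ?h c "1 / \<Lambda>" rs] c hs2 by auto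
  have \<rho>0: "0 < \<rho>" "\<rho> < R" using \<rho> c b by auto
  have root: "\<rho> \<in> roots \<Omega> \<Lambda>" using roots_iff[OF L] \<rho> \<rho>0 by simp
  have least: "\<rho> \<le> r" if "r \<in> roots \<Omega> \<Lambda>" for r
  proof (rule ccontr)
    assume "\<not> \<rho> \<le> r"
    then have "?h r < ?h \<rho>" using that \<rho> roots_iff[OF L] by (intro r2P_strict_mono) auto
    then show False using that \<rho> roots_iff[OF L] by simp
  qed
  have dG: "(?G has_real_derivative (\<Lambda> * ?h x - 1) / x\<^sup>2) (at x)" if x: "0 < x" "x < R" for x
    using x by (auto intro!: derivative_eq_intros DERIV_V simp: field_simps power2_eq_square)
  have cG: "continuous_on {p..q} ?G" if "0 < p" "q < R" for p q
    using that by (intro continuous_intros continuous_V) auto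
  have small: "?G \<rho> < ?G r" if r: "0 < r" "r \<le> rs" "r \<noteq> \<rho>" for r
  proof (cases "r < \<rho>")
    case True
    show ?thesis
    proof (rule DERIV_neg_imp_decreasing_open[OF True])
      fix x assume x: "r < x" "x < \<rho>"
      have "?h x < 1 / \<Lambda>" using r2P_strict_mono[of x \<rho>] x r \<rho> by simp
      then have "\<Lambda> * ?h x < 1" using L by (simp add: field_simps)
      then have "(\<Lambda> * ?h x - 1) / x\<^sup>2 < 0" using x r by (simp add: divide_neg_pos)
      then show "\<exists>y. (?G has_real_derivative y) (at x) \<and> y < 0" using dG[of x] x r \<rho>0 by force
    qed (use cG r \<rho>0 in auto)
  next
    case False
    then have "\<rho> < r" using r by simp
    then show ?thesis
    proof (rule DERIV_pos_imp_increasing_open)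
      fix x assume x: "\<rho> < x" "x < r"
      have "1 / \<Lambda> < ?h x" using r2P_strict_mono[of \<rho> x] x r \<rho> \<rho>0 by simp
      then have "\<Lambda> * ?h x > 1" using L by (simp add: field_simps)
      then have "(\<Lambda> * ?h x - 1) / x\<^sup>2 > 0" using x \<rho>0 by simp
      then show "\<exists>y. (?G has_real_derivative y) (at x) \<and> y > 0" using dG[of x] x r \<rho>0 b by force
    qed (use cG r \<rho>0 b in auto)
  qed
  have min: "?G \<rho> < ?G r" if r: "0 < r" "r < R" "r \<noteq> \<rho>" for r
  proof (cases "r \<le> rs")
    case False
    \<comment> \<open>Here \<open>r\<^sup>2 P r\<close> need not be monotone. Instead, the claim with \<open>rs\<close> in place of \<open>\<rho>\<close> is known for
      the critical parameter \<open>?L\<close>, and raising the parameter penalizes \<open>r\<close> more than \<open>rs\<close>.\<close>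
    have "?L * V r < 1 / r"
      using rV_less[of r] r False L0 b Vs by (simp add: field_simps)
    moreover have "?L * V rs = 1 / rs" using Vs by simp
    moreover have "(\<Lambda> - ?L) * V r \<le> (\<Lambda> - ?L) * V rs" using \<Lambda> V_mono[of rs r] False by (intro mult_left_mono) auto
    ultimately have "?G rs < ?G r" by (simp add: algebra_simps)
    moreover have "?G \<rho> \<le> ?G rs" using small[of rs] b by (cases "rs = \<rho>") auto
    ultimately show ?thesis by linarith
  qed (use small r in auto)
  have "\<rho> = rs" if "\<Lambda> = ?L"
  proof (rule ccontr)
    assume "\<rho> \<noteq> rs"
    then have "?h \<rho> < ?h rs" using \<rho> \<rho>0 by (intro r2P_strict_mono) auto
    then show False using \<rho>(3) hs that by simp
  qed
  then show ?thesis using that[of \<rho>] \<rho>0(1) \<rho>(2) root least min by blast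
qed

end

end

section \<open>Smooth bumps\<close>

text \<open>The polynomial factor in \<open>1 / s\<close> makes this family closed under
  differentiation, starting from the flat function \<open>exp (- (1 / s))\<close>.\<close>

definition flat_exp :: "real poly \<Rightarrow> real \<Rightarrow> real" where
  "flat_exp p s = (if s \<le> 0 then 0 else poly p (1 / s) * exp (- (1 / s)))"

text \<open>With \<open>t = 1 / s\<close>, the chain rule contributes the factor
  \<open>- t\<^sup>2\<close> to the derivative of \<open>poly p t * exp (- t)\<close> in
  \<open>t\<close>.\<close>

definition flat_exp_deriv :: "real poly \<Rightarrow> real poly" where
  "flat_exp_deriv p = monom 1 2 * (p - pderiv p)"

lemma tendsto_poly_exp_0: "((\<lambda>t. poly p t * exp (- t)) \<longlongrightarrow> (0::real)) at_top"
proof -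
  have "((\<lambda>t::real. \<Sum>i\<le>degree p. coeff p i * (t ^ i / exp t)) \<longlongrightarrow> (\<Sum>i\<le>degree p. coeff p i * 0)) at_top"
    by (intro tendsto_intros tendsto_power_div_exp_0)
  then show ?thesis
    by (simp add: poly_altdef sum_distrib_right sum_divide_distrib exp_minus field_simps)
qed

lemma has_derivative_flat_exp: "(flat_exp p has_real_derivative flat_exp (flat_exp_deriv p) s) (at s)"
proof -
  consider "s < 0" | "s = 0" | "s > 0" by linarith
  then show ?thesis
  proof cases
    case 1
    have "((\<lambda>_. 0) has_real_derivative 0) (at s)" by simp
    then have "(flat_exp p has_real_derivative 0) (at s)"
      by (rule has_field_derivative_transform_within_open[of _ _ _ "{..<0}"])
         (use 1 in \<open>auto simp: flat_exp_def\<close>)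
    then show ?thesis using 1 by (simp add: flat_exp_def)
  next
    case 3
    have "((\<lambda>s. poly p (1 / s) * exp (- (1 / s))) has_real_derivative flat_exp (flat_exp_deriv p) s) (at s)"
      using 3 by (auto intro!: derivative_eq_intros poly_DERIV[THEN DERIV_chain2]
        simp: flat_exp_def flat_exp_deriv_def poly_monom field_simps power2_eq_square)
    then show ?thesis
      by (rule has_field_derivative_transform_within_open[of _ _ _ "{0<..}"])
         (use 3 in \<open>auto simp: flat_exp_def\<close>)
  next
    case 2
    \<comment> \<open>With \<open>t = 1 / h\<close> the quotient is
      \<open>t * poly p t * exp (- t)\<close>, again a polynomial times an exponential, with
      \<open>t\<close> tending to infinity.\<close>
    have "((\<lambda>h. flat_exp p h / h) \<longlongrightarrow> 0) (at_right 0)"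
    proof -
      have "((\<lambda>t. poly (monom 1 1 * p) t * exp (- t)) \<longlongrightarrow> (0::real)) at_top" by (rule tendsto_poly_exp_0)
      then have "((\<lambda>h. poly (monom 1 1 * p) (inverse h) * exp (- inverse h)) \<longlongrightarrow> (0::real)) (at_right 0)"
        by (rule filterlim_compose) (rule filterlim_inverse_at_top_right)
      then show ?thesis
        by (rule filterlim_cong[THEN iffD1, rotated -1, OF _ refl refl])
           (auto simp: eventually_at_right_field flat_exp_def poly_monom field_simps intro!: exI[of _ 1])
    qed
    moreover have "((\<lambda>h. flat_exp p h / h) \<longlongrightarrow> 0) (at_left 0)"
      by (rule tendsto_eventually) (auto simp: eventually_at_left_field flat_exp_def intro!: exI[of _ "-1"])
    ultimately have "((\<lambda>h. flat_exp p h / h) \<longlongrightarrow> 0) (at 0)"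
      by (simp add: filterlim_at_split)
    then have "(flat_exp p has_real_derivative 0) (at 0)"
      by (simp add: DERIV_def flat_exp_def)
    then show ?thesis using 2 by (simp add: flat_exp_def)
  qed
qed

text \<open>A class closed under directional derivatives that contains the bumps. Differentiability
  of every order then follows by induction on the order.\<close>

inductive smooth_elementary :: "('a::euclidean_space \<Rightarrow> real) \<Rightarrow> bool" where
  const: "smooth_elementary (\<lambda>_. c)"
| coord: "smooth_elementary (\<lambda>x. x \<bullet> i)"
| add: "smooth_elementary f \<Longrightarrow> smooth_elementary g \<Longrightarrow> smooth_elementary (\<lambda>x. f x + g x)"
| mult: "smooth_elementary f \<Longrightarrow> smooth_elementary g \<Longrightarrow> smooth_elementary (\<lambda>x. f x * g x)"
| flat: "smooth_elementary (\<lambda>x. flat_exp p (\<alpha> - \<beta> * ((x - c) \<bullet> (x - c))))"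

lemma has_derivative_radial_flat_exp:
  fixes c :: "'a::euclidean_space"
  shows "((\<lambda>x. flat_exp p (\<alpha> - \<beta> * ((x - c) \<bullet> (x - c)))) has_derivative
    (\<lambda>v. flat_exp (flat_exp_deriv p) (\<alpha> - \<beta> * ((x - c) \<bullet> (x - c))) * (- 2 * \<beta> * (v \<bullet> (x - c))))) (at x)"
proof -
  have 1: "((\<lambda>x. \<alpha> - \<beta> * ((x - c) \<bullet> (x - c))) has_derivative (\<lambda>v. - 2 * \<beta> * (v \<bullet> (x - c)))) (at x)"
    by (auto intro!: derivative_eq_intros simp: inner_commute algebra_simps)
  have 2: "(flat_exp p has_derivative (*) (flat_exp (flat_exp_deriv p) s)) (at s)" for s
    using has_derivative_flat_exp[of p s] by (simp add: has_field_derivative_def)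
  show ?thesis using diff_chain_at[OF 1 2] by (simp add: o_def)
qed

lemma smooth_elementary_derivative:
  "smooth_elementary f \<Longrightarrow> \<exists>f'. (\<forall>x. (f has_derivative f' x) (at x)) \<and> (\<forall>i. smooth_elementary (\<lambda>x. f' x i))"
proof (induction rule: smooth_elementary.induct)
  case (const c)
  show ?case by (rule exI[of _ "\<lambda>_ _. 0"]) (auto intro: smooth_elementary.const)
next
  case (coord i)
  show ?case by (rule exI[of _ "\<lambda>_ v. v \<bullet> i"]) (auto intro: smooth_elementary.const derivative_eq_intros)
next
  case (add f g)
  then obtain f' g' where d: "\<And>x. (f has_derivative f' x) (at x)" "\<And>i. smooth_elementary (\<lambda>x. f' x i)"
    "\<And>x. (g has_derivative g' x) (at x)" "\<And>i. smooth_elementary (\<lambda>x. g' x i)" by blast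
  show ?case
    by (rule exI[of _ "\<lambda>x v. f' x v + g' x v"]) (auto intro!: smooth_elementary.add d derivative_eq_intros)
next
  case (mult f g)
  then obtain f' g' where d: "\<And>x. (f has_derivative f' x) (at x)" "\<And>i. smooth_elementary (\<lambda>x. f' x i)"
    "\<And>x. (g has_derivative g' x) (at x)" "\<And>i. smooth_elementary (\<lambda>x. g' x i)" by blast
  show ?case
    by (rule exI[of _ "\<lambda>x v. f x * g' x v + f' x v * g x"])
       (auto intro!: smooth_elementary.add smooth_elementary.mult mult d has_derivative_mult)
next
  case (flat p \<alpha> \<beta> c)
  have "smooth_elementary (\<lambda>x. - 2 * \<beta> * (i \<bullet> (x - c)))" for i
  proof -
    have "(\<lambda>x. - 2 * \<beta> * (i \<bullet> (x - c))) = (\<lambda>x. (- 2 * \<beta>) * ((x \<bullet> i) + (- (i \<bullet> c))))"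
      by (auto simp: inner_diff_right inner_commute)
    then show ?thesis by (simp only:) (intro smooth_elementary.intros)
  qed
  note lin = this
  show ?case
    by (intro exI[of _ "\<lambda>x v. flat_exp (flat_exp_deriv p) (\<alpha> - \<beta> * ((x - c) \<bullet> (x - c))) * (- 2 * \<beta> * (v \<bullet> (x - c)))"]
         conjI allI has_derivative_radial_flat_exp) (rule smooth_elementary.mult[OF smooth_elementary.flat lin])
qed

lemma smooth_elementary_k_times_cont_diff: "smooth_elementary f \<Longrightarrow> k_times_cont_diff k f"
proof (induction k arbitrary: f)
  case 0
  then obtain f' where "\<And>x. (f has_derivative f' x) (at x)" using smooth_elementary_derivative by blast
  then show ?case unfolding k_times_cont_diff.simps
    by (intro continuous_at_imp_continuous_on ballI has_derivative_continuous)
next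
  case (Suc k)
  then obtain f' where d: "\<And>x. (f has_derivative f' x) (at x)" "\<And>i. smooth_elementary (\<lambda>x. f' x i)"
    using smooth_elementary_derivative by blast
  have "frechet_derivative f (at x) = f' x" for x using frechet_derivative_at[OF d(1)] by metis
  then show ?case using d Suc.IH by (auto simp: differentiable_def)
qed

text \<open>For positive \<rho> the function is positive exactly on \<open>ball c \<rho>\<close>.
  The factor \<open>Suc n\<close> drives it to the indicator of that ball, so that identities for
  test functions pass to balls.\<close>

definition bump :: "'a::euclidean_space \<Rightarrow> real \<Rightarrow> nat \<Rightarrow> 'a \<Rightarrow> real" where
  "bump c \<rho> n x = flat_exp 1 (real (Suc n) * \<rho>\<^sup>2 - real (Suc n) * ((x - c) \<bullet> (x - c)))"

lemma bump_eq: "bump c \<rho> n x = flat_exp 1 (real (Suc n) * (\<rho>\<^sup>2 - (dist x c)\<^sup>2))"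
  by (simp add: bump_def dist_norm power2_norm_eq_inner right_diff_distrib)

lemma bump_bounds: "0 \<le> bump c \<rho> n x" "bump c \<rho> n x \<le> 1"
  by (auto simp: bump_def flat_exp_def)

lemma bump_pos_iff: "\<rho> > 0 \<Longrightarrow> bump c \<rho> n x > 0 \<longleftrightarrow> x \<in> ball c \<rho>"
proof -
  assume \<rho>: "\<rho> > 0"
  have "bump c \<rho> n x > 0 \<longleftrightarrow> real (Suc n) * (\<rho>\<^sup>2 - (dist x c)\<^sup>2) > 0"
    by (auto simp: bump_eq flat_exp_def not_le)
  also have "\<dots> \<longleftrightarrow> (dist x c)\<^sup>2 < \<rho>\<^sup>2" by (simp add: zero_less_mult_iff)
  also have "\<dots> \<longleftrightarrow> dist x c < \<rho>" using \<rho> by (auto intro: power2_less_imp_less power_strict_mono)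
  finally show ?thesis by (simp add: dist_commute)
qed

lemma bump_eq_0_iff: "\<rho> > 0 \<Longrightarrow> bump c \<rho> n x = 0 \<longleftrightarrow> x \<notin> ball c \<rho>"
  using bump_pos_iff[of \<rho> c n x] bump_bounds(1)[of c \<rho> n x] by linarith

lemma bump_shift: "bump c \<rho> n (x - v) = bump (c + v) \<rho> n x"
  by (simp add: bump_def algebra_simps)

lemma bump_tendsto_indicator:
  assumes "\<rho> > 0"
  shows "(\<lambda>n. bump c \<rho> n x) \<longlonglongrightarrow> indicator (ball c \<rho>) x"
proof (cases "x \<in> ball c \<rho>")
  case True
  define k where "k = \<rho>\<^sup>2 - (dist x c)\<^sup>2"
  have k: "k > 0" using True assms by (auto simp: k_def dist_commute power_strict_mono)
  have "bump c \<rho> n x = exp (- (1 / k) * inverse (real (Suc n)))" for n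
  proof -
    have "\<not> real (Suc n) * k \<le> 0" using k by (simp add: not_le)
    then show ?thesis unfolding bump_eq k_def[symmetric] flat_exp_def by (simp add: field_simps)
  qed
  moreover have "(\<lambda>n. exp (- (1 / k) * inverse (real (Suc n)))) \<longlonglongrightarrow> exp (- (1 / k) * 0)"
    by (intro tendsto_intros LIMSEQ_inverse_real_of_nat)
  ultimately show ?thesis using True by simp
next
  case False
  then show ?thesis using bump_eq_0_iff[OF assms, of c _ x] by simp
qed

lemma bump_test_function:
  assumes "\<rho> > 0" "cball c \<rho> \<subseteq> \<Omega>"
  shows "bump c \<rho> n \<in> test_functions \<Omega>"
proof -
  have "smooth_elementary (bump c \<rho> n)"
    unfolding bump_def[abs_def] by (rule smooth_elementary.flat)
  then have 1: "k_times_cont_diff k (bump c \<rho> n)" for k by (rule smooth_elementary_k_times_cont_diff)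
  have 2: "{x. bump c \<rho> n x \<noteq> 0} = ball c \<rho>" unfolding bump_eq_0_iff[OF assms(1)] by blast
  have 3: "closure (ball c \<rho>) = cball c \<rho>" using assms by (intro closure_ball)
  show ?thesis unfolding test_functions_def mem_Collect_eq 2 3
    using 1 assms(2) compact_cball[of c \<rho>] by blast
qed

section \<open>Test functions and translations\<close>

lemma integral_lebesgue_translation:
  fixes f :: "'a::euclidean_space \<Rightarrow> real"
  assumes f: "f \<in> borel_measurable lebesgue"
  shows "(\<integral>x. f (x + a) \<partial>lebesgue) = (\<integral>x. f x \<partial>lebesgue)"
    "(\<lambda>x. f (x + a)) \<in> borel_measurable lebesgue"
proof -
  have im: "(\<lambda>x. x + a) -` A = (+) (- a) ` A" for A by force
  have m: "(\<lambda>x. x + a) \<in> measurable lebesgue lebesgue"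
  proof (rule measurableI)
    fix A :: "'a set" assume "A \<in> sets lebesgue"
    from lebesgue_sets_translation[OF this, of "- a"]
    show "(\<lambda>x. x + a) -` A \<inter> space lebesgue \<in> sets lebesgue" unfolding im by simp
  qed simp
  have "distr lebesgue lebesgue (\<lambda>x. x + a) = lebesgue"
  proof (rule measure_eqI)
    fix A :: "'a set" assume "A \<in> sets (distr lebesgue lebesgue (\<lambda>x. x + a))"
    then have A: "A \<in> sets lebesgue" by simp
    have "emeasure lebesgue ((+) (- a) ` A) = emeasure lebesgue A"
      using emeasure_lebesgue_affine[of 1 "- a" A] by (simp add: add.commute cong: image_cong)
    then show "emeasure (distr lebesgue lebesgue (\<lambda>x. x + a)) A = emeasure lebesgue A"
      using A m by (subst emeasure_distr) (auto simp: im)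
  qed simp
  then show "(\<integral>x. f (x + a) \<partial>lebesgue) = (\<integral>x. f x \<partial>lebesgue)"
    using integral_distr[OF m f] by simp
  show "(\<lambda>x. f (x + a)) \<in> borel_measurable lebesgue"
    using measurable_compose[OF m f] by simp
qed

lemma test_function_continuous: "\<phi> \<in> test_functions \<Omega> \<Longrightarrow> continuous_on UNIV \<phi>"
  unfolding test_functions_def using k_times_cont_diff.simps(1) by blast

lemma test_function_derivative: "\<phi> \<in> test_functions \<Omega> \<Longrightarrow> (\<phi> has_derivative frechet_derivative \<phi> (at x)) (at x)"
  unfolding test_functions_def using k_times_cont_diff.simps(2)[of 0 \<phi>] frechet_derivative_works by blast

lemma test_function_support:
  assumes "\<phi> \<in> test_functions \<Omega>" "x \<notin> closure {x. \<phi> x \<noteq> 0}"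
  shows "\<phi> x = 0" "frechet_derivative \<phi> (at x) = (\<lambda>_. 0)"
proof -
  show "\<phi> x = 0" using assms(2) closure_subset[of "{x. \<phi> x \<noteq> 0}"] by blast
  have "((\<lambda>_. 0) has_derivative (\<lambda>_. 0)) (at x)" by simp
  then have "(\<phi> has_derivative (\<lambda>_. 0)) (at x)"
    by (rule has_derivative_transform_within_open[of _ _ _ _ "- closure {x. \<phi> x \<noteq> 0}"])
       (use assms(2) closure_subset[of "{x. \<phi> x \<noteq> 0}"] in auto)
  then show "frechet_derivative \<phi> (at x) = (\<lambda>_. 0)" using frechet_derivative_at by metis
qed

lemma test_function_derivative_expand:
  assumes "\<phi> \<in> test_functions \<Omega>"
  shows "frechet_derivative \<phi> (at x) v = (\<Sum>i\<in>Basis. (v \<bullet> i) * frechet_derivative \<phi> (at x) i)"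
proof -
  interpret linear "frechet_derivative \<phi> (at x)"
    using test_function_derivative[OF assms] has_derivative_linear by blast
  have "frechet_derivative \<phi> (at x) v = frechet_derivative \<phi> (at x) (\<Sum>i\<in>Basis. (v \<bullet> i) *\<^sub>R i)"
    by (simp add: euclidean_representation)
  then show ?thesis by (simp add: sum scaleR)
qed

lemma test_function_derivative_continuous:
  assumes "\<phi> \<in> test_functions \<Omega>"
  shows "continuous_on UNIV (\<lambda>x. frechet_derivative \<phi> (at x) v)"
proof -
  have "k_times_cont_diff (Suc 0) \<phi>" using assms by (auto simp: test_functions_def)
  then have c: "\<And>i. i \<in> Basis \<Longrightarrow> continuous_on UNIV (\<lambda>x. frechet_derivative \<phi> (at x) i)" by simp
  have "frechet_derivative \<phi> (at x) v = (\<Sum>i\<in>Basis. (v \<bullet> i) * frechet_derivative \<phi> (at x) i)" for x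
    by (rule test_function_derivative_expand[OF assms])
  then show ?thesis by (simp only:) (intro continuous_intros c)
qed

lemma test_function_derivative_bounded:
  assumes \<phi>: "\<phi> \<in> test_functions \<Omega>"
  obtains C where "C \<ge> 0" "\<And>x v. \<bar>frechet_derivative \<phi> (at x) v\<bar> \<le> C * norm v"
proof -
  let ?K = "closure {x. \<phi> x \<noteq> 0}"
  have K: "compact ?K" using \<phi> by (auto simp: test_functions_def)
  have "\<exists>B\<ge>0. \<forall>x. \<bar>frechet_derivative \<phi> (at x) i\<bar> \<le> B" for i
  proof -
    have "compact ((\<lambda>x. frechet_derivative \<phi> (at x) i) ` ?K)"
      using K test_function_derivative_continuous[OF \<phi>] by (meson compact_continuous_image continuous_on_subset subset_UNIV)
    then have "bounded ((\<lambda>x. frechet_derivative \<phi> (at x) i) ` ?K)" by (rule compact_imp_bounded)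
    then obtain B where B: "B > 0" "\<forall>x\<in>?K. norm (frechet_derivative \<phi> (at x) i) \<le> B"
      unfolding bounded_pos by blast
    have "\<bar>frechet_derivative \<phi> (at x) i\<bar> \<le> B" for x
      using B test_function_support(2)[OF \<phi>, of x] by (cases "x \<in> ?K") auto
    then show ?thesis using B by (intro exI[of _ B]) auto
  qed
  then obtain B where B: "\<And>i. B i \<ge> 0" "\<And>i x. \<bar>frechet_derivative \<phi> (at x) i\<bar> \<le> B i" by metis
  show ?thesis
  proof
    show "0 \<le> (\<Sum>i\<in>Basis. B i)" using B by (intro sum_nonneg)
    fix x v :: 'a
    have "frechet_derivative \<phi> (at x) v = (\<Sum>i\<in>Basis. (v \<bullet> i) * frechet_derivative \<phi> (at x) i)"
      by (rule test_function_derivative_expand[OF \<phi>])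
    also have "\<bar>\<dots>\<bar> \<le> (\<Sum>i\<in>Basis. \<bar>(v \<bullet> i) * frechet_derivative \<phi> (at x) i\<bar>)" by (rule sum_abs)
    also have "\<dots> \<le> (\<Sum>i\<in>Basis. norm v * B i)"
      using B by (intro sum_mono) (auto simp: abs_mult Basis_le_norm intro!: mult_mono)
    also have "\<dots> = (\<Sum>i\<in>Basis. B i) * norm v" by (simp only: sum_distrib_right mult.commute[of "norm v"])
    finally show "\<bar>frechet_derivative \<phi> (at x) v\<bar> \<le> (\<Sum>i\<in>Basis. B i) * norm v" .
  qed
qed

lemma test_function_lipschitz:
  assumes \<phi>: "\<phi> \<in> test_functions \<Omega>" and C: "\<And>x v. \<bar>frechet_derivative \<phi> (at x) v\<bar> \<le> C * norm v"
  shows "\<bar>\<phi> x - \<phi> y\<bar> \<le> C * norm (x - y)"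
proof -
  have "norm (\<phi> x - \<phi> y) \<le> C * norm (x - y)"
    using C by (intro differentiable_bound[of UNIV \<phi> "\<lambda>x. frechet_derivative \<phi> (at x)"])
      (auto intro!: onorm_le test_function_derivative[OF \<phi>])
  then show ?thesis by simp
qed

lemma test_function_bounded:
  assumes \<phi>: "\<phi> \<in> test_functions \<Omega>"
  obtains B where "\<And>x. \<bar>\<phi> x\<bar> \<le> B"
proof -
  let ?K = "closure {x. \<phi> x \<noteq> 0}"
  have "compact (\<phi> ` ?K)"
    using \<phi> test_function_continuous[OF \<phi>] unfolding test_functions_def
    by (metis (no_types, lifting) compact_continuous_image continuous_on_subset mem_Collect_eq subset_UNIV)
  then have "bounded (\<phi> ` ?K)" by (rule compact_imp_bounded)
  then obtain B where B: "B > 0" "\<forall>x\<in>?K. norm (\<phi> x) \<le> B" unfolding bounded_pos by blast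
  then have "\<bar>\<phi> x\<bar> \<le> B" for x using test_function_support(1)[OF \<phi>, of x] by (cases "x \<in> ?K") auto
  then show ?thesis using that by blast
qed

lemma Linf_bound:
  assumes "f \<in> Linf M"
  obtains C where "C \<ge> 0" "AE x in M. norm (f x) \<le> C" "f \<in> borel_measurable M"
proof -
  have f: "f \<in> borel_measurable M" "Linf_norm M f < \<infinity>" using assms by (auto simp: Linf_def)
  obtain C where C: "Linf_norm M f \<le> ereal C" using f(2) by (cases "Linf_norm M f") auto
  have "AE x in M. ereal (norm (f x)) \<le> Linf_norm M f"
    unfolding Linf_norm_def by (rule esssup_AE)
  then have "AE x in M. norm (f x) \<le> max 0 C"
    by eventually_elim (use C order_trans in fastforce)
  then show ?thesis using that[of "max 0 C"] f(1) by simp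
qed

lemma LinfI:
  assumes "f \<in> borel_measurable M" "AE x in M. norm (f x) \<le> C"
  shows "f \<in> Linf M" "Linf_norm M f \<le> ereal C"
proof -
  show "Linf_norm M f \<le> ereal C" unfolding Linf_norm_def using assms by (intro esssup_I) auto
  then show "f \<in> Linf M" using assms(1) by (auto simp: Linf_def intro: le_less_trans)
qed

section \<open>Weak gradients and Lipschitz constants\<close>

context
  fixes \<Omega> :: "'a::euclidean_space set"
  assumes \<Omega>: "open \<Omega>" "bounded \<Omega>"
begin

abbreviation M :: "'a measure" where "M \<equiv> lebesgue_on \<Omega>"

lemma domain_lmeasurable: "\<Omega> \<in> lmeasurable" "\<Omega> \<in> sets lebesgue"
  using \<Omega> by (auto intro: lmeasurable_open fmeasurableD)


lemma finite_measure_M: "finite_measure M"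
  using domain_lmeasurable by (intro finite_measure_lebesgue_on)

lemma integrable_bounded:
  fixes f :: "'a \<Rightarrow> real"
  assumes "f \<in> borel_measurable M" "AE x in M. \<bar>f x\<bar> \<le> C"
  shows "integrable M f"
  using finite_measure.integrable_const_bound[OF finite_measure_M, of f C] assms by simp

lemma continuous_measurable:
  fixes f :: "'a \<Rightarrow> real"
  assumes "continuous_on UNIV f"
  shows "f \<in> borel_measurable M"
  using assms domain_lmeasurable(2) by (intro continuous_imp_measurable_on_sets_lebesgue) (auto intro: continuous_on_subset)

lemma measurable_extend:
  fixes u :: "'a \<Rightarrow> real"
  assumes "u \<in> borel_measurable M"
  shows "(\<lambda>x. indicator \<Omega> x * u x) \<in> borel_measurable lebesgue"
  using assms domain_lmeasurable(2) by (subst (asm) borel_measurable_restrict_space_iff) auto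

lemma integral_M:
  fixes f :: "'a \<Rightarrow> real"
  shows "(\<integral>x. f x \<partial>M) = (\<integral>x. indicator \<Omega> x * f x \<partial>lebesgue)"
  using domain_lmeasurable(2) by (subst integral_restrict_space) auto

text \<open>Moves a translation from the test function to \<open>u\<close>, extended by zero; the
  vanishing of \<open>\<phi>\<close> outside \<Omega> allows integration over \<Omega> on both
  sides.\<close>

lemma integral_translate:
  fixes u \<phi> :: "'a \<Rightarrow> real"
  assumes u: "u \<in> borel_measurable M" and \<phi>: "continuous_on UNIV \<phi>" "\<And>x. x \<notin> \<Omega> \<Longrightarrow> \<phi> x = 0"
  shows "(\<integral>x. u x * \<phi> (x - a) \<partial>M) = (\<integral>x. (indicator \<Omega> (x + a) * u (x + a)) * \<phi> x \<partial>M)"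
proof -
  have c: "continuous_on UNIV (\<lambda>x. \<phi> (x - a))"
    by (rule continuous_on_compose2[OF \<phi>(1)]) (auto intro!: continuous_intros)
  have m: "(\<lambda>x. \<phi> (x - a)) \<in> borel_measurable lebesgue"
    using borel_measurable_continuous_onI[OF c] by (simp add: measurable_completion)
  have "(\<integral>x. u x * \<phi> (x - a) \<partial>M) = (\<integral>x. (indicator \<Omega> x * u x) * \<phi> (x - a) \<partial>lebesgue)"
    by (simp add: integral_M mult.assoc)
  also have "\<dots> = (\<integral>x. (indicator \<Omega> (x + a) * u (x + a)) * \<phi> (x + a - a) \<partial>lebesgue)"
    using measurable_extend[OF u] m by (intro integral_lebesgue_translation(1)[symmetric]) auto
  also have "\<dots> = (\<integral>x. indicator \<Omega> x * ((indicator \<Omega> (x + a) * u (x + a)) * \<phi> x) \<partial>lebesgue)"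
    using \<phi>(2) by (intro Bochner_Integration.integral_cong) (auto simp: indicator_def)
  also have "\<dots> = (\<integral>x. (indicator \<Omega> (x + a) * u (x + a)) * \<phi> x \<partial>M)"
    by (simp add: integral_M)
  finally show ?thesis .
qed

text \<open>Dominated convergence with a constant majorant: \<open>\<phi>\<close> is Lipschitz,
  \<open>u\<close> is essentially bounded and \<Omega> has finite measure. The limit is the
  left-hand side of the weak gradient identity up to sign, so differences of \<open>u\<close> can
  stand in for \<open>g\<close>.\<close>

lemma difference_quotient_integral_tendsto:
  assumes u: "u \<in> Linf M" and \<phi>: "\<phi> \<in> test_functions \<Omega>'" and h: "h \<longlonglongrightarrow> 0" "\<And>n. h n \<noteq> (0::real)"
  shows "(\<lambda>n. ((\<integral>x. u x * \<phi> (x - h n *\<^sub>R v) \<partial>M) - (\<integral>x. u x * \<phi> x \<partial>M)) / h n)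
     \<longlonglongrightarrow> - (\<integral>x. u x * frechet_derivative \<phi> (at x) v \<partial>M)"
proof -
  obtain C where C: "C \<ge> 0" "AE x in M. norm (u x) \<le> C" and um: "u \<in> borel_measurable M" using Linf_bound[OF u] by metis
  obtain D where D: "D \<ge> 0" "\<And>x v. \<bar>frechet_derivative \<phi> (at x) v\<bar> \<le> D * norm v" using test_function_derivative_bounded[OF \<phi>] by metis
  obtain B where B: "\<And>x. \<bar>\<phi> x\<bar> \<le> B" using test_function_bounded[OF \<phi>] by metis
  have cont: "continuous_on UNIV (\<lambda>x. \<phi> (x - a))" for a
    by (rule continuous_on_compose2[OF test_function_continuous[OF \<phi>]]) (auto intro!: continuous_intros)
  have m\<phi>: "(\<lambda>x. \<phi> (x - a)) \<in> borel_measurable M" for a by (rule continuous_measurable[OF cont])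
  have md: "(\<lambda>x. frechet_derivative \<phi> (at x) v) \<in> borel_measurable M"
    by (rule continuous_measurable[OF test_function_derivative_continuous[OF \<phi>]])
  have int: "integrable M (\<lambda>x. u x * \<phi> (x - a))" for a
  proof (rule integrable_bounded)
    show "(\<lambda>x. u x * \<phi> (x - a)) \<in> borel_measurable M" using um m\<phi> by (rule borel_measurable_times)
    show "AE x in M. \<bar>u x * \<phi> (x - a)\<bar> \<le> C * B"
      using C(2) by eventually_elim (use B in \<open>auto simp: abs_mult intro!: mult_mono\<close>)
  qed
  have lim: "(\<lambda>n. \<integral>x. u x * ((\<phi> (x - h n *\<^sub>R v) - \<phi> x) / h n) \<partial>M)
     \<longlonglongrightarrow> (\<integral>x. u x * (- frechet_derivative \<phi> (at x) v) \<partial>M)"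
  proof (rule integral_dominated_convergence[where w="\<lambda>_. C * (D * norm v)"])
    show "(\<lambda>x. u x * (- frechet_derivative \<phi> (at x) v)) \<in> borel_measurable M"
      using um md by (intro borel_measurable_times borel_measurable_uminus)
    show "(\<lambda>x. u x * ((\<phi> (x - h n *\<^sub>R v) - \<phi> x) / h n)) \<in> borel_measurable M" for n
      using um m\<phi>[of "h n *\<^sub>R v"] m\<phi>[of 0]
      by (intro borel_measurable_times borel_measurable_divide borel_measurable_diff) auto
    show "integrable M (\<lambda>_. C * (D * norm v))" using finite_measure_M by (simp add: finite_measure.integrable_const)
    show "AE x in M. (\<lambda>n. u x * ((\<phi> (x - h n *\<^sub>R v) - \<phi> x) / h n)) \<longlonglongrightarrow> u x * (- frechet_derivative \<phi> (at x) v)"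
    proof (rule AE_I2)
      fix x
      have d: "(\<phi> has_derivative frechet_derivative \<phi> (at x)) (at x)" by (rule test_function_derivative[OF \<phi>])
      note lin = has_derivative_linear[OF d]
      have "((\<lambda>t. x - t *\<^sub>R v) has_derivative (\<lambda>t. - (t *\<^sub>R v))) (at 0)"
        by (auto intro!: derivative_eq_intros)
      moreover have "(\<phi> has_derivative frechet_derivative \<phi> (at x)) (at (x - 0 *\<^sub>R v))" using d by simp
      ultimately have "((\<lambda>t. \<phi> (x - t *\<^sub>R v)) has_derivative (\<lambda>t. frechet_derivative \<phi> (at x) (- (t *\<^sub>R v)))) (at 0)"
        using diff_chain_at[of "\<lambda>t. x - t *\<^sub>R v" _ 0 \<phi>] by (simp add: o_def)
      then have "((\<lambda>t. \<phi> (x - t *\<^sub>R v)) has_real_derivative (- frechet_derivative \<phi> (at x) v)) (at 0)"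
        by (rule has_derivative_imp_has_field_derivative) (simp add: linear_neg[OF lin] linear_scale[OF lin])
      then have "(\<lambda>t. (\<phi> (x - t *\<^sub>R v) - \<phi> x) / t) \<midarrow>0\<rightarrow> - frechet_derivative \<phi> (at x) v"
        by (simp add: DERIV_def)
      then have "(\<lambda>n. (\<phi> (x - h n *\<^sub>R v) - \<phi> x) / h n) \<longlonglongrightarrow> - frechet_derivative \<phi> (at x) v"
        using h by (auto simp: tendsto_at_iff_sequentially o_def)
      then show "(\<lambda>n. u x * ((\<phi> (x - h n *\<^sub>R v) - \<phi> x) / h n)) \<longlonglongrightarrow> u x * (- frechet_derivative \<phi> (at x) v)"
        by (intro tendsto_intros)
    qed
    show "AE x in M. norm (u x * ((\<phi> (x - h n *\<^sub>R v) - \<phi> x) / h n)) \<le> C * (D * norm v)" for n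
      using C(2)
    proof eventually_elim
      fix x assume x: "norm (u x) \<le> C"
      have "\<bar>\<phi> (x - h n *\<^sub>R v) - \<phi> x\<bar> \<le> D * norm (h n *\<^sub>R v)"
        using test_function_lipschitz[OF \<phi> D(2), of "x - h n *\<^sub>R v" x] by simp
      then have "\<bar>(\<phi> (x - h n *\<^sub>R v) - \<phi> x) / h n\<bar> \<le> D * norm v"
        using h(2)[of n] by (simp add: abs_divide field_simps)
      then show "norm (u x * ((\<phi> (x - h n *\<^sub>R v) - \<phi> x) / h n)) \<le> C * (D * norm v)"
        using x C(1) unfolding real_norm_def abs_mult by (intro mult_mono) auto
    qed
  qed
  have eq: "(\<integral>x. u x * ((\<phi> (x - h n *\<^sub>R v) - \<phi> x) / h n) \<partial>M) = ((\<integral>x. u x * \<phi> (x - h n *\<^sub>R v) \<partial>M) - (\<integral>x. u x * \<phi> x \<partial>M)) / h n" for n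
  proof -
    have "(\<lambda>x. u x * ((\<phi> (x - h n *\<^sub>R v) - \<phi> x) / h n)) = (\<lambda>x. (u x * \<phi> (x - h n *\<^sub>R v) - u x * \<phi> x) / h n)"
      by (simp add: right_diff_distrib)
    then show ?thesis using Bochner_Integration.integral_diff[OF int[of "h n *\<^sub>R v"] int[of 0]]
      by (simp only: integral_divide_zero diff_zero scaleR_zero_left)
  qed
  show ?thesis using lim unfolding eq mult_minus_right integral_minus .
qed

lemma weak_gradient_direction:
  assumes g: "is_Linf_weak_gradient \<Omega> u g" and \<phi>: "\<phi> \<in> test_functions \<Omega>"
  shows "(\<integral>x. u x * frechet_derivative \<phi> (at x) v \<partial>M) = - (\<integral>x. (g x \<bullet> v) * \<phi> x \<partial>M)"
    "integrable M (\<lambda>x. (g x \<bullet> v) * \<phi> x)"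
proof -
  have uL: "u \<in> Linf M" and gL: "g \<in> Linf M" using g by (auto simp: is_Linf_weak_gradient_def)
  obtain C where C: "C \<ge> 0" "AE x in M. norm (u x) \<le> C" and um: "u \<in> borel_measurable M" using Linf_bound[OF uL] by metis
  obtain G where G: "G \<ge> 0" "AE x in M. norm (g x) \<le> G" and gm: "g \<in> borel_measurable M" using Linf_bound[OF gL] by metis
  obtain D where D: "D \<ge> 0" "\<And>x v. \<bar>frechet_derivative \<phi> (at x) v\<bar> \<le> D * norm v" using test_function_derivative_bounded[OF \<phi>] by metis
  obtain B where B: "\<And>x. \<bar>\<phi> x\<bar> \<le> B" using test_function_bounded[OF \<phi>] by metis
  have m\<phi>: "\<phi> \<in> borel_measurable M" by (rule continuous_measurable[OF test_function_continuous[OF \<phi>]])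
  have md: "(\<lambda>x. frechet_derivative \<phi> (at x) v) \<in> borel_measurable M" for v
    by (rule continuous_measurable[OF test_function_derivative_continuous[OF \<phi>]])
  have i1: "integrable M (\<lambda>x. u x * frechet_derivative \<phi> (at x) v)" for v
  proof (rule integrable_bounded)
    show "AE x in M. \<bar>u x * frechet_derivative \<phi> (at x) v\<bar> \<le> C * (D * norm v)"
      using C(2) by eventually_elim (use C D in \<open>auto simp: abs_mult intro!: mult_mono\<close>)
  qed (use um md in \<open>rule borel_measurable_times\<close>)
  show i2: "integrable M (\<lambda>x. (g x \<bullet> v) * \<phi> x)" for v
  proof (rule integrable_bounded)
    show "AE x in M. \<bar>g x \<bullet> v * \<phi> x\<bar> \<le> (G * norm v) * B"
      using G(2)
    proof eventually_elim
      fix x assume x: "norm (g x) \<le> G"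
      have "\<bar>g x \<bullet> v\<bar> \<le> norm (g x) * norm v" by (rule Cauchy_Schwarz_ineq2)
      also have "\<dots> \<le> G * norm v" using x by (intro mult_right_mono) auto
      finally show "\<bar>g x \<bullet> v * \<phi> x\<bar> \<le> (G * norm v) * B" unfolding abs_mult using B[of x] G(1) by (intro mult_mono) auto
    qed
  qed (use gm m\<phi> in \<open>auto intro!: borel_measurable_times borel_measurable_inner\<close>)
  have lin: "frechet_derivative \<phi> (at x) v = (\<Sum>i\<in>Basis. (v \<bullet> i) * frechet_derivative \<phi> (at x) i)" for x
    by (rule test_function_derivative_expand[OF \<phi>])
  have "(\<integral>x. u x * frechet_derivative \<phi> (at x) v \<partial>M) = (\<integral>x. (\<Sum>i\<in>Basis. (v \<bullet> i) * (u x * frechet_derivative \<phi> (at x) i)) \<partial>M)"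
    unfolding lin by (simp add: sum_distrib_left algebra_simps)
  also have "\<dots> = (\<Sum>i\<in>Basis. (v \<bullet> i) * (\<integral>x. u x * frechet_derivative \<phi> (at x) i \<partial>M))"
    using i1 by (subst Bochner_Integration.integral_sum) auto
  also have "\<dots> = (\<Sum>i\<in>Basis. (v \<bullet> i) * - (\<integral>x. (g x \<bullet> i) * \<phi> x \<partial>M))"
    using g \<phi> by (intro sum.cong refl arg_cong2[where f="(*)"]) (auto simp: is_Linf_weak_gradient_def)
  also have "\<dots> = - (\<integral>x. (\<Sum>i\<in>Basis. (v \<bullet> i) * ((g x \<bullet> i) * \<phi> x)) \<partial>M)"
    using i2 by (subst Bochner_Integration.integral_sum) (auto simp: sum_negf)
  also have "(\<lambda>x. \<Sum>i\<in>Basis. (v \<bullet> i) * ((g x \<bullet> i) * \<phi> x)) = (\<lambda>x. (g x \<bullet> v) * \<phi> x)"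
    by (subst euclidean_inner[of "g _" v]) (simp add: sum_distrib_left algebra_simps)
  finally show "(\<integral>x. u x * frechet_derivative \<phi> (at x) v \<partial>M) = - (\<integral>x. (g x \<bullet> v) * \<phi> x \<partial>M)" .
qed

text \<open>The set \<open>E\<close> where \<open>f\<close> is positive is enclosed in an open set
  of nearly the same measure. Vitali fills that set with disjoint balls up to a null set, so the
  integral of \<open>f\<close> over it is nonpositive, and hence so is the integral over
  \<open>E\<close> up to an arbitrarily small error.\<close>

lemma AE_nonpos_of_balls:
  fixes f :: "'a \<Rightarrow> real"
  assumes f: "f \<in> borel_measurable M" and C: "AE x in M. \<bar>f x\<bar> \<le> C" "C \<ge> 0"
    and le: "\<And>c r. r > 0 \<Longrightarrow> cball c r \<subseteq> \<Omega> \<Longrightarrow> (\<integral>x. indicator (ball c r) x * f x \<partial>M) \<le> 0"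
  shows "AE x in M. f x \<le> 0"
proof -
  define E where "E = {x \<in> \<Omega>. f x > 0}"
  have "{x \<in> space M. f x > 0} \<in> sets M" using f by measurable
  then have E: "E \<in> sets M" by (simp add: E_def)
  have El: "E \<in> sets lebesgue" "E \<subseteq> \<Omega>" using E domain_lmeasurable(2) by (auto simp: sets_restrict_space_iff E_def)
  have intA: "integrable M (\<lambda>x. indicator A x * f x)" if "A \<in> sets M" for A
  proof (rule integrable_bounded)
    show "(\<lambda>x. indicator A x * f x) \<in> borel_measurable M" using f that by measurable
    show "AE x in M. \<bar>indicator A x * f x\<bar> \<le> C" using C(1) by eventually_elim (use C in \<open>auto simp: indicator_def\<close>)
  qed
  have *: "(\<integral>x. indicator E x * f x \<partial>M) \<le> 0 + e" if e: "e > 0" for e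
  proof -
    \<comment> \<open>The excess has measure below \<open>e / (C + 1)\<close>, and \<open>f\<close>
      is bounded by \<open>C\<close>, so it contributes at most \<open>e\<close> to the
      integral.\<close>
    obtain T where T: "open T" "E \<subseteq> T" "T - E \<in> lmeasurable" "emeasure lebesgue (T - E) < ennreal (e / (C + 1))"
      using sets_lebesgue_outer_open[OF El(1), of "e / (C + 1)"] e C by (metis add_nonneg_pos divide_pos_pos zero_less_one)
    define U where "U = T \<inter> \<Omega>"
    have U: "open U" "E \<subseteq> U" "U \<subseteq> \<Omega>" using T El \<Omega> by (auto simp: U_def)
    have US: "U \<in> sets M" using U domain_lmeasurable(2) by (auto simp: sets_restrict_space_iff)
    let ?K = "{(c,r). 0 < r \<and> cball c r \<subseteq> U}"
    obtain I where I: "countable I" "I \<subseteq> ?K" "pairwise (\<lambda>i j. disjnt (ball (fst i) (snd i)) (ball (fst j) (snd j))) I"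
        "negligible (U - (\<Union>i\<in>I. ball (fst i) (snd i)))"
    proof (rule Vitali_covering_theorem_balls[of U ?K fst snd])
      fix x :: 'a and h :: real assume x: "x \<in> U" "0 < h"
      obtain k where k: "k > 0" "cball x k \<subseteq> U" using U x open_contains_cball by blast
      have "cball x (min k (h/2)) \<subseteq> U" using k by (meson subset_cball min.cobounded1 order_trans)
      then show "\<exists>i. i \<in> ?K \<and> x \<in> ball (fst i) (snd i) \<and> snd i < h"
        using k x by (intro exI[of _ "(x, min k (h/2))"]) auto
    qed
    let ?b = "\<lambda>i. ball (fst i) (snd i)"
    define B where "B n = (if n \<in> to_nat_on I ` I then ?b (from_nat_into I n) else {})" for n
    have fi: "from_nat_into I (to_nat_on I i) = i" if "i \<in> I" for i using I(1) that by simp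
    have Bdisj: "B m \<inter> B n = {}" if "m \<noteq> n" for m n
    proof (cases "m \<in> to_nat_on I ` I \<and> n \<in> to_nat_on I ` I")
      case True
      then obtain i j where ij: "i \<in> I" "j \<in> I" "m = to_nat_on I i" "n = to_nat_on I j" by auto
      then have "i \<noteq> j" using that by auto
      then show ?thesis using I(3) ij fi by (auto simp: B_def pairwise_def disjnt_def)
    qed (auto simp: B_def)
    have BU: "(\<Union>n. B n) = (\<Union>i\<in>I. ?b i)"
    proof (intro equalityI subsetI)
      fix x assume "x \<in> (\<Union>i\<in>I. ?b i)"
      then obtain i where "i \<in> I" "x \<in> ?b i" by auto
      then have "x \<in> B (to_nat_on I i)" by (simp add: B_def fi)
      then show "x \<in> (\<Union>n. B n)" by blast
    qed (use fi in \<open>auto simp: B_def split: if_splits\<close>)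
    have BM: "B n \<in> sets M" for n
    proof (cases "n \<in> to_nat_on I ` I")
      case True
      then obtain i where "i \<in> I" "n = to_nat_on I i" by auto
      then have "B n = ?b i" "?b i \<subseteq> \<Omega>" using I(2) U(3) ball_subset_cball by (auto simp: B_def fi) fastforce
      then show ?thesis using domain_lmeasurable(2) by (auto simp: sets_restrict_space_iff)
    qed (simp add: B_def)
    have Ble: "(\<integral>x. indicator (B n) x * f x \<partial>M) \<le> 0" for n
    proof (cases "n \<in> to_nat_on I ` I")
      case True
      then obtain i where i: "i \<in> I" "n = to_nat_on I i" by auto
      then show ?thesis using le[of "snd i" "fst i"] I(2) U(3) by (auto simp: B_def fi)
    qed (simp add: B_def)
    have "(\<lambda>n. \<integral>x. (\<Sum>k<n. indicator (B k) x * f x) \<partial>M) \<longlonglongrightarrow> (\<integral>x. indicator (\<Union>n. B n) x * f x \<partial>M)"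
    proof (rule integral_dominated_convergence[where w="\<lambda>_. C"])
      show "(\<lambda>x. indicator (\<Union>n. B n) x * f x) \<in> borel_measurable M" using f BM by measurable
      show "(\<lambda>x. \<Sum>k<n. indicator (B k) x * f x) \<in> borel_measurable M" for n using f BM by measurable
      show "integrable M (\<lambda>_. C)" using finite_measure_M by (simp add: finite_measure.integrable_const)
      have part: "(\<Sum>k<n. indicator (B k) x * f x) = indicator (\<Union>k<n. B k) x * f x" for n x
      proof -
        have "disjoint_family_on B {..<n}" using Bdisj by (auto simp: disjoint_family_on_def)
        then have "(\<Sum>k<n. indicator (B k) x) = (indicator (\<Union>k<n. B k) x :: real)"
          by (simp add: indicator_UN_disjoint)
        then show ?thesis by (simp add: sum_distrib_right[symmetric])
      qed
      show "AE x in M. norm (\<Sum>k<n. indicator (B k) x * f x) \<le> C" for n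
        unfolding part using C(1) by eventually_elim (use C in \<open>auto simp: indicator_def\<close>)
      show "AE x in M. (\<lambda>n. \<Sum>k<n. indicator (B k) x * f x) \<longlonglongrightarrow> indicator (\<Union>n. B n) x * f x"
      proof (rule AE_I2)
        fix x
        have "\<forall>\<^sub>F n in sequentially. indicator (\<Union>k<n. B k) x = (indicator (\<Union>n. B n) x :: real)"
        proof (cases "x \<in> (\<Union>n. B n)")
          case True
          then obtain k where "x \<in> B k" by auto
          then have "\<forall>n>k. x \<in> (\<Union>k<n. B k)" by auto
          then show ?thesis using True unfolding eventually_sequentially
            by (intro exI[of _ "Suc k"]) (auto simp: indicator_def)
        qed (auto simp: indicator_def)
        then show "(\<lambda>n. \<Sum>k<n. indicator (B k) x * f x) \<longlonglongrightarrow> indicator (\<Union>n. B n) x * f x"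
          unfolding part by (intro tendsto_intros tendsto_eventually)
      qed
    qed
    moreover have "(\<integral>x. (\<Sum>k<n. indicator (B k) x * f x) \<partial>M) \<le> 0" for n
      using intA[OF BM] Ble by (subst Bochner_Integration.integral_sum) (auto intro!: sum_nonpos)
    ultimately have UB0: "(\<integral>x. indicator (\<Union>n. B n) x * f x \<partial>M) \<le> 0"
      by (intro LIMSEQ_le_const2) auto
    have "U - (\<Union>n. B n) \<in> null_sets M"
      using I(4) U(3) domain_lmeasurable(2) by (auto simp: BU negligible_iff_null_sets null_sets_restrict_space)
    then have "AE x in M. x \<notin> U - (\<Union>n. B n)" by (rule AE_not_in)
    moreover have "(\<Union>n. B n) \<subseteq> U" unfolding BU using I(2) ball_subset_cball by fastforce
    ultimately have "AE x in M. indicator U x * f x = indicator (\<Union>n. B n) x * f x"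
      by (auto elim!: eventually_mono simp: indicator_def)
    then have "(\<integral>x. indicator U x * f x \<partial>M) = (\<integral>x. indicator (\<Union>n. B n) x * f x \<partial>M)"
      using BM by (intro integral_cong_AE borel_measurable_integrable intA US sets.countable_UN) auto
    with UB0 have U0: "(\<integral>x. indicator U x * f x \<partial>M) \<le> 0" by simp
    have UE: "U - E \<in> sets M" using US E by auto
    have "(\<integral>x. indicator E x * f x \<partial>M) = (\<integral>x. indicator U x * f x - indicator (U - E) x * f x \<partial>M)"
      using U(2) by (intro Bochner_Integration.integral_cong) (auto simp: indicator_def)
    also have "\<dots> = (\<integral>x. indicator U x * f x \<partial>M) - (\<integral>x. indicator (U - E) x * f x \<partial>M)"
      using intA[OF US] intA[OF UE] by (rule Bochner_Integration.integral_diff)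
    also have "\<dots> \<le> - (\<integral>x. indicator (U - E) x * f x \<partial>M)" using U0 by simp
    also have "\<dots> = (\<integral>x. - (indicator (U - E) x * f x) \<partial>M)" by simp
    also have "\<dots> \<le> (\<integral>x. C * indicator (U - E) x \<partial>M)"
    proof (rule integral_mono_AE)
      show "integrable M (\<lambda>x. - (indicator (U - E) x * f x))" using intA[OF UE] by simp
      show "integrable M (\<lambda>x. C * indicator (U - E) x)"
        using UE finite_measure.emeasure_finite[OF finite_measure_M, of "U - E"]
        by (intro integrable_mult_right) (simp add: less_top)
      show "AE x in M. - (indicator (U - E) x * f x) \<le> C * indicator (U - E) x"
        using C(1) by eventually_elim (auto simp: indicator_def)
    qed
    also have "\<dots> = C * measure M (U - E)"
    proof -
      have "(U - E) \<inter> \<Omega> = U - E" using U(3) by blast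
      then show ?thesis using UE by simp
    qed
    also have "measure M (U - E) = measure lebesgue (U - E)"
      using U(3) domain_lmeasurable(2) by (intro measure_restrict_space) auto
    also have "measure lebesgue (U - E) \<le> measure lebesgue (T - E)"
      using T U E El by (intro measure_mono_fmeasurable) (auto simp: U_def)
    also have "measure lebesgue (T - E) \<le> e / (C + 1)"
      using T(4) e C(2) emeasure_eq_measure2[OF T(3)] by (simp add: ennreal_less_iff)
    finally have "(\<integral>x. indicator E x * f x \<partial>M) \<le> C * (e / (C + 1))" using C(2) by (simp add: mult_left_mono)
    also have "\<dots> \<le> e" using C(2) e by (simp add: field_simps)
    finally show ?thesis by simp
  qed
  have le0: "(\<integral>x. indicator E x * f x \<partial>M) \<le> 0" by (rule field_le_epsilon) (rule *)
  have nn: "AE x in M. 0 \<le> indicator E x * f x" by (rule AE_I2) (auto simp: E_def indicator_def)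
  then have "(\<integral>x. indicator E x * f x \<partial>M) = 0" using le0 integral_nonneg_AE[OF nn] by linarith
  then have "AE x in M. indicator E x * f x = 0"
    using integral_nonneg_eq_0_iff_AE[OF intA[OF E] nn] by simp
  then show ?thesis
    by (rule AE_mp) (rule AE_I2, auto simp: E_def indicator_def not_less)
qed

lemma compact_margin:
  assumes "compact K" "K \<subseteq> \<Omega>"
  obtains d where "d > 0" "\<And>x y. x \<in> K \<Longrightarrow> norm y < d \<Longrightarrow> x + y \<in> \<Omega>"
proof -
  obtain d where d: "d > 0" "(\<Union>x\<in>K. ball x d) \<subseteq> \<Omega>"
    using compact_subset_open_imp_ball_epsilon_subset[OF assms(1) \<Omega>(1) assms(2)] by metis
  show ?thesis
  proof (rule that[OF d(1)])
    fix x y :: 'a assume "x \<in> K" "norm y < d"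
    then have "x + y \<in> ball x d" by (simp add: dist_norm)
    then show "x + y \<in> \<Omega>" using d(2) \<open>x \<in> K\<close> by blast
  qed
qed

lemma lipschitz_bounded:
  assumes L: "L \<ge> 0" and lip: "\<And>x y. x \<in> \<Omega> \<Longrightarrow> y \<in> \<Omega> \<Longrightarrow> \<bar>u x - u y\<bar> \<le> L * norm (x - y)"
  obtains C where "\<And>x. x \<in> \<Omega> \<Longrightarrow> \<bar>u x\<bar> \<le> C"
proof (cases "\<Omega> = {}")
  case False
  then obtain c where c: "c \<in> \<Omega>" by auto
  obtain R where R: "\<And>x y. x \<in> \<Omega> \<Longrightarrow> y \<in> \<Omega> \<Longrightarrow> norm (x - y) \<le> R" using \<Omega>(2) bounded_two_points by (metis dist_norm)
  have "\<bar>u x\<bar> \<le> \<bar>u c\<bar> + L * R" if "x \<in> \<Omega>" for x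
    using lip[OF that c] mult_left_mono[OF R[OF that c] L] by linarith
  then show ?thesis using that by blast
qed (use that in auto)

lemma bump_integrable: "integrable M (bump c \<rho> n)" "bump c \<rho> n \<in> borel_measurable M"
proof -
  have "smooth_elementary (bump c \<rho> n)" unfolding bump_def[abs_def] by (rule smooth_elementary.flat)
  then have "k_times_cont_diff 0 (bump c \<rho> n)" by (rule smooth_elementary_k_times_cont_diff)
  then show m: "bump c \<rho> n \<in> borel_measurable M" using continuous_measurable by simp
  show "integrable M (bump c \<rho> n)"
    using bump_bounds[of c \<rho> n] by (intro integrable_bounded[OF m, of 1] AE_I2) auto
qed

text \<open>The difference quotient is shifted from the bump to \<open>u\<close>, where the
  Lipschitz bound controls it. The support of the bump is compact in \<Omega>, so small shifts do
  not leave \<Omega>.\<close>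

lemma directional_bound_of_lipschitz:
  assumes g: "is_Linf_weak_gradient \<Omega> u g" and L: "L \<ge> 0"
    and lip: "\<And>x y. x \<in> \<Omega> \<Longrightarrow> y \<in> \<Omega> \<Longrightarrow> \<bar>u x - u y\<bar> \<le> L * norm (x - y)"
    and \<rho>: "\<rho> > 0" "cball c \<rho> \<subseteq> \<Omega>"
  shows "(\<integral>x. (g x \<bullet> v) * bump c \<rho> n x \<partial>M) \<le> (\<integral>x. L * norm v * bump c \<rho> n x \<partial>M)"
proof -
  let ?\<phi> = "bump c \<rho> n"
  have \<phi>: "?\<phi> \<in> test_functions \<Omega>" by (rule bump_test_function[OF \<rho>])
  have uL: "u \<in> Linf M" using g by (simp add: is_Linf_weak_gradient_def)
  obtain C where C: "C \<ge> 0" "AE x in M. norm (u x) \<le> C" and um: "u \<in> borel_measurable M" using Linf_bound[OF uL] by metis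
  obtain d where d: "d > 0" "\<And>x y. x \<in> cball c \<rho> \<Longrightarrow> norm y < d \<Longrightarrow> x + y \<in> \<Omega>" using compact_margin[OF compact_cball \<rho>(2)] by metis
  \<comment> \<open>Step sizes with \<open>norm (h k *\<^sub>R v) < d\<close>; the
    \<open>+ 1\<close> covers \<open>v = 0\<close>.\<close>
  define h where "h k = d / (norm v + 1) * inverse (real (Suc k))" for k
  have nv: "norm v + 1 > 0" by (simp add: add_nonneg_pos)
  have h0: "h \<longlonglongrightarrow> 0" unfolding h_def using tendsto_mult_left[OF LIMSEQ_inverse_real_of_nat, of "d / (norm v + 1)"] by simp
  have hp: "h k > 0" for k using d nv by (simp add: h_def)
  have hd: "norm (h k *\<^sub>R v) < d" for k
  proof -
    have "inverse (real (Suc k)) \<le> 1" by (simp add: inverse_le_1_iff)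
    then have "h k \<le> d / (norm v + 1) * 1" unfolding h_def using d(1) nv by (intro mult_left_mono) auto
    then have "h k \<le> d / (norm v + 1)" by simp
    then have "h k * norm v \<le> d / (norm v + 1) * norm v" by (intro mult_right_mono) auto
    also have "\<dots> < d" using d nv by (simp add: field_simps)
    finally show ?thesis using hp[of k] by simp
  qed
  let ?u = "\<lambda>x. indicator \<Omega> x * u x"
  have i: "integrable M (\<lambda>x. ?u (x + a) * ?\<phi> x)" for a
  proof -
    have mu: "(\<lambda>x. ?u (x + a)) \<in> borel_measurable M"
      using integral_lebesgue_translation(2)[OF measurable_extend[OF um]] by (rule measurable_restrict_space1)
    obtain D where D: "\<And>x. x \<in> \<Omega> \<Longrightarrow> \<bar>u x\<bar> \<le> D" using lipschitz_bounded[OF L lip] by metis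
    show ?thesis
    proof (rule integrable_bounded)
      show "(\<lambda>x. ?u (x + a) * ?\<phi> x) \<in> borel_measurable M" using mu bump_integrable(2) by (rule borel_measurable_times)
      have "\<bar>?u (x + a) * ?\<phi> x\<bar> \<le> \<bar>D\<bar> * 1" for x
        unfolding abs_mult using D[of "x + a"] bump_bounds[of c \<rho> n x]
        by (intro mult_mono) (auto simp: indicator_def)
      then show "AE x in M. \<bar>?u (x + a) * ?\<phi> x\<bar> \<le> \<bar>D\<bar> * 1" by simp
    qed
  qed
  have "(\<lambda>k. ((\<integral>x. u x * ?\<phi> (x - h k *\<^sub>R v) \<partial>M) - (\<integral>x. u x * ?\<phi> x \<partial>M)) / h k)
     \<longlonglongrightarrow> - (\<integral>x. u x * frechet_derivative ?\<phi> (at x) v \<partial>M)"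
    using hp by (intro difference_quotient_integral_tendsto[OF uL \<phi> h0]) (metis less_irrefl)
  moreover have "((\<integral>x. u x * ?\<phi> (x - h k *\<^sub>R v) \<partial>M) - (\<integral>x. u x * ?\<phi> x \<partial>M)) / h k \<le> (\<integral>x. L * norm v * ?\<phi> x \<partial>M)" for k
  proof -
    have z: "?\<phi> x = 0" if "x \<notin> \<Omega>" for x
      using bump_eq_0_iff[OF \<rho>(1), of c n x] that \<rho>(2) ball_subset_cball by blast
    have "(\<integral>x. u x * ?\<phi> (x - h k *\<^sub>R v) \<partial>M) - (\<integral>x. u x * ?\<phi> x \<partial>M)
      = (\<integral>x. ?u (x + h k *\<^sub>R v) * ?\<phi> x \<partial>M) - (\<integral>x. ?u (x + 0) * ?\<phi> x \<partial>M)"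
      using integral_translate[OF um test_function_continuous[OF \<phi>] z, of "h k *\<^sub>R v"]
        integral_translate[OF um test_function_continuous[OF \<phi>] z, of 0] by simp
    also have "\<dots> = (\<integral>x. ?u (x + h k *\<^sub>R v) * ?\<phi> x - ?u (x + 0) * ?\<phi> x \<partial>M)"
      by (rule Bochner_Integration.integral_diff[OF i i, symmetric])
    also have "\<dots> \<le> (\<integral>x. h k * (L * norm v * ?\<phi> x) \<partial>M)"
    proof (rule integral_mono)
      show "integrable M (\<lambda>x. ?u (x + h k *\<^sub>R v) * ?\<phi> x - ?u (x + 0) * ?\<phi> x)" by (intro Bochner_Integration.integrable_diff i)
      show "integrable M (\<lambda>x. h k * (L * norm v * ?\<phi> x))" using bump_integrable(1) by (intro integrable_mult_right)
      fix x
      show "?u (x + h k *\<^sub>R v) * ?\<phi> x - ?u (x + 0) * ?\<phi> x \<le> h k * (L * norm v * ?\<phi> x)"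
      proof (cases "x \<in> ball c \<rho>")
        case True
        then have xx: "x \<in> \<Omega>" "x + h k *\<^sub>R v \<in> \<Omega>" using d(2)[of x "h k *\<^sub>R v"] hd[of k] \<rho>(2) by auto
        then have "?u (x + h k *\<^sub>R v) - ?u (x + 0) \<le> L * norm (h k *\<^sub>R v)"
          using lip[OF xx(2,1)] by simp
        then have "(?u (x + h k *\<^sub>R v) - ?u (x + 0)) * ?\<phi> x \<le> (L * norm (h k *\<^sub>R v)) * ?\<phi> x"
          using bump_bounds by (intro mult_right_mono) auto
        then show ?thesis using hp[of k] by (simp add: algebra_simps)
      next
        case False
        then show ?thesis using bump_eq_0_iff[OF \<rho>(1), of c n x] by simp
      qed
    qed
    also have "\<dots> = h k * (\<integral>x. L * norm v * ?\<phi> x \<partial>M)" by (rule integral_mult_right_zero)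
    finally show ?thesis using hp[of k] by (simp add: field_simps)
  qed
  ultimately have "- (\<integral>x. u x * frechet_derivative ?\<phi> (at x) v \<partial>M) \<le> (\<integral>x. L * norm v * ?\<phi> x \<partial>M)"
    by (intro LIMSEQ_le_const2) auto
  then show ?thesis using weak_gradient_direction(1)[OF g \<phi>, of v] by simp
qed

text \<open>Letting the bumps tend to indicators of balls gives
  \<open>g x \<bullet> v \<le> L * norm v\<close> almost everywhere for each fixed \<open>v\<close>.
  A countable dense set of directions allows a single exceptional null set.\<close>

lemma weak_gradient_bound_of_lipschitz:
  assumes g: "is_Linf_weak_gradient \<Omega> u g" and L: "L \<ge> 0"
    and lip: "\<And>x y. x \<in> \<Omega> \<Longrightarrow> y \<in> \<Omega> \<Longrightarrow> \<bar>u x - u y\<bar> \<le> L * norm (x - y)"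
  shows "AE x in M. norm (g x) \<le> L"
proof -
  have gL: "g \<in> Linf M" using g by (auto simp: is_Linf_weak_gradient_def)
  obtain G where G: "G \<ge> 0" "AE x in M. norm (g x) \<le> G" and gm: "g \<in> borel_measurable M" using Linf_bound[OF gL] by metis
  have dir: "AE x in M. g x \<bullet> v - L * norm v \<le> 0" for v
  proof (rule AE_nonpos_of_balls)
    let ?f = "\<lambda>x. g x \<bullet> v - L * norm v"
    show fm: "?f \<in> borel_measurable M" using gm by (intro borel_measurable_diff borel_measurable_inner) auto
    show fb: "AE x in M. \<bar>?f x\<bar> \<le> G * norm v + L * norm v"
      using G(2)
    proof eventually_elim
      fix x assume x: "norm (g x) \<le> G"
      have "\<bar>g x \<bullet> v\<bar> \<le> norm (g x) * norm v" by (rule Cauchy_Schwarz_ineq2)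
      also have "\<dots> \<le> G * norm v" using x by (intro mult_right_mono) auto
      finally show "\<bar>?f x\<bar> \<le> G * norm v + L * norm v" using mult_nonneg_nonneg[OF L norm_ge_zero[of v]] by linarith
    qed
    show "0 \<le> G * norm v + L * norm v" using G L by simp
    fix c r assume r: "(r::real) > 0" "cball c r \<subseteq> \<Omega>"
    have "(\<lambda>n. \<integral>x. bump c r n x * ?f x \<partial>M) \<longlonglongrightarrow> (\<integral>x. indicator (ball c r) x * ?f x \<partial>M)"
    proof (rule integral_dominated_convergence[where w="\<lambda>_. G * norm v + L * norm v"])
      have "ball c r \<in> sets M" using r domain_lmeasurable(2) ball_subset_cball by (auto simp: sets_restrict_space_iff)
      then show "(\<lambda>x. indicator (ball c r) x * ?f x) \<in> borel_measurable M" using fm by measurable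
      show "(\<lambda>x. bump c r n x * ?f x) \<in> borel_measurable M" for n using fm bump_integrable(2) by (intro borel_measurable_times)
      show "integrable M (\<lambda>_. G * norm v + L * norm v)" using finite_measure_M by (simp add: finite_measure.integrable_const)
      show "AE x in M. (\<lambda>n. bump c r n x * ?f x) \<longlonglongrightarrow> indicator (ball c r) x * ?f x"
        by (intro AE_I2 tendsto_intros bump_tendsto_indicator r)
      show "AE x in M. norm (bump c r n x * ?f x) \<le> G * norm v + L * norm v" for n
        using fb
      proof eventually_elim
        fix x assume "\<bar>?f x\<bar> \<le> G * norm v + L * norm v"
        then have "\<bar>bump c r n x\<bar> * \<bar>?f x\<bar> \<le> 1 * (G * norm v + L * norm v)"
          using bump_bounds[of c r n x] by (intro mult_mono) auto
        then show "norm (bump c r n x * ?f x) \<le> G * norm v + L * norm v" by (simp add: abs_mult)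
      qed
    qed
    moreover have "(\<integral>x. bump c r n x * ?f x \<partial>M) \<le> 0" for n
    proof -
      have "(\<integral>x. bump c r n x * ?f x \<partial>M) = (\<integral>x. (g x \<bullet> v) * bump c r n x - L * norm v * bump c r n x \<partial>M)"
        by (intro Bochner_Integration.integral_cong) (auto simp: algebra_simps)
      also have "\<dots> = (\<integral>x. (g x \<bullet> v) * bump c r n x \<partial>M) - (\<integral>x. L * norm v * bump c r n x \<partial>M)"
        by (intro Bochner_Integration.integral_diff weak_gradient_direction(2)[OF g bump_test_function[OF r]] integrable_mult_right bump_integrable)
      also have "\<dots> \<le> 0" using directional_bound_of_lipschitz[OF g L lip r] by simp
      finally show ?thesis .
    qed
    ultimately show "(\<integral>x. indicator (ball c r) x * ?f x \<partial>M) \<le> 0" by (intro LIMSEQ_le_const2) auto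
  qed
  obtain D :: "'a set" where D: "countable D" "\<And>X. open X \<Longrightarrow> X \<noteq> {} \<Longrightarrow> \<exists>d\<in>D. d \<in> X"
    using countable_dense_exists by blast
  have "AE x in M. \<forall>d\<in>D. g x \<bullet> d - L * norm d \<le> 0"
    using D(1) dir by (simp add: AE_ball_countable)
  then show ?thesis
  proof eventually_elim
    fix x assume x: "\<forall>d\<in>D. g x \<bullet> d - L * norm d \<le> 0"
    show "norm (g x) \<le> L"
    proof (rule ccontr)
      assume "\<not> ?thesis"
      then have *: "L < norm (g x)" by simp
      \<comment> \<open>If \<open>norm (g x)\<close> exceeded \<open>L\<close>, the direction
        \<open>g x\<close> would violate the bound, and so would all directions near it, one of
        which is in \<open>D\<close>.\<close>
      have "open {w. g x \<bullet> w > L * norm w}" by (intro open_Collect_less continuous_intros)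
      moreover have "L * norm (g x) < norm (g x) * norm (g x)" using * L by (intro mult_strict_right_mono) auto
      then have "g x \<in> {w. g x \<bullet> w > L * norm w}" by (simp add: dot_square_norm power2_eq_square)
      ultimately obtain d where "d \<in> D" "g x \<bullet> d > L * norm d" using D(2) by (metis (no_types, lifting) empty_iff mem_Collect_eq)
      then show False using x by force
    qed
  qed
qed

text \<open>The mass of the bump is independent of its centre as long as the closed ball stays in
  \<Omega>; it serves to normalize averages taken along a segment.\<close>

lemma bump_integral:
  assumes "\<rho> > 0" "cball c \<rho> \<subseteq> \<Omega>"
  shows "(\<integral>x. bump c \<rho> n x \<partial>M) = (\<integral>x. bump (0::'a) \<rho> n x \<partial>lebesgue)" "(\<integral>x. bump c \<rho> n x \<partial>M) > 0"
proof -
  have z: "bump c \<rho> n x = 0" if "x \<notin> \<Omega>" for x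
    using bump_eq_0_iff[OF assms(1), of c n x] that assms(2) ball_subset_cball by blast
  have "smooth_elementary (bump c \<rho> n)" unfolding bump_def[abs_def] by (rule smooth_elementary.flat)
  then have "k_times_cont_diff 0 (bump c \<rho> n)" by (rule smooth_elementary_k_times_cont_diff)
  then have m: "bump c \<rho> n \<in> borel_measurable lebesgue"
    by (simp add: borel_measurable_continuous_onI measurable_completion)
  have "(\<integral>x. bump c \<rho> n x \<partial>M) = (\<integral>x. bump c \<rho> n x \<partial>lebesgue)"
    unfolding integral_M using z by (intro Bochner_Integration.integral_cong) (auto simp: indicator_def)
  also have "\<dots> = (\<integral>x. bump c \<rho> n (x + c) \<partial>lebesgue)" by (rule integral_lebesgue_translation(1)[OF m, symmetric])
  also have "\<dots> = (\<integral>x. bump (0::'a) \<rho> n x \<partial>lebesgue)" by (simp add: bump_def)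
  finally show "(\<integral>x. bump c \<rho> n x \<partial>M) = (\<integral>x. bump (0::'a) \<rho> n x \<partial>lebesgue)" .
  have nn: "AE x in M. 0 \<le> bump c \<rho> n x" by (rule AE_I2) (rule bump_bounds)
  show "(\<integral>x. bump c \<rho> n x \<partial>M) > 0"
  proof (rule ccontr)
    assume "\<not> ?thesis"
    then have "(\<integral>x. bump c \<rho> n x \<partial>M) = 0" using integral_nonneg_AE[OF nn] by linarith
    then have "AE x in M. bump c \<rho> n x = 0" using integral_nonneg_eq_0_iff_AE[OF bump_integrable(1) nn] by simp
    then have "AE x in M. x \<notin> ball c \<rho>" using bump_eq_0_iff[OF assms(1), of c n] by simp
    then have "AE x in lebesgue. x \<in> \<Omega> \<longrightarrow> x \<notin> ball c \<rho>" using domain_lmeasurable(2) by (simp add: AE_restrict_space_iff)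
    then have "AE x in lebesgue. x \<notin> ball c \<rho>" by eventually_elim (use assms(2) ball_subset_cball in blast)
    then have "negligible (ball c \<rho>)" by (simp add: negligible_iff_null_sets AE_iff_null_sets del: mem_ball)
    then show False using assms(1) open_not_negligible[of "ball c \<rho>"] by simp
  qed
qed

text \<open>The average of \<open>u\<close> over a bump travelling from \<open>x\<close> to
  \<open>y\<close> is differentiable in time, with derivative the integral of
  \<open>g z \<bullet> v\<close> against the bump. The mean value theorem bounds the change of the
  average; for a small radius, continuity makes the averages close to \<open>u x\<close> and
  \<open>u y\<close>.\<close>

lemma lipschitz_of_weak_gradient_bound_aux:
  assumes g: "is_Linf_weak_gradient \<Omega> u g" and cvx: "convex \<Omega>" and cont: "continuous_on \<Omega> u"
    and L: "L \<ge> 0" "AE x in M. norm (g x) \<le> L" and xy: "x \<in> \<Omega>" "y \<in> \<Omega>"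
  shows "u y - u x \<le> L * norm (y - x)"
proof -
  have uL: "u \<in> Linf M" using g by (simp add: is_Linf_weak_gradient_def)
  obtain C where C: "C \<ge> 0" "AE x in M. norm (u x) \<le> C" and um: "u \<in> borel_measurable M" using Linf_bound[OF uL] by metis
  define v where "v = y - x"
  have "u y - u x \<le> L * norm v + e" if e: "e > 0" for e
  proof -
    have near: "\<exists>r>0. cball z r \<subseteq> \<Omega> \<and> (\<forall>w\<in>cball z r. \<bar>u w - u z\<bar> \<le> e/2)" if z: "z \<in> \<Omega>" for z
    proof -
      obtain r1 where r1: "r1 > 0" "cball z r1 \<subseteq> \<Omega>" using \<Omega>(1) z open_contains_cball by blast
      obtain r2 where r2: "r2 > 0" "\<And>w. w \<in> \<Omega> \<Longrightarrow> dist w z < r2 \<Longrightarrow> dist (u w) (u z) < e/2"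
        using cont z e unfolding continuous_on_iff by (metis half_gt_zero)
      show ?thesis
      proof (intro exI[of _ "min r1 (r2/2)"] conjI ballI)
        show "cball z (min r1 (r2/2)) \<subseteq> \<Omega>" using r1 by (meson subset_cball min.cobounded1 order_trans)
        fix w assume w: "w \<in> cball z (min r1 (r2/2))"
        then have "w \<in> \<Omega>" "dist w z < r2" using r1 r2 by (auto simp: dist_commute)
        then show "\<bar>u w - u z\<bar> \<le> e/2" using r2(2)[of w] by (simp add: dist_real_def)
      qed (use r1 r2 in auto)
    qed
    obtain r1 r2 where r: "r1 > 0" "cball x r1 \<subseteq> \<Omega>" "\<And>w. w \<in> cball x r1 \<Longrightarrow> \<bar>u w - u x\<bar> \<le> e/2"
      "r2 > 0" "cball y r2 \<subseteq> \<Omega>" "\<And>w. w \<in> cball y r2 \<Longrightarrow> \<bar>u w - u y\<bar> \<le> e/2"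
      using near[OF xy(1)] near[OF xy(2)] by metis
    define \<rho> where "\<rho> = min r1 r2"
    have \<rho>: "\<rho> > 0" "cball x \<rho> \<subseteq> cball x r1" "cball y \<rho> \<subseteq> cball y r2" using r by (auto simp: \<rho>_def)
    define c where "c t = x + t *\<^sub>R v" for t
    \<comment> \<open>Each point of the moving ball is a convex combination of the corresponding
      points of the balls around \<open>x\<close> and \<open>y\<close>.\<close>
    have cin: "cball (c t) \<rho> \<subseteq> \<Omega>" if t: "0 \<le> t" "t \<le> 1" for t
    proof
      fix z assume z: "z \<in> cball (c t) \<rho>"
      define w where "w = z - c t"
      have "norm w \<le> \<rho>" using z by (simp add: w_def dist_norm norm_minus_commute)
      then have "x + w \<in> cball x \<rho>" "y + w \<in> cball y \<rho>" by (auto simp: dist_norm)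
      then have "x + w \<in> \<Omega>" "y + w \<in> \<Omega>" using \<rho> r by blast+
      then have "(1 - t) *\<^sub>R (x + w) + t *\<^sub>R (y + w) \<in> \<Omega>" using cvx t by (intro convexD) auto
      moreover have "(1 - t) *\<^sub>R (x + w) + t *\<^sub>R (y + w) = z" by (simp add: w_def c_def v_def algebra_simps)
      ultimately show "z \<in> \<Omega>" by simp
    qed
    define W where "W t = (\<integral>z. u z * bump (c t) \<rho> 0 z \<partial>M)" for t
    define I where "I = (\<integral>x. bump (0::'a) \<rho> 0 x \<partial>lebesgue)"
    have I: "(\<integral>z. bump (c t) \<rho> 0 z \<partial>M) = I" if "0 \<le> t" "t \<le> 1" for t
      using bump_integral(1)[OF \<rho>(1) cin[OF that]] by (simp add: I_def)
    have Ipos: "I > 0" using bump_integral(2)[OF \<rho>(1) cin, of 0 0] I[of 0] by simp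
    have dW: "(W has_real_derivative (\<integral>z. (g z \<bullet> v) * bump (c t) \<rho> 0 z \<partial>M)) (at t)" if t: "0 \<le> t" "t \<le> 1" for t
      unfolding DERIV_def tendsto_at_iff_sequentially o_def
    proof (intro allI impI)
      fix h :: "nat \<Rightarrow> real" assume h: "\<forall>i. h i \<in> UNIV - {0}" "h \<longlonglongrightarrow> 0"
      have tf: "bump (c t) \<rho> 0 \<in> test_functions \<Omega>" by (rule bump_test_function[OF \<rho>(1) cin[OF t]])
      have "W (t + h n) = (\<integral>z. u z * bump (c t) \<rho> 0 (z - h n *\<^sub>R v) \<partial>M)" for n
        by (simp add: W_def bump_shift c_def algebra_simps)
      then show "(\<lambda>n. (W (t + h n) - W t) / h n) \<longlonglongrightarrow> (\<integral>z. (g z \<bullet> v) * bump (c t) \<rho> 0 z \<partial>M)"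
        using difference_quotient_integral_tendsto[OF uL tf h(2), of v] h(1) weak_gradient_direction(1)[OF g tf, of v]
        by (simp add: W_def)
    qed
    have dle: "(\<integral>z. (g z \<bullet> v) * bump (c t) \<rho> 0 z \<partial>M) \<le> L * norm v * I" if t: "0 \<le> t" "t \<le> 1" for t
    proof -
      have "(\<integral>z. (g z \<bullet> v) * bump (c t) \<rho> 0 z \<partial>M) \<le> (\<integral>z. (L * norm v) * bump (c t) \<rho> 0 z \<partial>M)"
      proof (rule integral_mono_AE)
        show "integrable M (\<lambda>z. (g z \<bullet> v) * bump (c t) \<rho> 0 z)"
          by (rule weak_gradient_direction(2)[OF g bump_test_function[OF \<rho>(1) cin[OF t]]])
        show "integrable M (\<lambda>z. (L * norm v) * bump (c t) \<rho> 0 z)" by (intro integrable_mult_right bump_integrable)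
        show "AE z in M. (g z \<bullet> v) * bump (c t) \<rho> 0 z \<le> (L * norm v) * bump (c t) \<rho> 0 z"
          using L(2)
        proof eventually_elim
          fix z assume "norm (g z) \<le> L"
          then have "g z \<bullet> v \<le> L * norm v"
            using norm_cauchy_schwarz[of "g z" v] mult_right_mono[of "norm (g z)" L "norm v"] by simp
          then show "(g z \<bullet> v) * bump (c t) \<rho> 0 z \<le> (L * norm v) * bump (c t) \<rho> 0 z"
            using bump_bounds by (intro mult_right_mono) auto
        qed
      qed
      also have "\<dots> = L * norm v * I" using I[OF t] by simp
      finally show ?thesis .
    qed
    obtain s where s: "0 < s" "s < 1" "W 1 - W 0 = (1 - 0) * (\<integral>z. (g z \<bullet> v) * bump (c s) \<rho> 0 z \<partial>M)"
      using MVT2[of 0 1 W "\<lambda>t. \<integral>z. (g z \<bullet> v) * bump (c t) \<rho> 0 z \<partial>M"] dW by auto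
    then have W10: "W 1 - W 0 \<le> L * norm v * I" using dle[of s] by simp
    have end_est: "\<bar>W t - u (c t) * I\<bar> \<le> e/2 * I" if t: "t = 0 \<or> t = 1" for t
    proof -
      have t01: "0 \<le> t" "t \<le> 1" using t by auto
      have b: "\<bar>u w - u (c t)\<bar> \<le> e/2" if "w \<in> cball (c t) \<rho>" for w
        using t that r(3)[of w] r(6)[of w] \<rho> by (auto simp: c_def v_def)
      have iu: "integrable M (\<lambda>z. u z * bump (c t) \<rho> 0 z)"
      proof (rule integrable_bounded)
        show "(\<lambda>z. u z * bump (c t) \<rho> 0 z) \<in> borel_measurable M" using um bump_integrable(2) by (rule borel_measurable_times)
        show "AE z in M. \<bar>u z * bump (c t) \<rho> 0 z\<bar> \<le> C * 1"
          using C(2)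
        proof eventually_elim
          fix z assume "norm (u z) \<le> C"
          then show "\<bar>u z * bump (c t) \<rho> 0 z\<bar> \<le> C * 1"
            unfolding abs_mult using bump_bounds[of "c t" \<rho> 0 z] C(1) by (intro mult_mono) auto
        qed
      qed
      have ic: "integrable M (\<lambda>z. u (c t) * bump (c t) \<rho> 0 z)" by (intro integrable_mult_right bump_integrable)
      have "W t - u (c t) * I = (\<integral>z. u z * bump (c t) \<rho> 0 z - u (c t) * bump (c t) \<rho> 0 z \<partial>M)"
        using Bochner_Integration.integral_diff[OF iu ic] I[OF t01] by (simp add: W_def)
      also have "\<bar>\<dots>\<bar> \<le> (\<integral>z. e/2 * bump (c t) \<rho> 0 z \<partial>M)"
      proof (rule integral_abs_bound_integral)
        show "integrable M (\<lambda>z. u z * bump (c t) \<rho> 0 z - u (c t) * bump (c t) \<rho> 0 z)" using iu ic by (rule Bochner_Integration.integrable_diff)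
        show "integrable M (\<lambda>z. e/2 * bump (c t) \<rho> 0 z)" by (intro integrable_mult_right bump_integrable)
        fix z
        show "\<bar>u z * bump (c t) \<rho> 0 z - u (c t) * bump (c t) \<rho> 0 z\<bar> \<le> e/2 * bump (c t) \<rho> 0 z"
        proof (cases "z \<in> ball (c t) \<rho>")
          case True
          then have "\<bar>u z - u (c t)\<bar> * bump (c t) \<rho> 0 z \<le> e/2 * bump (c t) \<rho> 0 z"
            using b[of z] bump_bounds by (intro mult_right_mono) auto
          then show ?thesis using bump_bounds(1)[of "c t" \<rho> 0 z] by (simp add: left_diff_distrib[symmetric] abs_mult)
        next
          case False
          then show ?thesis using bump_eq_0_iff[OF \<rho>(1), of "c t" 0 z] by simp
        qed
      qed
      also have "\<dots> = e/2 * I" using I[OF t01] by simp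
      finally show ?thesis .
    qed
    have "c 0 = x" "c 1 = y" by (auto simp: c_def v_def)
    then have "\<bar>W 0 - u x * I\<bar> \<le> e/2 * I" "\<bar>W 1 - u y * I\<bar> \<le> e/2 * I" using end_est[of 0] end_est[of 1] by auto
    moreover have "e/2 * I = (e * I) / 2" by simp
    ultimately have "u y * I - u x * I \<le> L * norm v * I + e * I" using W10 unfolding abs_le_iff by linarith
    then have "(u y - u x) * I \<le> (L * norm v + e) * I" by (simp add: algebra_simps)
    then show ?thesis using Ipos by simp
  qed
  then show ?thesis unfolding v_def by (rule field_le_epsilon)
qed

end

section \<open>The gradient norm and membership in W1inf\<close>

context
  fixes \<Omega> :: "'a::euclidean_space set"
  assumes \<Omega>: "open \<Omega>" "bounded \<Omega>"
begin

lemma lipschitz_of_weak_gradient_bound: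
  assumes "is_Linf_weak_gradient \<Omega> u g" "convex \<Omega>" "continuous_on \<Omega> u"
    and "L \<ge> 0" "AE x in lebesgue_on \<Omega>. norm (g x) \<le> L" and "x \<in> \<Omega>" "y \<in> \<Omega>"
  shows "\<bar>u x - u y\<bar> \<le> L * norm (x - y)"
  using lipschitz_of_weak_gradient_bound_aux[OF \<Omega> assms] lipschitz_of_weak_gradient_bound_aux[OF \<Omega> assms(1-5) assms(7,6)]
  by (simp add: abs_le_iff norm_minus_commute)

lemma grad_norm_properties:
  assumes ne: "\<Omega> \<noteq> {}" and u: "u \<in> W1inf \<Omega>" 
  shows "is_Linf_weak_gradient \<Omega> u (weak_gradient \<Omega> u)" "grad_norm \<Omega> u \<ge> 0"
    "L \<ge> 0 \<Longrightarrow> grad_norm \<Omega> u \<le> L \<longleftrightarrow> (AE x in lebesgue_on \<Omega>. norm (weak_gradient \<Omega> u x) \<le> L)"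
proof -
  let ?g = "weak_gradient \<Omega> u" and ?M = "lebesgue_on \<Omega>"
  show g: "is_Linf_weak_gradient \<Omega> u ?g"
    unfolding weak_gradient_def using u someI_ex[of "is_Linf_weak_gradient \<Omega> u"] by (auto simp: W1inf_def)
  then have gL: "?g \<in> Linf ?M" by (simp add: is_Linf_weak_gradient_def)
  then have gm: "?g \<in> borel_measurable ?M" by (simp add: Linf_def)
  let ?N = "Linf_norm ?M ?g"
  have le: "AE x in ?M. ereal (norm (?g x)) \<le> ?N" unfolding Linf_norm_def by (rule esssup_AE)
  \<comment> \<open>A negative essential supremum of norms would make the nonempty open set \<Omega>
    null.\<close>
  have N0: "?N \<ge> 0"
  proof (rule ccontr)
    assume neg: "\<not> ?N \<ge> 0"
    have "AE x in ?M. False"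
      using le
    proof eventually_elim
      fix x assume "ereal (norm (?g x)) \<le> ?N"
      moreover have "0 \<le> ereal (norm (?g x))" by simp
      ultimately show False using neg by (meson order_trans)
    qed
    moreover have "\<Omega> \<in> sets lebesgue" using \<Omega> by auto
    ultimately have "AE x in lebesgue. x \<notin> \<Omega>" by (simp add: AE_restrict_space_iff)
    then have "negligible \<Omega>" using \<Omega>(1) by (simp add: negligible_iff_null_sets AE_iff_null_sets)
    then show False using \<Omega>(1) ne open_not_negligible by blast
  qed
  moreover have "?N < \<infinity>" using gL by (simp add: Linf_def)
  ultimately obtain r where r: "?N = ereal r" "r \<ge> 0" by (cases ?N) auto
  have gn: "grad_norm \<Omega> u = r" by (simp add: grad_norm_def r)
  then show "grad_norm \<Omega> u \<ge> 0" using r by simp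
  show "grad_norm \<Omega> u \<le> L \<longleftrightarrow> (AE x in ?M. norm (?g x) \<le> L)" if L: "L \<ge> 0"
  proof
    assume "grad_norm \<Omega> u \<le> L"
    then have "?N \<le> ereal L" using gn r by simp
    note NL = this
    show "AE x in ?M. norm (?g x) \<le> L"
      using le
    proof eventually_elim
      fix x assume "ereal (norm (?g x)) \<le> ?N"
      from order_trans[OF this NL] show "norm (?g x) \<le> L" by simp
    qed
  next
    assume "AE x in ?M. norm (?g x) \<le> L"
    then have "?N \<le> ereal L" by (rule LinfI(2)[OF gm])
    then show "grad_norm \<Omega> u \<le> L" using gn r by simp
  qed
qed

lemma grad_norm_le_iff:
  assumes "\<Omega> \<noteq> {}" "convex \<Omega>" "u \<in> W1inf \<Omega>" "continuous_on \<Omega> u" "L \<ge> 0"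
  shows "grad_norm \<Omega> u \<le> L \<longleftrightarrow> (\<forall>x\<in>\<Omega>. \<forall>y\<in>\<Omega>. \<bar>u x - u y\<bar> \<le> L * norm (x - y))"
  using grad_norm_properties[OF assms(1,3)] lipschitz_of_weak_gradient_bound[OF _ assms(2,4,5)]
    weak_gradient_bound_of_lipschitz[OF \<Omega> _ assms(5)] assms(5) by metis

text \<open>Convexity makes the forward difference quotients decrease as the step shrinks, so they
  converge at every point; their limits are the components of the gradient. Dominated convergence
  turns the discrete integration by parts into the weak identity.\<close>

lemma convex_lipschitz_in_W1inf:
  fixes u :: "'a \<Rightarrow> real"
  assumes cvx: "convex_on \<Omega> u" and L: "L \<ge> 0"
    and lip: "\<And>x y. x \<in> \<Omega> \<Longrightarrow> y \<in> \<Omega> \<Longrightarrow> \<bar>u x - u y\<bar> \<le> L * norm (x - y)"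
  shows "u \<in> W1inf \<Omega>"
proof -
  let ?M = "lebesgue_on \<Omega>"
  have OS: "\<Omega> \<in> sets lebesgue" using \<Omega> by auto
  have "continuous_on \<Omega> u"
    by (rule lipschitz_on_continuous_on[of L], rule lipschitz_onI) (use lip L in \<open>auto simp: dist_norm\<close>)
  then have um: "u \<in> borel_measurable ?M" using OS by (rule continuous_imp_measurable_on_sets_lebesgue)
  obtain C where C: "\<And>x. x \<in> \<Omega> \<Longrightarrow> \<bar>u x\<bar> \<le> C" using lipschitz_bounded[OF \<Omega> L lip] by metis
  have uL: "u \<in> Linf ?M" using um C by (intro LinfI(1)[where C=C] AE_I2) auto
  define ue where "ue x = indicator \<Omega> x * u x" for x
  define q where "q n i x = (ue (x + (1 / real (Suc n)) *\<^sub>R i) - ue x) * real (Suc n)" for n i x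
  define D where "D i x = lim (\<lambda>n. q n i x)" for i x
  have ue: "ue x = u x" if "x \<in> \<Omega>" for x using that by (simp add: ue_def)
  have uem: "(\<lambda>x. ue (x + a)) \<in> borel_measurable ?M" for a
    using integral_lebesgue_translation(2)[OF measurable_extend[OF \<Omega> um]] unfolding ue_def by (rule measurable_restrict_space1)
  have qm: "q n i \<in> borel_measurable ?M" for n i
    unfolding q_def[abs_def] using uem[of "(1 / real (Suc n)) *\<^sub>R i"] uem[of 0] by simp
  have qb: "\<bar>q n i x\<bar> \<le> L" if "x \<in> \<Omega>" "x + (1 / real (Suc n)) *\<^sub>R i \<in> \<Omega>" "i \<in> Basis" for n i x
  proof -
    have "\<bar>ue (x + (1 / real (Suc n)) *\<^sub>R i) - ue x\<bar> \<le> L * (1 / real (Suc n))"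
      using lip[OF that(2,1)] that by (simp add: ue)
    then have "\<bar>ue (x + (1 / real (Suc n)) *\<^sub>R i) - ue x\<bar> * real (Suc n) \<le> L * (1 / real (Suc n)) * real (Suc n)"
      by (intro mult_right_mono) auto
    then show ?thesis by (simp add: q_def abs_mult)
  qed
  have small: "1 / real (Suc n) < d" if "d > 0" "n \<ge> nat \<lceil>1 / d\<rceil>" for d n
  proof -
    have "1 / d < real (Suc n)" using that by linarith
    then show ?thesis using that(1) by (simp add: field_simps)
  qed
  have conv: "(\<lambda>n. q n i x) \<longlonglongrightarrow> D i x" if x: "x \<in> \<Omega>" and i: "i \<in> Basis" for i x
  proof -
    obtain d where d: "d > 0" "\<And>y. norm y < d \<Longrightarrow> x + y \<in> \<Omega>"
      by (rule compact_margin[OF \<Omega>, of "{x}"]) (use x in auto)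
    define N where "N = nat \<lceil>1 / d\<rceil>"
    have ins: "x + (1 / real (Suc n)) *\<^sub>R i \<in> \<Omega>" if "n \<ge> N" for n
      using small[OF d(1), of n] that i by (intro d(2)) (auto simp: N_def)
    \<comment> \<open>The shorter step is the fraction \<theta> of the longer one, so this is
      convexity along the segment. From \<open>N\<close> on, both end points lie in
      \<Omega>.\<close>
    have "q (Suc n) i x \<le> q n i x" if n: "n \<ge> N" for n
    proof -
      let ?s = "1 / real (Suc n)" and ?t = "1 / real (Suc (Suc n))"
      define \<theta> where "\<theta> = real (Suc n) / real (Suc (Suc n))"
      have th: "0 \<le> \<theta>" "\<theta> \<le> 1" "\<theta> * ?s = ?t" by (auto simp: \<theta>_def field_simps)
      have "x + ?t *\<^sub>R i = (1 - \<theta>) *\<^sub>R x + \<theta> *\<^sub>R (x + ?s *\<^sub>R i)"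
        unfolding th(3)[symmetric] by (simp add: algebra_simps)
      then have "u (x + ?t *\<^sub>R i) \<le> (1 - \<theta>) * u x + \<theta> * u (x + ?s *\<^sub>R i)"
        using convex_onD[OF cvx th(1,2) x ins[OF n]] by simp
      then have "u (x + ?t *\<^sub>R i) - u x \<le> \<theta> * (u (x + ?s *\<^sub>R i) - u x)" by (simp add: algebra_simps)
      then have "(u (x + ?t *\<^sub>R i) - u x) * real (Suc (Suc n)) \<le> \<theta> * (u (x + ?s *\<^sub>R i) - u x) * real (Suc (Suc n))"
        by (intro mult_right_mono) auto
      also have "\<dots> = (u (x + ?s *\<^sub>R i) - u x) * real (Suc n)" by (simp add: \<theta>_def)
      finally show ?thesis using ins[OF n] ins[of "Suc n"] n x by (simp add: q_def ue)
    qed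
    then have "decseq (\<lambda>n. q (n + N) i x)" by (intro decseq_SucI) simp
    moreover have "-L \<le> q (n + N) i x" for n using qb[OF x ins i, of "n + N"] by (simp add: abs_le_iff)
    ultimately obtain l where "(\<lambda>n. q (n + N) i x) \<longlonglongrightarrow> l" using decseq_convergent by metis
    then have "(\<lambda>n. q n i x) \<longlonglongrightarrow> l" by (rule LIMSEQ_offset)
    then show ?thesis unfolding D_def using limI by metis
  qed
  have DL: "\<bar>D i x\<bar> \<le> L" if x: "x \<in> \<Omega>" and i: "i \<in> Basis" for i x
  proof (rule LIMSEQ_le_const2[OF tendsto_rabs[OF conv[OF x i]]])
    obtain d where d: "d > 0" "\<And>y. norm y < d \<Longrightarrow> x + y \<in> \<Omega>"
      by (rule compact_margin[OF \<Omega>, of "{x}"]) (use x in auto)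
    have "x + (1 / real (Suc n)) *\<^sub>R i \<in> \<Omega>" if "n \<ge> nat \<lceil>1 / d\<rceil>" for n
      using small[OF d(1), of n] that i by (intro d(2)) auto
    then show "\<exists>N. \<forall>n\<ge>N. \<bar>q n i x\<bar> \<le> L" using qb[OF x _ i] by blast
  qed
  have Dm: "D i \<in> borel_measurable ?M" for i
    unfolding D_def[abs_def] using qm by (intro borel_measurable_lim_metric)
  define g where "g x = (\<Sum>i\<in>Basis. D i x *\<^sub>R i)" for x
  have gi: "g x \<bullet> i = D i x" if "i \<in> Basis" for i x using that by (simp add: g_def inner_sum_left_Basis)
  have gm: "g \<in> borel_measurable ?M" unfolding g_def[abs_def] using Dm by simp
  have "norm (g x) \<le> real DIM('a) * L" if "x \<in> \<Omega>" for x
  proof -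
    have "norm (g x) \<le> (\<Sum>i\<in>Basis. norm (D i x *\<^sub>R i))" unfolding g_def by (rule norm_sum)
    also have "\<dots> \<le> (\<Sum>i\<in>(Basis::'a set). L)" using DL[OF that] by (intro sum_mono) simp
    finally show ?thesis by simp
  qed
  then have gL: "g \<in> Linf ?M" using gm by (intro LinfI(1)[where C="real DIM('a) * L"] AE_I2) auto
  have "is_Linf_weak_gradient \<Omega> u g"
    unfolding is_Linf_weak_gradient_def
  proof (intro conjI uL gL ballI)
    fix \<phi> :: "'a \<Rightarrow> real" and i :: 'a assume \<phi>: "\<phi> \<in> test_functions \<Omega>" and i: "i \<in> Basis"
    let ?K = "closure {x. \<phi> x \<noteq> 0}"
    have K: "compact ?K" "?K \<subseteq> \<Omega>" using \<phi> by (auto simp: test_functions_def)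
    obtain d where d: "d > 0" "\<And>x y. x \<in> ?K \<Longrightarrow> norm y < d \<Longrightarrow> x + y \<in> \<Omega>" using compact_margin[OF \<Omega> K] by metis
    define N where "N = nat \<lceil>1 / d\<rceil>"
    have ins: "x + (1 / real (Suc n)) *\<^sub>R i \<in> \<Omega>" if "n \<ge> N" "x \<in> ?K" for n x
      using small[OF d(1), of n] that i by (intro d(2)) (auto simp: N_def)
    obtain B where B: "\<And>x. \<bar>\<phi> x\<bar> \<le> B" using test_function_bounded[OF \<phi>] by metis
    have z: "\<phi> x = 0" if "x \<notin> \<Omega>" for x using test_function_support(1)[OF \<phi>, of x] K(2) that by blast
    have \<phi>m: "\<phi> \<in> borel_measurable ?M" by (rule continuous_measurable[OF \<Omega> test_function_continuous[OF \<phi>]])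
    have qB: "\<bar>q n i x * \<phi> x\<bar> \<le> L * B" if "n \<ge> N" "x \<in> \<Omega>" for n x
    proof (cases "x \<in> ?K")
      case True
      then show ?thesis unfolding abs_mult using qb[OF that(2) ins[OF that(1) True] i] B[of x] L by (intro mult_mono) auto
    next
      case False
      then show ?thesis using test_function_support(1)[OF \<phi>, of x] L B[of x] by simp
    qed
    have "(\<lambda>n. \<integral>x. q (n + N) i x * \<phi> x \<partial>?M) \<longlonglongrightarrow> (\<integral>x. D i x * \<phi> x \<partial>?M)"
    proof (rule integral_dominated_convergence[where w="\<lambda>_. L * B"])
      show "(\<lambda>x. D i x * \<phi> x) \<in> borel_measurable ?M" using Dm \<phi>m by (rule borel_measurable_times)
      show "(\<lambda>x. q (n + N) i x * \<phi> x) \<in> borel_measurable ?M" for n using qm \<phi>m by (rule borel_measurable_times)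
      show "integrable ?M (\<lambda>_. L * B)" using finite_measure_M[OF \<Omega>] by (simp add: finite_measure.integrable_const)
      show "AE x in ?M. (\<lambda>n. q (n + N) i x * \<phi> x) \<longlonglongrightarrow> D i x * \<phi> x"
        using conv[OF _ i] by (intro AE_I2 tendsto_intros LIMSEQ_ignore_initial_segment) auto
      show "AE x in ?M. norm (q (n + N) i x * \<phi> x) \<le> L * B" for n
        using qB[of "n + N"] by (intro AE_I2) auto
    qed
    then have lim1: "(\<lambda>n. \<integral>x. q n i x * \<phi> x \<partial>?M) \<longlonglongrightarrow> (\<integral>x. D i x * \<phi> x \<partial>?M)" by (rule LIMSEQ_offset)
    define h where "h n = 1 / real (Suc n)" for n
    have h: "h \<longlonglongrightarrow> 0" "\<And>n. h n \<noteq> 0"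
      using LIMSEQ_inverse_real_of_nat by (auto simp: h_def[abs_def] inverse_eq_divide)
    have qi: "((\<integral>x. u x * \<phi> (x - h n *\<^sub>R i) \<partial>?M) - (\<integral>x. u x * \<phi> x \<partial>?M)) / h n = (\<integral>x. q n i x * \<phi> x \<partial>?M)" for n
    proof -
      have ueb: "\<bar>ue y\<bar> \<le> \<bar>C\<bar>" for y using C[of y] by (auto simp: ue_def indicator_def)
      have i1: "integrable ?M (\<lambda>x. ue (x + a) * \<phi> x)" for a
      proof (rule integrable_bounded[OF \<Omega>])
        show "(\<lambda>x. ue (x + a) * \<phi> x) \<in> borel_measurable ?M" using uem \<phi>m by (rule borel_measurable_times)
        have "\<bar>ue (x + a) * \<phi> x\<bar> \<le> \<bar>C\<bar> * B" for x unfolding abs_mult using ueb B[of x] by (intro mult_mono) auto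
        then show "AE x in ?M. \<bar>ue (x + a) * \<phi> x\<bar> \<le> \<bar>C\<bar> * B" by simp
      qed
      have "(\<integral>x. u x * \<phi> (x - h n *\<^sub>R i) \<partial>?M) - (\<integral>x. u x * \<phi> x \<partial>?M)
         = (\<integral>x. ue (x + h n *\<^sub>R i) * \<phi> x \<partial>?M) - (\<integral>x. ue (x + 0) * \<phi> x \<partial>?M)"
        using integral_translate[OF \<Omega> um test_function_continuous[OF \<phi>] z, of "h n *\<^sub>R i"]
          integral_translate[OF \<Omega> um test_function_continuous[OF \<phi>] z, of 0] by (simp add: ue_def)
      also have "\<dots> = (\<integral>x. ue (x + h n *\<^sub>R i) * \<phi> x - ue (x + 0) * \<phi> x \<partial>?M)"
        by (rule Bochner_Integration.integral_diff[OF i1 i1, symmetric])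
      also have "(\<lambda>x. ue (x + h n *\<^sub>R i) * \<phi> x - ue (x + 0) * \<phi> x) = (\<lambda>x. h n * (q n i x * \<phi> x))"
      proof (rule ext)
        fix x
        have e1: "h n * (q n i x * \<phi> x) = (h n * real (Suc n)) * ((ue (x + h n *\<^sub>R i) - ue x) * \<phi> x)"
          unfolding q_def h_def by (simp only: mult_ac)
        have e2: "h n * real (Suc n) = 1" by (simp add: h_def)
        show "ue (x + h n *\<^sub>R i) * \<phi> x - ue (x + 0) * \<phi> x = h n * (q n i x * \<phi> x)"
          unfolding e1 e2 by (simp add: left_diff_distrib)
      qed
      also have "(\<integral>x. h n * (q n i x * \<phi> x) \<partial>?M) = h n * (\<integral>x. q n i x * \<phi> x \<partial>?M)" by (rule integral_mult_right_zero)
      finally show ?thesis using h(2)[of n] by simp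
    qed
    have "(\<lambda>n. \<integral>x. q n i x * \<phi> x \<partial>?M) \<longlonglongrightarrow> - (\<integral>x. u x * frechet_derivative \<phi> (at x) i \<partial>?M)"
      using difference_quotient_integral_tendsto[OF \<Omega> uL \<phi> h, of i] unfolding qi .
    then have "(\<integral>x. D i x * \<phi> x \<partial>?M) = - (\<integral>x. u x * frechet_derivative \<phi> (at x) i \<partial>?M)"
      using lim1 LIMSEQ_unique by blast
    then show "(\<integral>x. u x * frechet_derivative \<phi> (at x) i \<partial>?M) = - (\<integral>x. (g x \<bullet> i) * \<phi> x \<partial>?M)"
      using gi[OF i] by simp
  qed
  then show ?thesis by (auto simp: W1inf_def)
qed

end

section \<open>The minimization problem\<close>

context convex_domain
begin

lemma lipschitz_to_frontier:
  assumes u: "continuous_on (closure \<Omega>) u" and lip: "\<forall>x\<in>\<Omega>. \<forall>y\<in>\<Omega>. \<bar>u x - u y\<bar> \<le> L * norm (x - y)"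
    and x: "x \<in> \<Omega>" and y: "y \<in> closure \<Omega>"
  shows "\<bar>u x - u y\<bar> \<le> L * norm (x - y)"
proof -
  have "\<bar>u x - u y\<bar> - L * norm (x - y) \<le> 0"
    by (rule continuous_le_on_closure[of \<Omega> "\<lambda>y. \<bar>u x - u y\<bar> - L * norm (x - y)"])
       (use lip x y in \<open>auto intro!: continuous_intros u\<close>)
  then show ?thesis by simp
qed

text \<open>The Lipschitz bound is applied between \<open>x\<close> and its nearest frontier point,
  where \<open>u\<close> equals 1.\<close>

lemma Lip1_facts:
  assumes u: "u \<in> Lip1 \<Omega>"
  shows "grad_norm \<Omega> u \<ge> 0" "x \<in> closure \<Omega> \<Longrightarrow> 1 - grad_norm \<Omega> u * d x \<le> u x"
    "grad_norm \<Omega> u = 0 \<Longrightarrow> x \<in> closure \<Omega> \<Longrightarrow> u x = 1"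
proof -
  let ?L = "grad_norm \<Omega> u"
  have W: "u \<in> W1inf \<Omega>" and c: "continuous_on (closure \<Omega>) u" and f: "\<And>x. x \<in> frontier \<Omega> \<Longrightarrow> u x = 1"
    using u by (auto simp: Lip1_def)
  have c': "continuous_on \<Omega> u" using c closure_subset continuous_on_subset by blast
  show L0: "?L \<ge> 0" by (rule grad_norm_properties(2)[OF \<Omega>(2,3,1) W])
  then have lip: "\<forall>x\<in>\<Omega>. \<forall>y\<in>\<Omega>. \<bar>u x - u y\<bar> \<le> ?L * norm (x - y)"
    using grad_norm_le_iff[OF \<Omega>(2,3,1,4) W c' L0] by simp
  have near: "\<bar>u x - 1\<bar> \<le> ?L * d x" if x: "x \<in> closure \<Omega>" for x
  proof (cases "x \<in> \<Omega>")
    case True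
    obtain y where y: "y \<in> frontier \<Omega>" "d x = dist x y" using nearest_frontier by metis
    have "y \<in> closure \<Omega>" using y(1) closure_Un_frontier by blast
    from lipschitz_to_frontier[OF c lip True this] show ?thesis using y f[OF y(1)] by (simp add: dist_norm)
  next
    case False
    then have "x \<in> frontier \<Omega>" using x closure_Un_frontier by blast
    then show ?thesis using f L0 by simp
  qed
  show "x \<in> closure \<Omega> \<Longrightarrow> 1 - ?L * d x \<le> u x" using near[of x] by (simp add: abs_le_iff)
  show "?L = 0 \<Longrightarrow> x \<in> closure \<Omega> \<Longrightarrow> u x = 1" using near[of x] by simp
qed

lemma positivity_set_lmeasurable:
  assumes "u \<in> Lip1 \<Omega>"
  shows "open {x \<in> \<Omega>. u x > 0}" "{x \<in> \<Omega>. u x > 0} \<in> lmeasurable"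
proof -
  have "continuous_on \<Omega> u" using assms continuous_on_subset[OF _ closure_subset, of \<Omega> u] by (auto simp: Lip1_def)
  then have "open (u -` {0<..} \<inter> \<Omega>)" using \<Omega>(2) by (simp add: continuous_on_open_vimage)
  moreover have "u -` {0<..} \<inter> \<Omega> = {x \<in> \<Omega>. u x > 0}" by auto
  ultimately show o: "open {x \<in> \<Omega>. u x > 0}" by simp
  show "{x \<in> \<Omega>. u x > 0} \<in> lmeasurable"
    using o \<Omega>(3) by (intro lmeasurable_open) (auto intro: bounded_subset)
qed

lemma \<Omega>_lmeasurable: "\<Omega> \<in> lmeasurable"
  using \<Omega> by (intro lmeasurable_open)

lemma boundary_layer_eq:
  assumes "0 < r" "r < R"
  shows "boundary_layer \<Omega> r = {x \<in> \<Omega>. d x < r}"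
  unfolding boundary_layer_def closure_inner_set[OF assms] by (auto simp: K_def)

lemma vol_boundary_layer:
  assumes "0 < r" "r < R"
  shows "vol (boundary_layer \<Omega> r) = vol \<Omega> - V r"
proof -
  have "boundary_layer \<Omega> r = \<Omega> - K r" unfolding boundary_layer_def closure_inner_set[OF assms] ..
  then show ?thesis using \<Omega>_lmeasurable lmeasurable_compact[OF compact_K[OF assms(1)]] vol_K[OF assms] K_subset[of r]
    by (simp add: measurable_measure_Diff fmeasurableD)
qed

lemma one_Lip1: "(\<lambda>_. 1) \<in> Lip1 \<Omega>" and grad_norm_one: "grad_norm \<Omega> (\<lambda>_. 1) = 0"
  and J_one: "J \<Omega> \<Lambda> (\<lambda>_. 1) = \<Lambda> * vol \<Omega>"
proof -
  have W: "(\<lambda>_. 1) \<in> W1inf \<Omega>"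
    by (rule convex_lipschitz_in_W1inf[OF \<Omega>(2,3), of _ 0]) (use \<Omega>(4) in \<open>auto simp: convex_on_def\<close>)
  then show "(\<lambda>_. 1) \<in> Lip1 \<Omega>" by (simp add: Lip1_def)
  have "grad_norm \<Omega> (\<lambda>_. 1) \<le> 0"
    by (subst grad_norm_le_iff[OF \<Omega>(2,3,1,4) W]) auto
  then show g: "grad_norm \<Omega> (\<lambda>_. 1) = 0" using grad_norm_properties(2)[OF \<Omega>(2,3,1) W] by simp
  show "J \<Omega> \<Lambda> (\<lambda>_. 1) = \<Lambda> * vol \<Omega>" unfolding J_def g by simp
qed

text \<open>Concavity of the distance makes the cone function convex on \<Omega>, hence a member of
  \<open>W1inf\<close>. The upper bound for \<open>J\<close> is met by the lower bound in
  \<open>J_lower_bound\<close> when the radius is optimal.\<close>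

lemma cone_Lip1:
  assumes r: "0 < r" "r < R"
  shows "cone_fun \<Omega> r \<in> Lip1 \<Omega>" "\<Lambda> > 0 \<Longrightarrow> J \<Omega> \<Lambda> (cone_fun \<Omega> r) \<le> \<Lambda> * vol \<Omega> + (1 / r - \<Lambda> * V r)"
    "\<not> cone_fun \<Omega> r constant_on closure \<Omega>"
proof -
  let ?u = "cone_fun \<Omega> r"
  have cvx: "convex_on \<Omega> ?u"
  proof (rule convex_onI)
    fix t :: real and x y assume t: "0 < t" "t < 1" and xy: "x \<in> \<Omega>" "y \<in> \<Omega>"
    have "((1 - t) * d x + t * d y) / r \<le> d ((1 - t) *\<^sub>R x + t *\<^sub>R y) / r"
      using d_concave[of x y t] t xy r by (intro divide_right_mono) auto
    then have "1 - d ((1 - t) *\<^sub>R x + t *\<^sub>R y) / r \<le> (1 - t) * (1 - d x / r) + t * (1 - d y / r)"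
      by (simp add: algebra_simps add_divide_distrib diff_divide_distrib)
    also have "\<dots> \<le> (1 - t) * ?u x + t * ?u y"
      using t by (intro add_mono mult_left_mono) (auto simp: cone_fun_def)
    finally have "1 - d ((1 - t) *\<^sub>R x + t *\<^sub>R y) / r \<le> (1 - t) * ?u x + t * ?u y" .
    moreover have "0 \<le> (1 - t) * ?u x + t * ?u y" using t by (auto simp: cone_fun_def)
    ultimately show "?u ((1 - t) *\<^sub>R x + t *\<^sub>R y) \<le> (1 - t) * ?u x + t * ?u y"
      by (simp add: cone_fun_def[of \<Omega> r "(1 - t) *\<^sub>R x + t *\<^sub>R y"])
  qed (rule \<Omega>(4))
  have lip: "\<bar>?u x - ?u y\<bar> \<le> 1 / r * norm (x - y)" for x y
  proof -
    have "\<bar>?u x - ?u y\<bar> \<le> \<bar>d x / r - d y / r\<bar>" by (auto simp: cone_fun_def max_def abs_if)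
    also have "\<dots> = \<bar>d x - d y\<bar> / r" using r by (simp add: diff_divide_distrib[symmetric])
    also have "\<dots> \<le> norm (x - y) / r" using d_lipschitz[of x y] r by (intro divide_right_mono) (auto simp: dist_norm)
    finally show ?thesis by simp
  qed
  have W: "?u \<in> W1inf \<Omega>"
    by (rule convex_lipschitz_in_W1inf[OF \<Omega>(2,3) cvx, of "1/r"]) (use r lip in auto)
  have c: "continuous_on S ?u" for S
    unfolding cone_fun_def[abs_def] using r by (intro continuous_intros) auto
  show L: "?u \<in> Lip1 \<Omega>"
    using W c by (auto simp: Lip1_def) (auto simp: cone_fun_def)
  have g: "grad_norm \<Omega> ?u \<le> 1 / r"
    by (subst grad_norm_le_iff[OF \<Omega>(2,3,1,4) W c]) (use r lip in auto)
  have "{x \<in> \<Omega>. ?u x > 0} = boundary_layer \<Omega> r"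
    unfolding boundary_layer_eq[OF r] using r by (auto simp: cone_fun_def less_max_iff_disj)
  then have veq: "vol {x \<in> \<Omega>. ?u x > 0} = vol \<Omega> - V r" by (simp only: vol_boundary_layer[OF r])
  show "\<Lambda> > 0 \<Longrightarrow> J \<Omega> \<Lambda> ?u \<le> \<Lambda> * vol \<Omega> + (1 / r - \<Lambda> * V r)"
    unfolding J_def veq using g by (simp add: algebra_simps)
  show "\<not> ?u constant_on closure \<Omega>"
  proof
    assume "?u constant_on closure \<Omega>"
    then obtain k where k: "\<And>x. x \<in> closure \<Omega> \<Longrightarrow> ?u x = k" by (auto simp: constant_on_def)
    obtain x0 where x0: "x0 \<in> \<Omega>" "d x0 = R" using inradius_attained by metis
    obtain z where z: "z \<in> frontier \<Omega>" using frontier_ne by auto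
    have "x0 \<in> closure \<Omega>" "z \<in> closure \<Omega>" using x0 z closure_Un_frontier by blast+
    then have "?u x0 = ?u z" using k by simp
    then show False using x0 z r by (simp add: cone_fun_def)
  qed
qed

text \<open>The cases are distinguished by the Lipschitz constant. If it is 0, \<open>u\<close> is
  constant; if it is positive but at most \<open>1 / R\<close>, positivity fails at most on a null
  set while the gradient still costs; if it is larger, its inverse is a radius in the range of the
  one-dimensional problem.\<close>

lemma J_lower_bound:
  assumes u: "u \<in> Lip1 \<Omega>" and \<Lambda>: "\<Lambda> > 0"
  obtains (const) "\<And>x. x \<in> closure \<Omega> \<Longrightarrow> u x = 1" "J \<Omega> \<Lambda> u = \<Lambda> * vol \<Omega>"
    | (flat) "J \<Omega> \<Lambda> u > \<Lambda> * vol \<Omega>"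
    | (steep) r where "0 < r" "r < R" "grad_norm \<Omega> u = 1 / r" "J \<Omega> \<Lambda> u \<ge> \<Lambda> * vol \<Omega> + (1 / r - \<Lambda> * V r)"
       "J \<Omega> \<Lambda> u = \<Lambda> * vol \<Omega> + (1 / r - \<Lambda> * V r) \<Longrightarrow> {x \<in> \<Omega>. u x > 0} = boundary_layer \<Omega> r"
proof -
  let ?L = "grad_norm \<Omega> u" and ?U = "{x \<in> \<Omega>. u x > 0}"
  note fs = Lip1_facts[OF u] and ms = positivity_set_lmeasurable[OF u]
  have inU: "x \<in> ?U" if "x \<in> \<Omega>" "?L * d x < 1" for x
    using fs(2)[of x] that closure_subset by force
  consider "?L = 0" | "?L > 0" "?L * R \<le> 1" | "?L * R > 1" using fs(1) by linarith
  then show ?thesis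
  proof cases
    case 1
    have "?U = \<Omega>" using fs(3)[OF 1] closure_subset by force
    then have "J \<Omega> \<Lambda> u = \<Lambda> * vol \<Omega>" by (simp add: J_def 1)
    then show ?thesis using const fs(3)[OF 1] by blast
  next
    case 2
    \<comment> \<open>Only points at the maximal distance \<open>R\<close> can be zeros of
      \<open>u\<close>, and these form a null set.\<close>
    have "\<Omega> - K R \<subseteq> ?U"
    proof
      fix x assume x: "x \<in> \<Omega> - K R"
      then have "d x < R" by (auto simp: K_def)
      then have "?L * d x < ?L * R" using 2 by simp
      then have "?L * d x < 1" using 2 by linarith
      then show "x \<in> ?U" using inU[of x] x by blast
    qed
    then have "\<Omega> \<subseteq> ?U \<union> K R" by auto
    then have "vol \<Omega> \<le> vol (?U \<union> K R)"
      using ms negligible_K_inradius \<Omega>_lmeasurable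
      by (intro measure_mono_fmeasurable) (auto intro: fmeasurable.Un negligible_imp_measurable fmeasurableD)
    also have "\<dots> = vol ?U"
      using ms negligible_K_inradius by (simp add: measure_Un_null_set negligible_iff_null_sets fmeasurableD)
    finally have "\<Lambda> * vol \<Omega> \<le> \<Lambda> * vol ?U" using \<Lambda> by simp
    then show ?thesis using flat 2 by (simp add: J_def)
  next
    case 3
    have L0: "?L > 0" using 3 R_pos fs(1) by (auto simp: less_le)
    define r where "r = 1 / ?L"
    have r: "0 < r" "r < R" "?L = 1 / r" using 3 L0 by (auto simp: r_def field_simps)
    have sub: "boundary_layer \<Omega> r \<subseteq> ?U"
      unfolding boundary_layer_eq[OF r(1,2)] using inU r by (auto simp: field_simps)
    have bl: "boundary_layer \<Omega> r \<in> lmeasurable"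
      unfolding boundary_layer_def closure_inner_set[OF r(1,2)]
      using \<Omega>_lmeasurable lmeasurable_compact[OF compact_K[OF r(1)]] by (intro fmeasurable.Diff)
    have le: "vol \<Omega> - V r \<le> vol ?U"
      unfolding vol_boundary_layer[OF r(1,2), symmetric] using sub bl ms by (intro measure_mono_fmeasurable) (auto intro: fmeasurableD)
    have Jeq: "J \<Omega> \<Lambda> u = 1 / r + \<Lambda> * vol ?U" by (simp add: J_def r(3))
    have "\<Lambda> * (vol \<Omega> - V r) \<le> \<Lambda> * vol ?U" using le \<Lambda> by simp
    then have lower: "J \<Omega> \<Lambda> u \<ge> \<Lambda> * vol \<Omega> + (1 / r - \<Lambda> * V r)" by (simp add: Jeq algebra_simps)
    have "?U = boundary_layer \<Omega> r" if eq: "J \<Omega> \<Lambda> u = \<Lambda> * vol \<Omega> + (1 / r - \<Lambda> * V r)"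
    proof (rule ccontr)
      assume "?U \<noteq> boundary_layer \<Omega> r"
      then obtain x where x: "x \<in> ?U" "x \<notin> boundary_layer \<Omega> r" using sub by auto
      then have "x \<in> closure (inner_set \<Omega> r)" by (auto simp: boundary_layer_def)
      \<comment> \<open>The positivity set is open, so a point of it in the closure of the inner set
        forces an open intersection with the inner set. That intersection has positive volume and
        makes the estimate strict.\<close>
      then have ne: "?U \<inter> inner_set \<Omega> r \<noteq> {}" using x(1) ms(1) by (metis (no_types, lifting) open_Int_closure_eq_empty disjoint_iff)
      let ?W = "?U \<inter> inner_set \<Omega> r"
      have oW: "open ?W" using ms(1) open_inner_set by (rule open_Int)
      have lW: "?W \<in> lmeasurable" using ms(2) inner_set_lmeasurable by (rule fmeasurable_Int_fmeasurable[OF _ fmeasurableD])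
      have "vol ?W > 0"
        using open_not_negligible[OF oW ne] negligible_iff_measure[of ?W] lW measure_nonneg[of lebesgue ?W] by (metis less_eq_real_def)
      moreover have "boundary_layer \<Omega> r \<inter> ?W = {}" using closure_subset by (auto simp: boundary_layer_def)
      then have "vol (boundary_layer \<Omega> r \<union> ?W) = vol (boundary_layer \<Omega> r) + vol ?W"
        using bl lW by (simp add: measure_Un3)
      moreover have "vol (boundary_layer \<Omega> r \<union> ?W) \<le> vol ?U"
        using sub bl lW ms by (intro measure_mono_fmeasurable) (auto intro: fmeasurableD fmeasurable.Un)
      ultimately have "vol \<Omega> - V r < vol ?U" using vol_boundary_layer[OF r(1,2)] by simp
      then have "\<Lambda> * (vol \<Omega> - V r) < \<Lambda> * vol ?U" using \<Lambda> by simp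
      then show False using eq by (simp add: Jeq algebra_simps)
    qed
    then show ?thesis using steep[OF r lower] by blast
  qed
qed

section \<open>Minimizers below and above the critical parameter\<close>

lemma solution_iff: "solution \<Omega> \<Lambda> u \<longleftrightarrow> u \<in> Lip1 \<Omega> \<and> (\<forall>w\<in>Lip1 \<Omega>. J \<Omega> \<Lambda> u \<le> J \<Omega> \<Lambda> w)"
  by (auto simp: solution_def is_arg_min_def not_less)

text \<open>As \<open>rs * V rs\<close> is the maximum of \<open>r * V r\<close>, the term
  \<open>1 / r - \<Lambda> * V r\<close> is positive for all admissible radii, so every nonconstant
  competitor costs strictly more than the constant.\<close>

lemma subcritical:
  assumes rs: "critical_radius \<Omega> rs" and \<Lambda>: "0 < \<Lambda>" "\<Lambda> < 1 / (rs * V rs)"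
  shows "solution \<Omega> \<Lambda> (\<lambda>_. 1)" "solution \<Omega> \<Lambda> u \<Longrightarrow> x \<in> closure \<Omega> \<Longrightarrow> u x = 1"
proof -
  have pos: "1 / r - \<Lambda> * V r > 0" if r: "0 < r" "r < R" for r
  proof -
    have "r * V r \<le> rs * V rs" using rV_less[OF rs, of r] r by (cases "r = rs") auto
    then have "\<Lambda> * (r * V r) \<le> \<Lambda> * (rs * V rs)" using \<Lambda> by simp
    also have "\<dots> < 1" using \<Lambda> rs_bounds[OF rs] V_pos[of rs] by (simp add: field_simps)
    finally show ?thesis using r by (simp add: field_simps)
  qed
  have low: "J \<Omega> \<Lambda> w \<ge> \<Lambda> * vol \<Omega>" "J \<Omega> \<Lambda> w \<le> \<Lambda> * vol \<Omega> \<Longrightarrow> y \<in> closure \<Omega> \<Longrightarrow> w y = 1" if w: "w \<in> Lip1 \<Omega>" for w y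
    by (rule J_lower_bound[OF w \<Lambda>(1)]; use pos in force)+
  show "solution \<Omega> \<Lambda> (\<lambda>_. 1)" unfolding solution_iff J_one using one_Lip1 low(1) by blast
  assume u: "solution \<Omega> \<Lambda> u" "x \<in> closure \<Omega>"
  then have "u \<in> Lip1 \<Omega>" "J \<Omega> \<Lambda> u \<le> \<Lambda> * vol \<Omega>" using one_Lip1 J_one[of \<Lambda>] unfolding solution_iff by auto
  then show "u x = 1" using low(2) u(2) by blast
qed

text \<open>At the optimal radius \<rho> the term \<open>1 / \<rho> - \<Lambda> * V \<rho>\<close>
  is nonpositive, and it vanishes only for the critical parameter; its sign decides between the
  constant and the cone function. A nonconstant minimizer attains the same value, which fixes both
  its radius and its positivity set.\<close>

lemma supercritical:
  assumes rs: "critical_radius \<Omega> rs" and \<Lambda>: "\<Lambda> \<ge> 1 / (rs * V rs)"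
  shows "r_Lambda \<Omega> \<Lambda> \<in> roots \<Omega> \<Lambda>" "r \<in> roots \<Omega> \<Lambda> \<Longrightarrow> r_Lambda \<Omega> \<Lambda> \<le> r"
    "nonconst_solution \<Omega> \<Lambda> (cone_fun \<Omega> (r_Lambda \<Omega> \<Lambda>))"
    "solution \<Omega> \<Lambda> (\<lambda>_. 1) \<longleftrightarrow> \<Lambda> = 1 / (rs * V rs)"
    "\<Lambda> = 1 / (rs * V rs) \<Longrightarrow> r_Lambda \<Omega> \<Lambda> = rs"
    "nonconst_solution \<Omega> \<Lambda> v \<Longrightarrow> grad_norm \<Omega> v = 1 / r_Lambda \<Omega> \<Lambda> \<and>
       {x \<in> \<Omega>. v x > 0} = boundary_layer \<Omega> (r_Lambda \<Omega> \<Lambda>)"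
proof -
  let ?L = "1 / (rs * V rs)" and ?G = "\<lambda>r. 1 / r - \<Lambda> * V r"
  note b = rs_bounds[OF rs]
  have Vs: "V rs > 0" using V_pos b by simp
  have L0: "?L > 0" using Vs b by simp
  have L: "\<Lambda> > 0" using L0 \<Lambda> by linarith
  obtain \<rho> where \<rho>: "0 < \<rho>" "\<rho> \<le> rs" "\<rho> \<in> roots \<Omega> \<Lambda>" "\<And>r. r \<in> roots \<Omega> \<Lambda> \<Longrightarrow> \<rho> \<le> r"
    "\<And>r. 0 < r \<Longrightarrow> r < R \<Longrightarrow> r \<noteq> \<rho> \<Longrightarrow> ?G \<rho> < ?G r" "\<Lambda> = ?L \<Longrightarrow> \<rho> = rs"
    by (rule optimal_radius[OF rs \<Lambda>]) blast
  have rL: "r_Lambda \<Omega> \<Lambda> = \<rho>" unfolding r_Lambda_def using \<rho>(3,4) by (rule Least_equality)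
  show "r_Lambda \<Omega> \<Lambda> \<in> roots \<Omega> \<Lambda>" "r \<in> roots \<Omega> \<Lambda> \<Longrightarrow> r_Lambda \<Omega> \<Lambda> \<le> r" unfolding rL using \<rho> by auto
  show "\<Lambda> = ?L \<Longrightarrow> r_Lambda \<Omega> \<Lambda> = rs" unfolding rL using \<rho> by auto
  have \<rho>R: "\<rho> < R" using \<rho>(2) b by simp
  \<comment> \<open>This uses \<open>1 / rs = ?L * V rs\<close>, the definition of
    \<open>?L\<close>.\<close>
  have Gs: "?G rs = (?L - \<Lambda>) * V rs" using Vs by (simp add: left_diff_distrib)
  have G\<rho>s: "?G \<rho> \<le> ?G rs" using \<rho>(5)[of rs] b by (cases "rs = \<rho>") auto
  have Gle: "?G \<rho> \<le> 0"
  proof -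
    have "(?L - \<Lambda>) * V rs \<le> 0" using \<Lambda> Vs by (intro mult_nonpos_nonneg) auto
    then show ?thesis using G\<rho>s Gs by linarith
  qed
  have Geq: "?G \<rho> = 0 \<longleftrightarrow> \<Lambda> = ?L"
  proof
    assume "?G \<rho> = 0"
    then have "(?L - \<Lambda>) * V rs \<ge> 0" using G\<rho>s Gs by linarith
    then show "\<Lambda> = ?L" using Vs \<Lambda> by (simp add: zero_le_mult_iff)
  next
    assume "\<Lambda> = ?L"
    then show "?G \<rho> = 0" using \<rho>(6) Gs by auto
  qed
  have Jc: "J \<Omega> \<Lambda> (cone_fun \<Omega> \<rho>) \<le> \<Lambda> * vol \<Omega> + ?G \<rho>" by (rule cone_Lip1(2)[OF \<rho>(1) \<rho>R L])
  have low: "\<Lambda> * vol \<Omega> + ?G \<rho> \<le> J \<Omega> \<Lambda> w" if w: "w \<in> Lip1 \<Omega>" for w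
  proof (rule J_lower_bound[OF w L])
    fix r assume r: "0 < r" "r < R" "J \<Omega> \<Lambda> w \<ge> \<Lambda> * vol \<Omega> + ?G r"
    have "?G \<rho> \<le> ?G r" using \<rho>(5)[OF r(1,2)] by (cases "r = \<rho>") auto
    then show ?thesis using r(3) by linarith
  qed (use Gle in linarith)+
  show "nonconst_solution \<Omega> \<Lambda> (cone_fun \<Omega> (r_Lambda \<Omega> \<Lambda>))"
    unfolding rL nonconst_solution_def solution_iff
    using cone_Lip1(1,3)[OF \<rho>(1) \<rho>R] Jc low order_trans by blast
  have Jc_eq: "J \<Omega> \<Lambda> (cone_fun \<Omega> \<rho>) = \<Lambda> * vol \<Omega> + ?G \<rho>"
    using Jc low[OF cone_Lip1(1)[OF \<rho>(1) \<rho>R]] by linarith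
  have "solution \<Omega> \<Lambda> (\<lambda>_. 1) \<longleftrightarrow> ?G \<rho> = 0"
  proof
    assume "solution \<Omega> \<Lambda> (\<lambda>_. 1)"
    then have "J \<Omega> \<Lambda> (\<lambda>_. 1) \<le> J \<Omega> \<Lambda> (cone_fun \<Omega> \<rho>)" using cone_Lip1(1)[OF \<rho>(1) \<rho>R] by (simp add: solution_iff)
    then show "?G \<rho> = 0" using Jc Gle J_one[of \<Lambda>] by linarith
  next
    assume "?G \<rho> = 0"
    then show "solution \<Omega> \<Lambda> (\<lambda>_. 1)" unfolding solution_iff J_one using one_Lip1 low by simp
  qed
  then show "solution \<Omega> \<Lambda> (\<lambda>_. 1) \<longleftrightarrow> \<Lambda> = ?L" using Geq by simp
  assume v: "nonconst_solution \<Omega> \<Lambda> v"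
  have vL: "v \<in> Lip1 \<Omega>" using v by (simp add: nonconst_solution_def solution_iff)
  have vJ: "J \<Omega> \<Lambda> v = \<Lambda> * vol \<Omega> + ?G \<rho>"
  proof (rule antisym)
    show "J \<Omega> \<Lambda> v \<le> \<Lambda> * vol \<Omega> + ?G \<rho>"
      unfolding Jc_eq[symmetric] using v cone_Lip1(1)[OF \<rho>(1) \<rho>R] by (auto simp: nonconst_solution_def solution_iff)
  qed (rule low[OF vL])
  have "grad_norm \<Omega> v = 1 / \<rho> \<and> {x \<in> \<Omega>. v x > 0} = boundary_layer \<Omega> \<rho>"
  proof (rule J_lower_bound[OF vL L])
    assume "\<And>x. x \<in> closure \<Omega> \<Longrightarrow> v x = 1"
    then have "v constant_on closure \<Omega>" by (auto simp: constant_on_def)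
    then show ?thesis using v by (simp add: nonconst_solution_def)
  next
    assume "J \<Omega> \<Lambda> v > \<Lambda> * vol \<Omega>"
    then show ?thesis using vJ Gle by linarith
  next
    fix r assume r: "0 < r" "r < R" "grad_norm \<Omega> v = 1 / r" "J \<Omega> \<Lambda> v \<ge> \<Lambda> * vol \<Omega> + ?G r"
      "J \<Omega> \<Lambda> v = \<Lambda> * vol \<Omega> + ?G r \<Longrightarrow> {x \<in> \<Omega>. v x > 0} = boundary_layer \<Omega> r"
    \<comment> \<open>The minimum over radii is strict, so the radius read off from the gradient
      norm of \<open>v\<close> must be \<rho>. The lower bound then holds with equality and yields
      the positivity set.\<close>
    have "r = \<rho>" using \<rho>(5)[OF r(1,2)] r(4) vJ by force
    then show ?thesis using r vJ by simp
  qed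
  then show "grad_norm \<Omega> v = 1 / r_Lambda \<Omega> \<Lambda> \<and> {x \<in> \<Omega>. v x > 0} = boundary_layer \<Omega> (r_Lambda \<Omega> \<Lambda>)"
    unfolding rL .
qed

text \<open>The parameters that admit nonconstant solutions form the closed half-line starting at
  the critical one, so the infimum is attained.\<close>

lemma Lambda_inf_eq:
  assumes rs: "critical_radius \<Omega> rs"
  shows "Lambda_inf \<Omega> = 1 / (rs * V rs)"
proof -
  let ?L = "1 / (rs * V rs)"
  have L0: "?L > 0" using V_pos rs_bounds[OF rs] by simp
  have "{\<Lambda>. 0 < \<Lambda> \<and> (\<exists>u. nonconst_solution \<Omega> \<Lambda> u)} = {?L..}"
  proof (intro equalityI subsetI)
    fix \<Lambda> assume "\<Lambda> \<in> {\<Lambda>. 0 < \<Lambda> \<and> (\<exists>u. nonconst_solution \<Omega> \<Lambda> u)}"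
    then obtain u where u: "0 < \<Lambda>" "solution \<Omega> \<Lambda> u" "\<not> u constant_on closure \<Omega>" by (auto simp: nonconst_solution_def)
    show "\<Lambda> \<in> {?L..}"
    proof (rule ccontr)
      assume "\<Lambda> \<notin> {?L..}"
      then have "\<And>x. x \<in> closure \<Omega> \<Longrightarrow> u x = 1" using subcritical(2)[OF rs u(1) _ u(2)] by simp
      then show False using u(3) by (auto simp: constant_on_def)
    qed
  next
    fix \<Lambda> assume "\<Lambda> \<in> {?L..}"
    then show "\<Lambda> \<in> {\<Lambda>. 0 < \<Lambda> \<and> (\<exists>u. nonconst_solution \<Omega> \<Lambda> u)}"
      using supercritical(3)[OF rs, of \<Lambda>] less_le_trans[OF L0, of \<Lambda>] by auto
  qed
  then show ?thesis by (simp add: Lambda_inf_def)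
qed

end

theorem theorem1:
  fixes \<Omega> :: "(real ^ 'n) set"
  assumes dim: "CARD('n) \<ge> 2"
    and \<Omega>: "\<Omega> \<noteq> {}" "open \<Omega>" "bounded \<Omega>" "convex \<Omega>"
  shows "(\<exists>!r. critical_radius \<Omega> r) \<and>
    (\<forall>rs \<Lambda>s. critical_radius \<Omega> rs \<and> \<Lambda>s = 1 / (rs * vol (inner_set \<Omega> rs)) \<longrightarrow>
      Lambda_inf \<Omega> = \<Lambda>s \<and>
      (\<forall>\<Lambda>. 0 < \<Lambda> \<and> \<Lambda> < \<Lambda>s \<longrightarrow>
         solution \<Omega> \<Lambda> (\<lambda>_. 1) \<and>
         (\<forall>u. solution \<Omega> \<Lambda> u \<longrightarrow> (\<forall>x\<in>closure \<Omega>. u x = 1))) \<and>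
      solution \<Omega> \<Lambda>s (\<lambda>_. 1) \<and> nonconst_solution \<Omega> \<Lambda>s (cone_fun \<Omega> rs) \<and>
      (\<forall>\<Lambda>>\<Lambda>s.
         \<not> solution \<Omega> \<Lambda> (\<lambda>_. 1) \<and>
         r_Lambda \<Omega> \<Lambda> \<in> roots \<Omega> \<Lambda> \<and> (\<forall>r\<in>roots \<Omega> \<Lambda>. r_Lambda \<Omega> \<Lambda> \<le> r) \<and>
         nonconst_solution \<Omega> \<Lambda> (cone_fun \<Omega> (r_Lambda \<Omega> \<Lambda>))) \<and>
      r_Lambda \<Omega> \<Lambda>s = rs \<and>
      (\<forall>\<Lambda>\<ge>\<Lambda>s. \<forall>v. nonconst_solution \<Omega> \<Lambda> v \<longrightarrow>
         grad_norm \<Omega> v = 1 / r_Lambda \<Omega> \<Lambda> \<and>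
         {x\<in>\<Omega>. v x > 0} = boundary_layer \<Omega> (r_Lambda \<Omega> \<Lambda>)))"
proof -
  interpret convex_domain \<Omega> by unfold_locales (fact assms)+
  have main: "Lambda_inf \<Omega> = \<Lambda>s \<and>
      (\<forall>\<Lambda>. 0 < \<Lambda> \<and> \<Lambda> < \<Lambda>s \<longrightarrow>
         solution \<Omega> \<Lambda> (\<lambda>_. 1) \<and>
         (\<forall>u. solution \<Omega> \<Lambda> u \<longrightarrow> (\<forall>x\<in>closure \<Omega>. u x = 1))) \<and>
      solution \<Omega> \<Lambda>s (\<lambda>_. 1) \<and> nonconst_solution \<Omega> \<Lambda>s (cone_fun \<Omega> rs) \<and>
      (\<forall>\<Lambda>>\<Lambda>s.
         \<not> solution \<Omega> \<Lambda> (\<lambda>_. 1) \<and>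
         r_Lambda \<Omega> \<Lambda> \<in> roots \<Omega> \<Lambda> \<and> (\<forall>r\<in>roots \<Omega> \<Lambda>. r_Lambda \<Omega> \<Lambda> \<le> r) \<and>
         nonconst_solution \<Omega> \<Lambda> (cone_fun \<Omega> (r_Lambda \<Omega> \<Lambda>))) \<and>
      r_Lambda \<Omega> \<Lambda>s = rs \<and>
      (\<forall>\<Lambda>\<ge>\<Lambda>s. \<forall>v. nonconst_solution \<Omega> \<Lambda> v \<longrightarrow>
         grad_norm \<Omega> v = 1 / r_Lambda \<Omega> \<Lambda> \<and>
         {x\<in>\<Omega>. v x > 0} = boundary_layer \<Omega> (r_Lambda \<Omega> \<Lambda>))"
    if rs: "critical_radius \<Omega> rs" and \<Lambda>s: "\<Lambda>s = 1 / (rs * V rs)" for rs \<Lambda>s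
  proof (intro conjI)
    note sup = supercritical[OF rs, folded \<Lambda>s] and sub = subcritical[OF rs, folded \<Lambda>s]
    show "Lambda_inf \<Omega> = \<Lambda>s" unfolding \<Lambda>s by (rule Lambda_inf_eq[OF rs])
    show "solution \<Omega> \<Lambda>s (\<lambda>_. 1)" using sup(4)[of \<Lambda>s] by simp
    show rL: "r_Lambda \<Omega> \<Lambda>s = rs" using sup(5)[of \<Lambda>s] by simp
    show "nonconst_solution \<Omega> \<Lambda>s (cone_fun \<Omega> rs)" using sup(3)[of \<Lambda>s] rL by simp
    show "\<forall>\<Lambda>. 0 < \<Lambda> \<and> \<Lambda> < \<Lambda>s \<longrightarrow>
         solution \<Omega> \<Lambda> (\<lambda>_. 1) \<and> (\<forall>u. solution \<Omega> \<Lambda> u \<longrightarrow> (\<forall>x\<in>closure \<Omega>. u x = 1))"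
      using sub by blast
    show "\<forall>\<Lambda>>\<Lambda>s. \<not> solution \<Omega> \<Lambda> (\<lambda>_. 1) \<and>
         r_Lambda \<Omega> \<Lambda> \<in> roots \<Omega> \<Lambda> \<and> (\<forall>r\<in>roots \<Omega> \<Lambda>. r_Lambda \<Omega> \<Lambda> \<le> r) \<and>
         nonconst_solution \<Omega> \<Lambda> (cone_fun \<Omega> (r_Lambda \<Omega> \<Lambda>))"
      using sup(1-4) by (metis less_imp_le less_irrefl)
    show "\<forall>\<Lambda>\<ge>\<Lambda>s. \<forall>v. nonconst_solution \<Omega> \<Lambda> v \<longrightarrow>
         grad_norm \<Omega> v = 1 / r_Lambda \<Omega> \<Lambda> \<and> {x\<in>\<Omega>. v x > 0} = boundary_layer \<Omega> (r_Lambda \<Omega> \<Lambda>)"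
      using sup(6) by blast
  qed
  show ?thesis
    by (rule conjI[OF ex1_critical_radius], intro allI impI, elim conjE, rule main; assumption)
qed

end
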